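(* Let $n,m\ge1$ and let $w$ be an assignment of positive real conductances to the edges of $N(m)$. Then the set of assignments $w'$ of positive real conductances to the edges of $N(m)$ whose universal response matrix equals that of $(N(m),w)$ is exactly the orbit of $w$ under the action of $S_m$ generated by the electrical $R$-matrices $R_{j,j+1}$, $1\le j\le m-1$. In particular, for generic $w$ there are exactly $m!$ such assignments.
   Context: $N(m)$: the cylindrical network with vertices $M^{(k)}_i$ ($0\le k\le m$, $i\in\mathbb{Z}/n$), boundary vertices $M^{(0)}_i=i$ and $M^{(m)}_i=i'$, other vertices interior, and edges $M^{(k)}_i$–$M^{(k+1)}_i$ and $M^{(k)}_i$–$M^{(k+1)}_{i-1}$, $0\le k\le m-1$. $R_{j,j+1}$ applies the electrical $R$-matrix to the sub-network on columns $j-1,j,j+1$, viewed as a copy of $N(2)$ with $M^{(j-1)}_k,M^{(j)}_k,M^{(j+1)}_k$ in the roles of $k,M_k,k'$, and leaves other conductances unchanged; the $R_{j,j+1}$ satisfy $R_{j,j+1}^2=\mathrm{id}$ and the braid relations, giving an $S_m$-action. In $N(2)$ with conductances $a_k$ on $k$–$M_{k-1}$, $b_k$ on $k$–$M_k$, $c_k$ on $M_{k-1}$–$(k-1)'$, $d_k$ on $M_k$–$(k-1)'$ (indices mod $n$), the electrical $R$-matrix replaces them by $\tau_k/(c_k\kappa_k)$ on $k$–$M_{k-1}$, $\tau_k/(a_k\kappa_k)$ on $M_{k-1}$–$(k-1)'$, $\tau_{k+1}/(d_k\kappa_k)$ on $k$–$M_k$, $\tau_{k+1}/(b_k\kappa_k)$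 on $M_k$–$(k-1)'$, where (empty products $=1$) $\tau_i=\sum_{j=0}^{n-1}\Big((a_{i+j}+c_{i+j})\prod_{k=i}^{i+j-1}(a_kc_k)\prod_{k=i+j}^{i+n-1}(b_kd_k)+(b_{i+j}+d_{i+j})\prod_{k=i}^{i+j}(a_kc_k)\prod_{k=i+j+1}^{i+n-1}(b_kd_k)\Big)$, $\kappa_i=(a_i+c_i)\prod_{k=i+1}^{i+n-1}(a_kc_k)+(b_i+d_i)\prod_{k=i+1}^{i+n-1}(b_kd_k)+\sum_{j=1}^{n-1}\Big((a_{i+j}+c_{i+j})\prod_{k=i+1}^{i+j-1}(a_kc_k)\prod_{k=i+j}^{i+n-1}(b_kd_k)+(b_{i+j}+d_{i+j})\prod_{k=i+1}^{i+j}(a_kc_k)\prod_{k=i+j+1}^{i+n-1}(b_kd_k)\Big)$. Universal response matrix: lift the network to the universal cover $G(\infty)$ of the cylinder (an infinite strip); for finite vertex sets $V_1\subseteq V_2\subseteq\cdots$ exhausting $G(\infty)$ let $G(N)$ consist of all edges incident to $V_N$, a vertex being interior iff in $V_N$ and interior in $G(\infty)$; with $L(G(N))$ the Schur complement of the Kirchhoff matrix ($K_{uv}=\sum_{e\text{ joins }u,v}w(e)$, $u\ne v$; $K_{uu}=-\sum_{e\ni u}w(e)$) with respect to interior vertices, set $\mathcal{L}_{uv}=\lim_N L_{uv}(G(N))$ for boundary vertices $u,v$ of $G(\infty)$. *)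

theory Defs
  imports Complex_Main "HOL-Algebra.Sym_Groups" "HOL-Algebra.Group_Action"
begin

section \<open>The cylindrical network and its universal cover\<close>

text \<open>
  The vertex \<open>M\<^bsup>(k)\<^esup>\<^sub>i\<close> is the pair \<open>(k, i)\<close>. \<open>Straight k i\<close> is the edge joining
  \<open>M\<^bsup>(k)\<^esup>\<^sub>i\<close> and \<open>M\<^bsup>(k+1)\<^esup>\<^sub>i\<close>; \<open>Diagonal k i\<close> is the edge joining \<open>M\<^bsup>(k)\<^esup>\<^sub>i\<close> and
  \<open>M\<^bsup>(k+1)\<^esup>\<^bsub>i-1\<^esub>\<close>. The same labels are used on the cylinder, where \<open>i\<close> ranges over the
  representatives \<open>0, \<dots>, n - 1\<close> of the residues modulo \<open>n\<close>, and on the universal cover, where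
  \<open>i\<close> ranges over all integers. Edges are labels rather than pairs of end points because for
  \<open>n = 1\<close> the network on the cylinder has parallel edges.
\<close>

datatype edge = Straight nat int | Diagonal nat int

definition edges :: "nat \<Rightarrow> nat \<Rightarrow> edge set" where
  "edges n m = {Straight k i | k i. k < m \<and> 0 \<le> i \<and> i < int n} \<union>
               {Diagonal k i | k i. k < m \<and> 0 \<le> i \<and> i < int n}"

definition conductances :: "nat \<Rightarrow> nat \<Rightarrow> (edge \<Rightarrow> real) set" where
  "conductances n m = edges n m \<rightarrow>\<^sub>E {0<..}"

definition cover_vertices :: "nat \<Rightarrow> (nat \<times> int) set" where
  "cover_vertices m = {0..m} \<times> UNIV"

definition cover_boundary :: "nat \<Rightarrow> (nat \<times> int) set" where
  "cover_boundary m = {0, m} \<times> UNIV"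

definition cover_edges :: "nat \<Rightarrow> edge set" where
  "cover_edges m = {Straight k i | k i. k < m} \<union> {Diagonal k i | k i. k < m}"

fun cover_ends :: "edge \<Rightarrow> (nat \<times> int) set" where
  "cover_ends (Straight k i) = {(k, i), (k + 1, i)}"
| "cover_ends (Diagonal k i) = {(k, i), (k + 1, i - 1)}"

fun covering :: "nat \<Rightarrow> edge \<Rightarrow> edge" where
  "covering n (Straight k i) = Straight k (i mod int n)"
| "covering n (Diagonal k i) = Diagonal k (i mod int n)"

definition lift :: "nat \<Rightarrow> (edge \<Rightarrow> real) \<Rightarrow> edge \<Rightarrow> real" where
  "lift n w e = w (covering n e)"


section \<open>The universal response matrix\<close>

definition kirchhoff :: "edge set \<Rightarrow> (edge \<Rightarrow> real) \<Rightarrow> nat \<times> int \<Rightarrow> nat \<times> int \<Rightarrow> real" where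
  "kirchhoff E c u v =
     (if u = v then - (\<Sum>e | e \<in> E \<and> u \<in> cover_ends e. c e)
      else (\<Sum>e | e \<in> E \<and> cover_ends e = {u, v}. c e))"

definition inverse_matrix_on :: "'v set \<Rightarrow> ('v \<Rightarrow> 'v \<Rightarrow> real) \<Rightarrow> ('v \<Rightarrow> 'v \<Rightarrow> real)" where
  "inverse_matrix_on I A = (THE B.
     (\<forall>x y. x \<notin> I \<or> y \<notin> I \<longrightarrow> B x y = 0) \<and>
     (\<forall>x\<in>I. \<forall>y\<in>I. (\<Sum>z\<in>I. A x z * B z y) = of_bool (x = y)) \<and>
     (\<forall>x\<in>I. \<forall>y\<in>I. (\<Sum>z\<in>I. B x z * A z y) = of_bool (x = y)))"

definition schur_complement ::
    "'v set \<Rightarrow> ('v \<Rightarrow> 'v \<Rightarrow> real) \<Rightarrow> 'v \<Rightarrow> 'v \<Rightarrow> real" where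
  "schur_complement I A u v =
     A u v - (\<Sum>x\<in>I. \<Sum>y\<in>I. A u x * inverse_matrix_on I A x y * A y v)"

definition truncated_response ::
    "nat \<Rightarrow> nat \<Rightarrow> (edge \<Rightarrow> real) \<Rightarrow> (nat \<times> int) set \<Rightarrow> nat \<times> int \<Rightarrow> nat \<times> int \<Rightarrow> real" where
  "truncated_response n m w V =
     schur_complement (V - cover_boundary m)
       (kirchhoff {e \<in> cover_edges m. cover_ends e \<inter> V \<noteq> {}} (lift n w))"

definition exhaustion :: "nat \<Rightarrow> (nat \<Rightarrow> (nat \<times> int) set) \<Rightarrow> bool" where
  "exhaustion m V \<longleftrightarrow> (\<forall>N. finite (V N)) \<and> mono V \<and> (\<Union>N. V N) = cover_vertices m"

text \<open>
  The limit is required to exist and to have the same value for every exhaustion. It is only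
  meaningful for boundary vertices \<open>u\<close> and \<open>v\<close>; a boundary vertex may be missing from the
  first few truncations, which does not affect the limit.
\<close>

definition universal_response ::
    "nat \<Rightarrow> nat \<Rightarrow> (edge \<Rightarrow> real) \<Rightarrow> nat \<times> int \<Rightarrow> nat \<times> int \<Rightarrow> real" where
  "universal_response n m w u v = (THE l. \<forall>V. exhaustion m V \<longrightarrow>
     (\<lambda>N. truncated_response n m w (V N) u v) \<longlonglongrightarrow> l)"

definition same_response_assignments :: "nat \<Rightarrow> nat \<Rightarrow> (edge \<Rightarrow> real) \<Rightarrow> (edge \<Rightarrow> real) set" where
  "same_response_assignments n m w =
     {w' \<in> conductances n m. \<forall>u\<in>cover_boundary m. \<forall>v\<in>cover_boundary m.
        universal_response n m w' u v = universal_response n m w u v}"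


section \<open>The electrical R-matrix\<close>

text \<open>The families \<open>a, b, c, d\<close> indexed by residues modulo \<open>n\<close> are \<open>n\<close>-periodic functions of
  an integer index.\<close>

definition tau ::
    "nat \<Rightarrow> (int \<Rightarrow> real) \<Rightarrow> (int \<Rightarrow> real) \<Rightarrow> (int \<Rightarrow> real) \<Rightarrow> (int \<Rightarrow> real) \<Rightarrow> int \<Rightarrow> real" where
  "tau n a b c d i = (\<Sum>j\<in>{0..int n - 1}.
      (a (i + j) + c (i + j)) * (\<Prod>k\<in>{i..i + j - 1}. a k * c k) *
        (\<Prod>k\<in>{i + j..i + int n - 1}. b k * d k) +
      (b (i + j) + d (i + j)) * (\<Prod>k\<in>{i..i + j}. a k * c k) *
        (\<Prod>k\<in>{i + j + 1..i + int n - 1}. b k * d k))"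

definition kappa ::
    "nat \<Rightarrow> (int \<Rightarrow> real) \<Rightarrow> (int \<Rightarrow> real) \<Rightarrow> (int \<Rightarrow> real) \<Rightarrow> (int \<Rightarrow> real) \<Rightarrow> int \<Rightarrow> real" where
  "kappa n a b c d i =
      (a i + c i) * (\<Prod>k\<in>{i + 1..i + int n - 1}. a k * c k) +
      (b i + d i) * (\<Prod>k\<in>{i + 1..i + int n - 1}. b k * d k) +
      (\<Sum>j\<in>{1..int n - 1}.
        (a (i + j) + c (i + j)) * (\<Prod>k\<in>{i + 1..i + j - 1}. a k * c k) *
          (\<Prod>k\<in>{i + j..i + int n - 1}. b k * d k) +
        (b (i + j) + d (i + j)) * (\<Prod>k\<in>{i + 1..i + j}. a k * c k) *
          (\<Prod>k\<in>{i + j + 1..i + int n - 1}. b k * d k))"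

text \<open>
  \<open>R_matrix n m j\<close> is \<open>R\<^bsub>j,j+1\<^esub>\<close>. In the sub-network on the columns \<open>j - 1, j, j + 1\<close>, the edge
  from \<open>M\<^bsub>k-1\<^esub>\<close> to \<open>(k - 1)'\<close>, of conductance \<open>c\<^sub>k\<close>, is \<open>Straight j (k - 1)\<close>; hence the index
  shift by one in \<open>c\<close> and in the clause for \<open>Straight j i\<close>.
\<close>

definition R_matrix :: "nat \<Rightarrow> nat \<Rightarrow> nat \<Rightarrow> (edge \<Rightarrow> real) \<Rightarrow> (edge \<Rightarrow> real)" where
  "R_matrix n m j w =
    (let a = (\<lambda>k. lift n w (Diagonal (j - 1) k));
         b = (\<lambda>k. lift n w (Straight (j - 1) k));
         c = (\<lambda>k. lift n w (Straight j (k - 1)));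
         d = (\<lambda>k. lift n w (Diagonal j k));
         \<tau> = tau n a b c d;
         \<kappa> = kappa n a b c d;
         a' = (\<lambda>k. \<tau> k / (c k * \<kappa> k));
         b' = (\<lambda>k. \<tau> (k + 1) / (d k * \<kappa> k));
         c' = (\<lambda>k. \<tau> k / (a k * \<kappa> k));
         d' = (\<lambda>k. \<tau> (k + 1) / (b k * \<kappa> k))
     in (\<lambda>e\<in>edges n m.
          case e of
            Straight l i \<Rightarrow>
              if l = j - 1 then b' i else if l = j then c' (i + 1) else w e
          | Diagonal l i \<Rightarrow>
              if l = j - 1 then a' i else if l = j then d' i else w e))"

definition is_R_action ::
    "nat \<Rightarrow> nat \<Rightarrow> ((nat \<Rightarrow> nat) \<Rightarrow> (edge \<Rightarrow> real) \<Rightarrow> (edge \<Rightarrow> real)) \<Rightarrow> bool" where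
  "is_R_action n m \<phi> \<longleftrightarrow> group_action (sym_group m) (conductances n m) \<phi> \<and>
     (\<forall>j\<in>{1..<m}. \<forall>w\<in>conductances n m. \<phi> (transpose j (j + 1)) w = R_matrix n m j w)"


section \<open>Genericity\<close>

text \<open>
  A property holds for generic conductances if it holds off the zero set of a single nonzero
  polynomial in the conductances. Since the positive orthant is Zariski dense, a polynomial is
  nonzero iff it does not vanish identically on positive conductances.
\<close>

inductive_set polynomial_functions :: "edge set \<Rightarrow> ((edge \<Rightarrow> real) \<Rightarrow> real) set"
  for E :: "edge set" where
  const: "(\<lambda>w. r) \<in> polynomial_functions E"
| var: "e \<in> E \<Longrightarrow> (\<lambda>w. w e) \<in> polynomial_functions E"
| add: "\<lbrakk>p \<in> polynomial_functions E; q \<in> polynomial_functions E\<rbrakk>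
    \<Longrightarrow> (\<lambda>w. p w + q w) \<in> polynomial_functions E"
| mult: "\<lbrakk>p \<in> polynomial_functions E; q \<in> polynomial_functions E\<rbrakk>
    \<Longrightarrow> (\<lambda>w. p w * q w) \<in> polynomial_functions E"

definition generically :: "nat \<Rightarrow> nat \<Rightarrow> ((edge \<Rightarrow> real) \<Rightarrow> bool) \<Rightarrow> bool" where
  "generically n m Q \<longleftrightarrow> (\<exists>p\<in>polynomial_functions (edges n m).
     (\<exists>w\<in>conductances n m. p w \<noteq> 0) \<and> (\<forall>w\<in>conductances n m. p w \<noteq> 0 \<longrightarrow> Q w))"

end

theory Submission
  imports Defs "HOL-Computational_Algebra.Polynomial"
begin

text \<open>
  The response of a network is encoded in its bounded harmonic functions on the universal cover. On
  functions that are periodic up to a multiplier, harmonicity propagates from column to column by a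
  transfer map that is rational in the multiplier; the response determines it on the unit circle,
  hence everywhere. A layer with ratio \<open>\<rho>\<close> (product of the diagonal over product of the straight
  conductances) contributes a pole of modulus depending on \<open>\<rho>\<close> only. If the ratios are decreasing,
  positivity shows that the first pole on the positive axis stems from the first layer, and its
  residue functional determines this layer up to rescaling the potentials in the next column. Peeling
  off the layers, two networks with decreasing ratios and equal response differ by such a gauge only;
  the gauge is a positive harmonic function with boundary values \<open>1\<close>, so it is trivial.

  \<open>R\<^bsub>j,j+1\<^esub>\<close> preserves the response (it preserves the network obtained by eliminating one column), is
  injective and swaps two adjacent ratios. So all orders of the ratios occur, each for exactly one
  network with the given response, and permuting the ratios defines the group action.
\<close>

section \<open>Bounded harmonic functions on the strip\<close>

text \<open>The response sees bounded potentials only, hence multipliers on the unit circle, whereas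
  the poles that reveal the layers lie elsewhere in general; rationality bridges this gap. On the
  positive axis below the first pole, the twist by powers of \<open>- 1 / \<tau>\<close> gives every
  layer an inverse with nonnegative coefficients, so later layers cannot cancel the divergence of
  the first one. Past the first pole this positivity is lost. Hence only the largest ratio is
  accessible, and it must belong to the layer next to the boundary; ties between ratios are
  harmless.

  A peeled network no longer has vertex weights that are sums of its own conductances. The weights
  are therefore carried as separate data with an inequality that survives peeling; that they are
  sums is used again only at the end, to show that the gauge is trivial.

  Injectivity of the R-matrices carries uniqueness from decreasing ratios to any order: one
  injective map sorts both of two networks with equal ratios, and the sorted images agree.
  Uniqueness in turn makes the action well defined, and pairwise different ratios make its orbit as
  large as the group.\<close>

lemma periodic_mult:
  fixes f :: "int \<Rightarrow> 'a"
  assumes "\<And>i. f (i + p) = f i"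
  shows "f (i + k * p) = f i"
proof (induction k rule: int_induct[of _ 0])
  case (step1 k)
  have "f (i + (k + 1) * p) = f ((i + k * p) + p)" by (simp add: algebra_simps)
  then show ?case using assms step1 by simp
next
  case (step2 k)
  have "f (i + (k - 1) * p) = f ((i + (k - 1) * p) + p)" using assms by simp
  also have "\<dots> = f (i + k * p)" by (simp add: algebra_simps)
  finally show ?case using step2 by simp
qed simp

lemma periodic_mod:
  fixes f :: "int \<Rightarrow> 'a"
  assumes "\<And>i. f (i + p) = f i"
  shows "f (i mod p) = f i"
  using periodic_mult[of f p i "- (i div p)", OF assms] by (simp add: minus_div_mult_eq_mod)

lemma ex_uniform_bounds:
  fixes f :: "'i \<Rightarrow> real"
  assumes "finite A" "\<And>x. x \<in> A \<Longrightarrow> 0 < f x"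
  shows "\<exists>lo hi. 0 < lo \<and> lo \<le> hi \<and> (\<forall>x\<in>A. lo \<le> f x \<and> f x \<le> hi)"
proof (cases "A = {}")
  case True
  then show ?thesis by (auto intro: exI[of _ 1])
next
  case False
  show ?thesis
  proof (intro exI conjI ballI)
    show "0 < Min (f ` A)" using assms False by auto
    show "Min (f ` A) \<le> Max (f ` A)" using assms False by (meson Max_ge Min_in Min_le finite_imageI image_is_empty)
  qed (use assms in auto)
qed

text \<open>\<open>a\<close> holds the diagonal and \<open>b\<close> the straight conductances of
  each layer. Potentials are vector valued so that one theory serves the real ones, from which the
  response matrix is built, and the complex ones, which have multipliers on the unit circle.\<close>

definition out_current ::
  "nat \<Rightarrow> (nat \<Rightarrow> int \<Rightarrow> real) \<Rightarrow> (nat \<Rightarrow> int \<Rightarrow> real) \<Rightarrow> (nat \<Rightarrow> int \<Rightarrow> 'v::real_normed_vector) \<Rightarrow> nat \<Rightarrow> int \<Rightarrow> 'v"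
  where "out_current m a b u k i =
    (if k < m then b k i *\<^sub>R (u k i - u (Suc k) i) + a k i *\<^sub>R (u k i - u (Suc k) (i - 1)) else 0) +
    (if 0 < k then b (k - 1) i *\<^sub>R (u k i - u (k - 1) i) +
       a (k - 1) (i + 1) *\<^sub>R (u k i - u (k - 1) (i + 1)) else 0)"

definition degree4 :: "(nat \<Rightarrow> int \<Rightarrow> real) \<Rightarrow> (nat \<Rightarrow> int \<Rightarrow> real) \<Rightarrow> nat \<Rightarrow> int \<Rightarrow> real" where
  "degree4 a b k i = b k i + a k i + b (k - 1) i + a (k - 1) (i + 1)"

definition neighbour_sum ::
  "(nat \<Rightarrow> int \<Rightarrow> real) \<Rightarrow> (nat \<Rightarrow> int \<Rightarrow> real) \<Rightarrow> (nat \<Rightarrow> int \<Rightarrow> 'v::real_normed_vector) \<Rightarrow> nat \<Rightarrow> int \<Rightarrow> 'v"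
  where "neighbour_sum a b u k i =
    b k i *\<^sub>R u (Suc k) i + a k i *\<^sub>R u (Suc k) (i - 1) +
    b (k - 1) i *\<^sub>R u (k - 1) i + a (k - 1) (i + 1) *\<^sub>R u (k - 1) (i + 1)"

lemma out_current_interior:
  assumes "0 < k" "k < m"
  shows "out_current m a b u k i = degree4 a b k i *\<^sub>R u k i - neighbour_sum a b u k i"
  using assms by (simp add: out_current_def degree4_def neighbour_sum_def algebra_simps)

lemma out_current_add: "out_current m a b (\<lambda>k i. u k i + v k i) k i = out_current m a b u k i + out_current m a b v k i"
  by (simp add: out_current_def algebra_simps)

lemma out_current_diff: "out_current m a b (\<lambda>k i. u k i - v k i) k i = out_current m a b u k i - out_current m a b v k i"
  by (simp add: out_current_def algebra_simps)

lemma out_current_zero [simp]: "out_current m a b (\<lambda>k i. 0) k i = 0"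
  by (simp add: out_current_def)

lemma out_current_const [simp]: "out_current m a b (\<lambda>k i. c) k i = 0"
  by (simp add: out_current_def)

lemma out_current_sum: "out_current m a b (\<lambda>k i. \<Sum>x\<in>A. u x k i) k i = (\<Sum>x\<in>A. out_current m a b (u x) k i)"
  by (induction A rule: infinite_finite_induct) (simp_all add: out_current_add)

lemma out_current_scaleR: 
  fixes u :: "nat \<Rightarrow> int \<Rightarrow> real"
  shows "out_current m a b (\<lambda>k i. u k i *\<^sub>R c) k i = out_current m a b u k i *\<^sub>R c"
  by (simp add: out_current_def algebra_simps)

locale strip =
  fixes n m :: nat and a b :: "nat \<Rightarrow> int \<Rightarrow> real"
  assumes n_pos: "1 \<le> n" and m_pos: "1 \<le> m"
    and a_pos: "k < m \<Longrightarrow> 0 < a k i" and b_pos: "k < m \<Longrightarrow> 0 < b k i"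
    and a_per: "k < m \<Longrightarrow> a k (i + int n) = a k i"
    and b_per: "k < m \<Longrightarrow> b k (i + int n) = b k i"
begin

abbreviation "current \<equiv> out_current m a b"

definition harmonic :: "(nat \<Rightarrow> int \<Rightarrow> 'v::real_normed_vector) \<Rightarrow> bool" where
  "harmonic u \<longleftrightarrow> (\<forall>k i. 0 < k \<longrightarrow> k < m \<longrightarrow> current u k i = 0)"

lemma ex_bounds: "\<exists>lo hi. 0 < lo \<and> lo \<le> hi \<and>
    (\<forall>k<m. \<forall>i. lo \<le> a k i \<and> a k i \<le> hi \<and> lo \<le> b k i \<and> b k i \<le> hi)"
proof -
  define A where "A = {..<m} \<times> {0..<int n} \<times> (UNIV :: bool set)"
  define f where "f = (\<lambda>(k, i, s). if s then a k i else b k i)"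
  have "finite A" by (auto simp: A_def)
  moreover have "0 < f x" if "x \<in> A" for x using that a_pos b_pos by (auto simp: A_def f_def)
  ultimately obtain lo hi where *: "0 < lo" "lo \<le> hi" "\<And>x. x \<in> A \<Longrightarrow> lo \<le> f x \<and> f x \<le> hi"
    using ex_uniform_bounds[of A f] by blast
  have "lo \<le> a k i \<and> a k i \<le> hi \<and> lo \<le> b k i \<and> b k i \<le> hi" if "k < m" for k i
  proof -
    have "i mod int n \<in> {0..<int n}" using n_pos by auto
    then have "(k, i mod int n, s) \<in> A" for s using that by (auto simp: A_def)
    then have "lo \<le> f (k, i mod int n, s) \<and> f (k, i mod int n, s) \<le> hi" for s using * by blast
    from this[of True] this[of False] show ?thesis
      using periodic_mod[of "a k" "int n" i] periodic_mod[of "b k" "int n" i] a_per b_per that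
      by (simp add: f_def)
  qed
  then show ?thesis using * by blast
qed

text \<open>Along the columns the weight increases by ever smaller steps, so that it is strictly
  superharmonic on all interior columns. In the norm weighted by it, averaging over the
  neighbours is a contraction, also on the infinite strip.\<close>

lemma ex_weight: "\<exists>\<phi> \<theta>. 0 \<le> \<theta> \<and> \<theta> < 1 \<and> (\<forall>k. 1 \<le> \<phi> k \<and> \<phi> k \<le> 2) \<and>
   (\<forall>k i. 0 < k \<longrightarrow> k < m \<longrightarrow> neighbour_sum a b (\<lambda>k i. \<phi> k) k i \<le> \<theta> * (degree4 a b k i * (\<phi> k :: real)))"
proof -
  obtain lo hi where lo: "0 < lo" "lo \<le> hi" and
    bd: "\<And>k i. k < m \<Longrightarrow> lo \<le> a k i \<and> a k i \<le> hi \<and> lo \<le> b k i \<and> b k i \<le> hi"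
    using ex_bounds by blast
  \<comment> \<open>The increments of the weight shrink by the factor \<open>t\<close> per column. A
    column is joined to the next one by total conductance \<open>r\<close> \<le> 2 \<open>hi\<close>
    and to the previous one by \<open>s\<close> \<ge> 2 \<open>lo\<close>, so \<open>r * t\<close>
    \<le> \<open>lo\<close> leaves a deficit \<open>t ^ k * (s - r * t)\<close> of at least
    \<open>t ^ m * lo\<close>. As degree times weight is at most 4 \<open>hi\<close> times 2, the
    relative deficit is at least \<open>t ^ m * lo / (8 * hi)\<close>, which fixes
    \<open>\<theta>\<close>.\<close>
  define t where "t = lo / (2 * hi)"
  define \<phi> where "\<phi> = (\<lambda>k::nat. \<Sum>l\<le>k. t ^ l)"
  define \<theta> where "\<theta> = 1 - t ^ m * lo / (8 * hi)"
  have t: "0 < t" "t \<le> 1/2" using lo by (auto simp: t_def field_simps)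
  have le2: "\<phi> k + t ^ k \<le> 2" for k
  proof (induction k)
    case (Suc k)
    have "t * t ^ k \<le> (1/2) * t ^ k" using t by (intro mult_right_mono) auto
    then show ?case using Suc by (simp add: \<phi>_def)
  qed (simp add: \<phi>_def)
  have ge1: "1 \<le> \<phi> k" for k
  proof -
    have "(\<Sum>l\<in>{0}. t ^ l) \<le> \<phi> k" unfolding \<phi>_def using t by (intro sum_mono2) auto
    then show ?thesis by simp
  qed
  have tm: "t ^ m \<le> 1" using t by (intro power_le_one) auto
  have "t ^ m * lo \<le> 1 * (8 * hi)" using tm lo t by (intro mult_mono) auto
  then have th: "0 \<le> \<theta>" "\<theta> < 1" using lo t by (auto simp: \<theta>_def field_simps)
  have main: "neighbour_sum a b (\<lambda>k i. \<phi> k) k i \<le> \<theta> * (degree4 a b k i * \<phi> k)" if k: "0 < k" "k < m" for k i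
  proof -
    obtain l where l: "k = Suc l" using k by (cases k) auto
    define r s where "r = b k i + a k i" and "s = b l i + a l (i + 1)"
    have r: "2 * lo \<le> r" "r \<le> 2 * hi" and s: "2 * lo \<le> s" "s \<le> 2 * hi"
      using bd[of k i] bd[of l i] bd[of l "i+1"] k l by (auto simp: r_def s_def)
    have "r * t \<le> 2 * hi * t" using r t by (intro mult_right_mono) auto
    then have srt: "lo \<le> s - r * t" using s lo by (simp add: t_def)
    have "t ^ m * lo \<le> t ^ k * (s - r * t)"
      using srt t lo k by (intro mult_mono power_decreasing) auto
    moreover have "neighbour_sum a b (\<lambda>k i. \<phi> k) k i = (r + s) * \<phi> k - t ^ k * (s - r * t)"
      by (simp add: neighbour_sum_def l \<phi>_def r_def s_def algebra_simps)
    moreover have "(r + s) * \<phi> k \<le> (4 * hi) * 2"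
      using r s lo le2[of k] ge1[of k] t zero_less_power[OF t(1), of k] by (intro mult_mono) linarith+
    then have "t ^ m * lo / (8 * hi) * ((r + s) * \<phi> k) \<le> t ^ m * lo / (8 * hi) * (8 * hi)"
      using lo t by (intro mult_left_mono) auto
    moreover have "t ^ m * lo / (8 * hi) * (8 * hi) = t ^ m * lo" using lo by simp
    moreover have "\<theta> * ((r + s) * \<phi> k) = (r + s) * \<phi> k - t ^ m * lo / (8 * hi) * ((r + s) * \<phi> k)"
      by (simp add: \<theta>_def left_diff_distrib)
    moreover have "degree4 a b k i = r + s" by (simp add: degree4_def l r_def s_def)
    moreover have "neighbour_sum a b (\<lambda>k i. \<phi> k) k i \<le> (r + s) * \<phi> k - t ^ m * lo" using calculation by linarith
    moreover have "\<dots> \<le> \<theta> * ((r + s) * \<phi> k)" using calculation by linarith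
    ultimately show ?thesis by (metis order_trans)
  qed
  have "\<phi> k \<le> 2" for k using le2[of k] zero_less_power[OF t(1), of k] by linarith
  then show ?thesis using th ge1 main by blast
qed

lemma norm_neighbour_sum_le:
  assumes k: "0 < k" "k < m"
    and "norm (e (Suc k) i) \<le> c * (\<phi> (Suc k) :: real)" "norm (e (Suc k) (i - 1)) \<le> c * \<phi> (Suc k)"
    "norm (e (k - 1) i) \<le> c * \<phi> (k - 1)" "norm (e (k - 1) (i + 1)) \<le> c * \<phi> (k - 1)"
  shows "norm (neighbour_sum a b e k i) \<le> c * neighbour_sum a b (\<lambda>k i. \<phi> k) k i"
proof -
  obtain l where l: "k = Suc l" using k by (cases k) auto
  have p: "0 < a k i" "0 < b k i" "0 < a l (i+1)" "0 < b l i" using a_pos b_pos k l by auto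
  have "norm (neighbour_sum a b e k i) \<le> b k i * norm (e (Suc k) i) + a k i * norm (e (Suc k) (i - 1)) +
    b l i * norm (e l i) + a l (i + 1) * norm (e l (i + 1))"
    unfolding neighbour_sum_def using p
    by (auto simp: l intro!: norm_triangle_mono)
  also have "\<dots> \<le> b k i * (c * \<phi> (Suc k)) + a k i * (c * \<phi> (Suc k)) + b l i * (c * \<phi> l) + a l (i + 1) * (c * \<phi> l)"
    using assms p by (intro add_mono mult_left_mono) (auto simp: l)
  also have "\<dots> = c * neighbour_sum a b (\<lambda>k i. \<phi> k) k i"
    by (simp add: neighbour_sum_def l algebra_simps)
  finally show ?thesis .
qed

lemma degree4_pos: "0 < k \<Longrightarrow> k < m \<Longrightarrow> 0 < degree4 a b k i"
  using a_pos[of k i] b_pos[of k i] a_pos[of "k-1" "i+1"] b_pos[of "k-1" i]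
  by (simp add: degree4_def less_imp_diff_less)

text \<open>Each use of the contraction looks one row further out, so a point at depth
  \<open>d\<close> inside the window gains \<open>d\<close> factors \<open>\<theta>\<close>; the
  \<open>+ 1\<close> allows \<open>d = 0\<close> just outside the window, where only the global
  bound is used. The factor 2 bounds the weight. The alternative between vanishing and harmonicity
  covers boundary columns and truncated networks alike, and \<open>\<theta>\<close> depends on the
  network alone.\<close>

lemma decay:
  "\<exists>\<theta>::real. 0 \<le> \<theta> \<and> \<theta> < 1 \<and> (\<forall>(e :: nat \<Rightarrow> int \<Rightarrow> 'v::real_normed_vector) M R d k i.
     (\<forall>k i. k \<le> m \<longrightarrow> norm (e k i) \<le> M) \<longrightarrow>
     (\<forall>k i. k \<le> m \<longrightarrow> \<bar>i\<bar> \<le> int R \<longrightarrow> e k i = 0 \<or> (0 < k \<and> k < m \<and> current e k i = 0)) \<longrightarrow>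
     k \<le> m \<longrightarrow> \<bar>i\<bar> + int d \<le> int R + 1 \<longrightarrow> norm (e k i) \<le> 2 * M * \<theta> ^ d)"
proof -
  obtain \<phi> \<theta> where th: "0 \<le> \<theta>" "\<theta> < 1" and \<phi>: "\<And>k. 1 \<le> \<phi> k \<and> \<phi> k \<le> 2" and
    con: "\<And>k i. 0 < k \<Longrightarrow> k < m \<Longrightarrow> neighbour_sum a b (\<lambda>k i. \<phi> k) k i \<le> \<theta> * (degree4 a b k i * (\<phi> k :: real))"
    using ex_weight by blast
  have main: "norm (e k i) \<le> 2 * M * \<theta> ^ d"
    if bd: "\<And>k i. k \<le> m \<Longrightarrow> norm (e k i) \<le> M"
      and h: "\<And>k i. \<lbrakk>k \<le> m; \<bar>i\<bar> \<le> int R\<rbrakk> \<Longrightarrow> e k i = 0 \<or> (0 < k \<and> k < m \<and> current e k i = 0)"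
      and k: "k \<le> m" and i: "\<bar>i\<bar> + int d \<le> int R + 1" for e :: "nat \<Rightarrow> int \<Rightarrow> 'v" and M R d k i
  proof -
    have M: "0 \<le> M" using bd[of 0 0] norm_ge_zero order_trans by blast
    have "norm (e k i) \<le> (M * \<theta> ^ d) * \<phi> k" using k i
    proof (induction d arbitrary: k i)
      case 0
      have "M * 1 \<le> M * \<phi> k" using M \<phi> by (intro mult_left_mono) auto
      then show ?case using bd[OF 0(1), of i] by simp
    next
      case (Suc d)
      have "\<bar>i\<bar> \<le> int R" using Suc.prems by simp
      then consider "e k i = 0" | "0 < k" "k < m" "current e k i = 0" using h Suc.prems(1) by blast
      then show ?case
      proof cases
        case 1
        then show ?thesis using M th \<phi>[of k] by simp
      next
        case 2
        have "norm (neighbour_sum a b e k i) \<le> (M * \<theta> ^ d) * neighbour_sum a b (\<lambda>k i. \<phi> k) k i"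
          using 2 Suc.prems by (intro norm_neighbour_sum_le Suc.IH) auto
        also have "\<dots> \<le> (M * \<theta> ^ d) * (\<theta> * (degree4 a b k i * \<phi> k))"
          using con 2 M th by (intro mult_left_mono) auto
        finally have "norm (degree4 a b k i *\<^sub>R e k i) \<le> (M * \<theta> ^ d) * (\<theta> * (degree4 a b k i * \<phi> k))"
          using 2 out_current_interior[of k m a b e i] by simp
        then have "degree4 a b k i * norm (e k i) \<le> degree4 a b k i * ((M * \<theta> ^ Suc d) * \<phi> k)"
          using degree4_pos[OF 2(1,2), of i] by (simp add: algebra_simps)
        then show ?thesis using degree4_pos[OF 2(1,2), of i] by simp
      qed
    qed
    also have "\<dots> \<le> (M * \<theta> ^ d) * 2" using M th \<phi> by (intro mult_left_mono) auto
    finally show ?thesis by (simp add: mult_ac)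
  qed
  show ?thesis
  proof (intro exI[of _ \<theta>] conjI allI impI th)
    fix e :: "nat \<Rightarrow> int \<Rightarrow> 'v" and M R d k i
    assume "\<forall>k i. k \<le> m \<longrightarrow> norm (e k i) \<le> M"
      "\<forall>k i. k \<le> m \<longrightarrow> \<bar>i\<bar> \<le> int R \<longrightarrow> e k i = 0 \<or> (0 < k \<and> k < m \<and> current e k i = 0)"
      "k \<le> m" "\<bar>i\<bar> + int d \<le> int R + 1"
    then show "norm (e k i) \<le> 2 * M * \<theta> ^ d" by (intro main[of e M R k i d]) auto
  qed
qed

text \<open>With the conditions given at every row, the window in \<open>decay\<close> can be as
  large as desired, so \<open>d\<close> is arbitrary.\<close>

lemma bounded_unique:
  fixes e :: "nat \<Rightarrow> int \<Rightarrow> 'v::real_normed_vector"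
  assumes bd: "\<And>k i. k \<le> m \<Longrightarrow> norm (e k i) \<le> M"
    and h: "\<And>k i. k \<le> m \<Longrightarrow> e k i = 0 \<or> (0 < k \<and> k < m \<and> current e k i = 0)"
    and k: "k \<le> m"
  shows "e k i = 0"
proof -
  obtain \<theta> where th: "0 \<le> \<theta>" "\<theta> < 1" and dec:
    "\<forall>(e :: nat \<Rightarrow> int \<Rightarrow> 'v) M R d k i.
     (\<forall>k i. k \<le> m \<longrightarrow> norm (e k i) \<le> M) \<longrightarrow>
     (\<forall>k i. k \<le> m \<longrightarrow> \<bar>i\<bar> \<le> int R \<longrightarrow> e k i = 0 \<or> (0 < k \<and> k < m \<and> current e k i = 0)) \<longrightarrow>
     k \<le> m \<longrightarrow> \<bar>i\<bar> + int d \<le> int R + 1 \<longrightarrow> norm (e k i) \<le> 2 * M * \<theta> ^ d"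
    using decay[where 'v = 'v] by (elim exE conjE) (rule that)
  have "norm (e k i) \<le> 2 * M * \<theta> ^ d" for d
    using dec[rule_format, of e M "nat \<bar>i\<bar> + d" k i d] bd h k by auto
  moreover have "(\<lambda>d. 2 * M * \<theta> ^ d) \<longlonglongrightarrow> 2 * M * 0"
    using th by (intro tendsto_mult tendsto_const LIMSEQ_realpow_zero) auto
  ultimately have "norm (e k i) \<le> 2 * M * 0"
    by (intro LIMSEQ_le_const) auto
  then show ?thesis by simp
qed

text \<open>Jacobi iteration, summed as a Neumann series: divide the source by the degree, then
  average repeatedly over the neighbours with value zero outside \<open>I\<close>. The contraction
  of \<open>ex_weight\<close> makes the series converge geometrically, with a bound independent of
  \<open>I\<close>. Finite sets \<open>I\<close> serve the truncations, the whole interior serves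
  the strip.\<close>

lemma ex_solution:
  "\<exists>K::real. 0 \<le> K \<and> (\<forall>(g :: nat \<Rightarrow> int \<Rightarrow> 'v::banach) I M.
       (\<forall>k i. (k, i) \<in> I \<longrightarrow> 0 < k \<and> k < m \<and> norm (g k i) \<le> M) \<longrightarrow> 0 \<le> M \<longrightarrow>
       (\<exists>f. (\<forall>k i. norm (f k i) \<le> K * M) \<and> (\<forall>k i. (k, i) \<notin> I \<longrightarrow> f k i = 0) \<and>
           (\<forall>k i. (k, i) \<in> I \<longrightarrow> current f k i = g k i)))"
proof -
  obtain lo hi where lo: "0 < lo" "lo \<le> hi" and
    bnd: "\<And>k i. k < m \<Longrightarrow> lo \<le> a k i \<and> a k i \<le> hi \<and> lo \<le> b k i \<and> b k i \<le> hi"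
    using ex_bounds by blast
  obtain \<phi> \<theta> where th: "0 \<le> \<theta>" "\<theta> < 1" and \<phi>: "\<And>k. 1 \<le> \<phi> k \<and> \<phi> k \<le> 2" and
    con: "\<And>k i. 0 < k \<Longrightarrow> k < m \<Longrightarrow> neighbour_sum a b (\<lambda>k i. \<phi> k) k i \<le> \<theta> * (degree4 a b k i * (\<phi> k :: real))"
    using ex_weight by blast
  \<comment> \<open>The first iterate is at most \<open>M / lo\<close> times the weight, since
    degrees are at least \<open>lo\<close>; the weight is at most 2, and the geometric series
    contributes \<open>1 / (1 - \<theta>)\<close>.\<close>
  define K where "K = 2 / (lo * (1 - \<theta>))"
  have ex: "\<exists>f. (\<forall>k i. norm (f k i) \<le> K * M) \<and> (\<forall>k i. (k, i) \<notin> I \<longrightarrow> f k i = 0) \<and>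
           (\<forall>k i. (k, i) \<in> I \<longrightarrow> current f k i = g k i)"
    if I: "\<And>k i. (k, i) \<in> I \<Longrightarrow> 0 < k \<and> k < m \<and> norm (g k i) \<le> M" and M: "0 \<le> M"
    for g :: "nat \<Rightarrow> int \<Rightarrow> 'v" and I M
  proof -
    define q where "q = rec_nat (\<lambda>k i. if (k, i) \<in> I then g k i /\<^sub>R degree4 a b k i else 0)
       (\<lambda>j p k i. if (k, i) \<in> I then neighbour_sum a b p k i /\<^sub>R degree4 a b k i else (0 :: 'v))"
    have q0: "q 0 k i = (if (k, i) \<in> I then g k i /\<^sub>R degree4 a b k i else 0)" for k i by (simp add: q_def)
    have qS: "q (Suc j) k i = (if (k, i) \<in> I then neighbour_sum a b (q j) k i /\<^sub>R degree4 a b k i else 0)" for j k i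
      by (simp add: q_def)
    have qb: "norm (q j k i) \<le> (M / lo * \<theta> ^ j) * \<phi> k" for j k i
    proof (induction j arbitrary: k i)
      case 0
      show ?case
      proof (cases "(k, i) \<in> I")
        case True
        then have k: "0 < k" "k < m" "norm (g k i) \<le> M" using I by auto
        have "lo \<le> degree4 a b k i"
          using bnd[of k i] bnd[of "k-1" i] bnd[of "k-1" "i+1"] lo k by (simp add: degree4_def less_imp_diff_less)
        then have "norm (g k i) / degree4 a b k i \<le> M / lo"
          using k lo M by (intro frac_le) auto
        also have "\<dots> \<le> (M / lo) * \<phi> k" using M lo \<phi>[of k] mult_left_mono[of 1 "\<phi> k" "M / lo"] by simp
        finally show ?thesis using True degree4_pos[OF k(1,2), of i] by (simp add: q0 divide_inverse mult.commute)
      next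
        case False
        then show ?thesis using M lo \<phi>[of k] by (simp add: q0)
      qed
    next
      case (Suc j)
      show ?case
      proof (cases "(k, i) \<in> I")
        case True
        then have k: "0 < k" "k < m" using I by auto
        have "norm (neighbour_sum a b (q j) k i) \<le> (M / lo * \<theta> ^ j) * neighbour_sum a b (\<lambda>k i. \<phi> k) k i"
          using k Suc.IH by (intro norm_neighbour_sum_le) auto
        also have "\<dots> \<le> (M / lo * \<theta> ^ j) * (\<theta> * (degree4 a b k i * \<phi> k))"
          using con k M lo th by (intro mult_left_mono) auto
        finally have "norm (neighbour_sum a b (q j) k i) / degree4 a b k i \<le> (M / lo * \<theta> ^ Suc j) * \<phi> k"
          using degree4_pos[OF k, of i] by (simp add: field_simps)
        then show ?thesis using True degree4_pos[OF k, of i] by (simp add: qS divide_inverse mult.commute)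
      next
        case False
        then show ?thesis using M lo th \<phi>[of k] by (simp add: qS)
      qed
    qed
    have qb2: "norm (q j k i) \<le> (M / lo * 2) * \<theta> ^ j" for j k i
    proof -
      have "(M / lo * \<theta> ^ j) * \<phi> k \<le> (M / lo * \<theta> ^ j) * 2" using M lo th \<phi> by (intro mult_left_mono) auto
      then show ?thesis using qb[of j k i] by (simp add: mult_ac)
    qed
    have sg: "summable (\<lambda>j. (M / lo * 2) * \<theta> ^ j)" using th by (intro summable_mult summable_geometric) auto
    have sn: "summable (\<lambda>j. norm (q j k i))" for k i
      by (rule summable_comparison_test'[OF sg, of 0]) (use qb2 in auto)
    then have sq: "summable (\<lambda>j. q j k i)" for k i by (rule summable_norm_cancel)
    define f where "f = (\<lambda>k i. \<Sum>j. q j k i)"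
    have f_bd: "norm (f k i) \<le> K * M" for k i
    proof -
      have "norm (f k i) \<le> (\<Sum>j. norm (q j k i))" unfolding f_def using sn by (rule summable_norm)
      also have "\<dots> \<le> (\<Sum>j. (M / lo * 2) * \<theta> ^ j)" using qb2 sn sg by (intro suminf_le) auto
      also have "\<dots> = (M / lo * 2) * (1 / (1 - \<theta>))" using th by (subst suminf_mult) (auto simp: suminf_geometric summable_geometric)
      also have "\<dots> = K * M" using lo th by (simp add: K_def field_simps)
      finally show ?thesis .
    qed
    have f0: "f k i = 0" if "(k, i) \<notin> I" for k i
    proof -
      have "q j k i = 0" for j using that by (cases j) (simp_all add: q0 qS)
      then show ?thesis by (simp add: f_def)
    qed
    have nsf: "neighbour_sum a b f k i = (\<Sum>j. neighbour_sum a b (q j) k i)" for k i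
      unfolding neighbour_sum_def f_def
      by (simp add: suminf_add[symmetric] suminf_scaleR_right[symmetric] summable_add summable_scaleR_right sq)
    have snq: "summable (\<lambda>j. neighbour_sum a b (q j) k i)" for k i
      unfolding neighbour_sum_def by (intro summable_add summable_scaleR_right sq)
    have fc: "current f k i = g k i" if kI: "(k, i) \<in> I" for k i
    proof -
      have k: "0 < k" "k < m" using I kI by auto
      have "f k i = q 0 k i + (\<Sum>j. q (Suc j) k i)" unfolding f_def using suminf_split_head[OF sq[of k i]] by simp
      also have "(\<Sum>j. q (Suc j) k i) = neighbour_sum a b f k i /\<^sub>R degree4 a b k i"
        using kI by (simp add: qS nsf suminf_scaleR_right[symmetric] snq)
      finally have "degree4 a b k i *\<^sub>R f k i = g k i + neighbour_sum a b f k i"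
        using kI degree4_pos[OF k, of i] by (simp add: q0 algebra_simps)
      then show ?thesis using out_current_interior[OF k, of a b f i] by simp
    qed
    show ?thesis using f_bd f0 fc by blast
  qed
  have "0 \<le> K" using lo th by (simp add: K_def)
  then show ?thesis
    by (intro exI[of _ K] conjI allI impI ex) auto
qed

text \<open>Boundary data extended by zero violate harmonicity by sources of size at most
  \<open>4 * hi * M\<close>, which \<open>ex_solution\<close> corrects without touching the
  boundary; hence the constant \<open>1 + 4 * hi * K\<close>.\<close>

lemma ex_harmonic:
  "\<exists>K::real. 0 \<le> K \<and> (\<forall>(g :: nat \<Rightarrow> int \<Rightarrow> 'v::banach) M.
       (\<forall>k\<in>{0, m}. \<forall>i. norm (g k i) \<le> M) \<longrightarrow> 0 \<le> M \<longrightarrow>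
       (\<exists>u. (\<forall>k i. norm (u k i) \<le> K * M) \<and> (\<forall>k\<in>{0, m}. \<forall>i. u k i = g k i) \<and> harmonic u))"
proof -
  obtain lo hi where lo: "0 < lo" "lo \<le> hi" and
    bnd: "\<And>k i. k < m \<Longrightarrow> lo \<le> a k i \<and> a k i \<le> hi \<and> lo \<le> b k i \<and> b k i \<le> hi"
    using ex_bounds by blast
  obtain K where K: "0 \<le> K" "(\<forall>(g :: nat \<Rightarrow> int \<Rightarrow> 'v) I M.
       (\<forall>k i. (k, i) \<in> I \<longrightarrow> 0 < k \<and> k < m \<and> norm (g k i) \<le> M) \<longrightarrow> 0 \<le> M \<longrightarrow>
       (\<exists>f. (\<forall>k i. norm (f k i) \<le> K * M) \<and> (\<forall>k i. (k, i) \<notin> I \<longrightarrow> f k i = 0) \<and>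
           (\<forall>k i. (k, i) \<in> I \<longrightarrow> current f k i = g k i)))"
    using ex_solution[where 'v = 'v] by (elim exE conjE) (rule that)
  have ex: "\<exists>u. (\<forall>k i. norm (u k i) \<le> (1 + 4 * hi * K) * M) \<and> (\<forall>k\<in>{0, m}. \<forall>i. u k i = g k i) \<and> harmonic u"
    if g: "\<And>k i. k \<in> {0, m} \<Longrightarrow> norm (g k i) \<le> M" and M: "0 \<le> M" for g :: "nat \<Rightarrow> int \<Rightarrow> 'v" and M
  proof -
    define G where "G = (\<lambda>k i. if k \<in> {0, m} then g k i else 0)"
    have G: "norm (G k i) \<le> M" for k i using g M by (simp add: G_def)
    define I where "I = {0<..<m} \<times> (UNIV :: int set)"
    have "norm (- current G k i) \<le> 4 * hi * M" if "(k, i) \<in> I" for k i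
    proof -
      have k: "0 < k" "k < m" using that by (auto simp: I_def)
      have "norm (neighbour_sum a b G k i) \<le> M * neighbour_sum a b (\<lambda>k i. 1 :: real) k i"
        using k G by (intro norm_neighbour_sum_le) auto
      also have "\<dots> \<le> M * (4 * hi)"
        using bnd[of k i] bnd[of "k-1" i] bnd[of "k-1" "i+1"] k M
        by (intro mult_left_mono) (auto simp: neighbour_sum_def less_imp_diff_less)
      finally show ?thesis using k out_current_interior[of k m a b G i] by (simp add: G_def mult_ac)
    qed
    moreover have "0 \<le> 4 * hi * M" using lo M by simp
    ultimately have "\<exists>f. (\<forall>k i. norm (f k i) \<le> K * (4 * hi * M)) \<and> (\<forall>k i. (k, i) \<notin> I \<longrightarrow> f k i = 0) \<and>
           (\<forall>k i. (k, i) \<in> I \<longrightarrow> current f k i = - current G k i)"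
      using K(2)[rule_format, of I "\<lambda>k i. - current G k i" "4 * hi * M"] by (simp add: I_def)
    then obtain f where f: "\<And>k i. norm (f k i) \<le> K * (4 * hi * M)" "\<And>k i. (k, i) \<notin> I \<Longrightarrow> f k i = 0"
        "\<And>k i. (k, i) \<in> I \<Longrightarrow> current f k i = - current G k i"
      by blast
    define u where "u = (\<lambda>k i. G k i + f k i)"
    have "norm (u k i) \<le> (1 + 4 * hi * K) * M" for k i
      using norm_triangle_ineq[of "G k i" "f k i"] G[of k i] f(1)[of k i] by (simp add: u_def algebra_simps)
    moreover have "u k i = g k i" if "k \<in> {0, m}" for k i using that f(2)[of k i] by (auto simp: u_def G_def I_def)
    moreover have "harmonic u" using f(3) by (simp add: harmonic_def u_def out_current_add I_def)
    ultimately show ?thesis by blast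
  qed
  have "0 \<le> 1 + 4 * hi * K" using lo K by simp
  then show ?thesis
    by (intro exI[of _ "1 + 4 * hi * K"] conjI allI impI ex) auto
qed

lemma harmonic_unique:
  fixes u v :: "nat \<Rightarrow> int \<Rightarrow> 'v::real_normed_vector"
  assumes "harmonic u" "harmonic v"
    and "\<And>k i. k \<le> m \<Longrightarrow> norm (u k i) \<le> M" "\<And>k i. k \<le> m \<Longrightarrow> norm (v k i) \<le> N"
    and "\<And>k i. k \<in> {0, m} \<Longrightarrow> u k i = v k i" and "k \<le> m"
  shows "u k i = v k i"
proof -
  have "u k i - v k i = 0"
  proof (rule bounded_unique[of "\<lambda>k i. u k i - v k i" "M + N" k i])
    show "norm (u k i - v k i) \<le> M + N" if "k \<le> m" for k i
      using norm_triangle_ineq4[of "u k i" "v k i"] assms(3,4)[OF that, of i] by linarith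
    show "u k i - v k i = 0 \<or> 0 < k \<and> k < m \<and> current (\<lambda>k i. u k i - v k i) k i = 0" if "k \<le> m" for k i
      using that assms(1,2) assms(5)[of k] by (cases "k = 0 \<or> k = m") (auto simp: harmonic_def out_current_diff)
  qed fact
  then show ?thesis by simp
qed

end

section \<open>The universal response through harmonic functions\<close>

definition straight :: "nat \<Rightarrow> (edge \<Rightarrow> real) \<Rightarrow> nat \<Rightarrow> int \<Rightarrow> real" where
  "straight n w k i = lift n w (Straight k i)"

definition diagonal :: "nat \<Rightarrow> (edge \<Rightarrow> real) \<Rightarrow> nat \<Rightarrow> int \<Rightarrow> real" where
  "diagonal n w k i = lift n w (Diagonal k i)"

lemma conductances_posD:
  assumes "w \<in> conductances n m" "1 \<le> n" "k < m"
  shows "0 < straight n w k i" "0 < diagonal n w k i"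
proof -
  have "0 \<le> i mod int n" "i mod int n < int n" using assms(2) by auto
  then have "Straight k (i mod int n) \<in> edges n m" "Diagonal k (i mod int n) \<in> edges n m"
    using assms(3) by (auto simp: edges_def)
  then have "w (Straight k (i mod int n)) \<in> {0<..}" "w (Diagonal k (i mod int n)) \<in> {0<..}"
    using assms(1) unfolding conductances_def by (meson PiE_mem)+
  then show "0 < straight n w k i" "0 < diagonal n w k i"
    by (simp_all add: straight_def diagonal_def lift_def)
qed

lemma straight_periodic: "straight n w k (i + int n) = straight n w k i"
  and diagonal_periodic: "diagonal n w k (i + int n) = diagonal n w k i"
  by (simp_all add: straight_def diagonal_def lift_def)

lemma strip_conductances:
  assumes "w \<in> conductances n m" "1 \<le> n" "1 \<le> m"
  shows "strip n m (diagonal n w) (straight n w)"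
  using assms conductances_posD[OF assms(1,2)]
  by unfold_locales (auto simp: straight_periodic diagonal_periodic)

section \<open>Schur complements as Dirichlet problems, and the passage to the limit\<close>

lemma incident_edges:
  assumes "k \<le> m"
  shows "{e \<in> cover_edges m. (k, i) \<in> cover_ends e} =
    (if k < m then {Straight k i, Diagonal k i} else {}) \<union>
    (if 0 < k then {Straight (k - 1) i, Diagonal (k - 1) (i + 1)} else {})" (is "?L = ?R")
proof (rule Set.set_eqI)
  fix e
  show "e \<in> ?L \<longleftrightarrow> e \<in> ?R"
    using assms by (cases e) (auto simp: cover_edges_def)
qed

text \<open>A vertex of \<open>V\<close> keeps all its edges, because every edge meeting
  \<open>V\<close> is kept, so its row is that of the full network. The minus sign comes from the
  negative diagonal of the Kirchhoff matrix. \<open>F\<close> only has to contain the support of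
  \<open>f\<close>, which allows sums over the interior with or without an extra boundary
  vertex.\<close>

lemma kirchhoff_row:
  assumes k: "k \<le> m" and V: "(k, i) \<in> V" and F: "finite F" "\<And>x. x \<notin> F \<Longrightarrow> f x = 0"
  shows "(\<Sum>x\<in>F. kirchhoff {e \<in> cover_edges m. cover_ends e \<inter> V \<noteq> {}} (lift n w) (k, i) x * f x) =
    - out_current m (diagonal n w) (straight n w) (\<lambda>k i. f (k, i)) k i"
proof -
  define u where "u = (k, i)"
  define c where "c = lift n w"
  define E where "E = {e \<in> cover_edges m. cover_ends e \<inter> V \<noteq> {}}"
  define D where "D = {e \<in> cover_edges m. u \<in> cover_ends e}"
  have D: "D = (if k < m then {Straight k i, Diagonal k i} else {}) \<union>
    (if 0 < k then {Straight (k - 1) i, Diagonal (k - 1) (i + 1)} else {})"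
    unfolding D_def u_def by (rule incident_edges[OF k])
  have fD: "finite D" by (simp add: D)
  have DE: "{e \<in> E. u \<in> cover_ends e} = D" using V by (auto simp: D_def E_def u_def)
  have K: "kirchhoff E c u x = (\<Sum>e\<in>D. c e * (of_bool (cover_ends e = {u, x} \<and> x \<noteq> u) - of_bool (x = u)))" for x
  proof (cases "x = u")
    case True
    then show ?thesis by (simp add: kirchhoff_def DE sum_negf)
  next
    case False
    then have "{e \<in> E. cover_ends e = {u, x}} = {e \<in> D. cover_ends e = {u, x}}" using DE by auto
    then have "kirchhoff E c u x = sum c {e \<in> D. cover_ends e = {u, x}}" using False by (simp add: kirchhoff_def)
    also have "\<dots> = (\<Sum>e\<in>D. if cover_ends e = {u, x} then c e else 0)" using fD by (rule sum.inter_filter)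
    also have "\<dots> = (\<Sum>e\<in>D. c e * (of_bool (cover_ends e = {u, x} \<and> x \<noteq> u) - of_bool (x = u)))"
      using False by (intro sum.cong) auto
    finally show ?thesis .
  qed
  have pick: "(\<Sum>x\<in>F. of_bool (x = y) * f x) = f y" for y
    using F by (cases "y \<in> F") (auto simp: of_bool_def if_distrib[of "\<lambda>z. z * _"] sum.delta cong: if_cong)
  define g where "g = (\<lambda>e. c e * (\<Sum>x\<in>F. of_bool (cover_ends e = {u, x} \<and> x \<noteq> u) * f x - of_bool (x = u) * f x))"
  have g: "g e = c e * (f y - f u)" if "cover_ends e = {u, y}" "y \<noteq> u" for e y
  proof -
    have "(cover_ends e = {u, x} \<and> x \<noteq> u) \<longleftrightarrow> x = y" for x using that by (auto simp: doubleton_eq_iff)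
    then show ?thesis by (simp only: g_def sum_subtractf pick)
  qed
  have "(\<Sum>x\<in>F. kirchhoff E c u x * f x) =
      (\<Sum>x\<in>F. \<Sum>e\<in>D. c e * (of_bool (cover_ends e = {u, x} \<and> x \<noteq> u) * f x - of_bool (x = u) * f x))"
    unfolding K sum_distrib_right by (intro sum.cong) (auto simp: algebra_simps)
  also have "\<dots> = (\<Sum>e\<in>D. g e)"
    unfolding g_def sum_distrib_left by (rule sum.swap)
  also have "\<dots> = - out_current m (diagonal n w) (straight n w) (\<lambda>k i. f (k, i)) k i"
  proof -
    have 1: "g (Straight k i) = straight n w k i * (f (Suc k, i) - f (k, i))"
      by (subst g[of _ "(Suc k, i)"]) (auto simp: u_def c_def straight_def)
    have 2: "g (Diagonal k i) = diagonal n w k i * (f (Suc k, i - 1) - f (k, i))"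
      by (subst g[of _ "(Suc k, i - 1)"]) (auto simp: u_def c_def diagonal_def)
    have 3: "g (Straight (k - 1) i) = straight n w (k - 1) i * (f (k - 1, i) - f (k, i))" if "0 < k"
      using that by (subst g[of _ "(k - 1, i)"]) (auto simp: u_def c_def straight_def)
    have 4: "g (Diagonal (k - 1) (i + 1)) = diagonal n w (k - 1) (i + 1) * (f (k - 1, i + 1) - f (k, i))" if "0 < k"
      using that by (subst g[of _ "(k - 1, i + 1)"]) (auto simp: u_def c_def diagonal_def)
    consider "k = 0" "k < m" | "0 < k" "k < m" | "k = m" "0 < k" | "k = 0" "m = 0" using k by linarith
    then show ?thesis
    proof cases
      case 1
      then show ?thesis using \<open>g (Straight k i) = _\<close> 2 by (simp add: D out_current_def algebra_simps)
    next
      case c2: 2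
      have "D = {Straight k i, Diagonal k i, Straight (k - 1) i, Diagonal (k - 1) (i + 1)}"
        using c2 by (auto simp: D)
      moreover have "k \<noteq> k - 1" using c2 by simp
      ultimately have "sum g D = g (Straight k i) + (g (Diagonal k i) + (g (Straight (k - 1) i) + g (Diagonal (k - 1) (i + 1))))"
        by simp
      then show ?thesis using 1 2 3[OF c2(1)] 4[OF c2(1)] c2 by (simp add: out_current_def algebra_simps)
    next
      case c3: 3
      then show ?thesis using 3 4 by (simp add: D out_current_def algebra_simps)
    next
      case 4
      then show ?thesis by (simp add: D out_current_def)
    qed
  qed
  finally show ?thesis by (simp add: E_def c_def u_def)
qed

text \<open>A left inverse and a right inverse of the same matrix agree, and the entries outside
  \<open>I\<close> are pinned to 0, so the description by \<open>THE\<close> has only one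
  solution.\<close>

lemma inverse_matrix_on_eqI:
  assumes I: "finite I"
    and z: "\<And>x y. x \<notin> I \<or> y \<notin> I \<Longrightarrow> B x y = 0"
    and r: "\<And>x y. \<lbrakk>x \<in> I; y \<in> I\<rbrakk> \<Longrightarrow> (\<Sum>z\<in>I. A x z * B z y) = of_bool (x = y)"
    and l: "\<And>x y. \<lbrakk>x \<in> I; y \<in> I\<rbrakk> \<Longrightarrow> (\<Sum>z\<in>I. B x z * A z y) = of_bool (x = y)"
  shows "inverse_matrix_on I A = B"
  unfolding inverse_matrix_on_def
proof (rule the_equality)
  fix B' assume B': "(\<forall>x y. x \<notin> I \<or> y \<notin> I \<longrightarrow> B' x y = 0) \<and>
     (\<forall>x\<in>I. \<forall>y\<in>I. (\<Sum>z\<in>I. A x z * B' z y) = of_bool (x = y)) \<and>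
     (\<forall>x\<in>I. \<forall>y\<in>I. (\<Sum>z\<in>I. B' x z * A z y) = of_bool (x = y))"
  have pick: "(\<Sum>z\<in>I. of_bool (z = y) * f z) = f y" "(\<Sum>z\<in>I. f z * of_bool (y = z)) = f y"
    if "y \<in> I" for y and f :: "_ \<Rightarrow> real"
    using I that by (simp_all add: of_bool_def if_distrib[of "\<lambda>z. z * _"] if_distrib[of "\<lambda>z. _ * z"] sum.delta sum.delta' cong: if_cong)
  have "B' x y = B x y" if xy: "x \<in> I" "y \<in> I" for x y
  proof -
    have "B' x y = (\<Sum>t\<in>I. B' x t * of_bool (y = t))" using pick(2)[OF xy(2)] by simp
    also have "\<dots> = (\<Sum>t\<in>I. B' x t * (\<Sum>z\<in>I. A t z * B z y))"
      using xy r by (intro sum.cong refl) (simp add: eq_commute)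
    also have "\<dots> = (\<Sum>t\<in>I. \<Sum>z\<in>I. B' x t * A t z * B z y)" by (simp add: sum_distrib_left mult.assoc)
    also have "\<dots> = (\<Sum>z\<in>I. (\<Sum>t\<in>I. B' x t * A t z) * B z y)"
      by (subst sum.swap) (simp add: sum_distrib_right)
    also have "\<dots> = (\<Sum>z\<in>I. of_bool (z = x) * B z y)" using B' xy by (intro sum.cong refl) auto
    also have "\<dots> = B x y" using pick(1)[OF xy(1)] by simp
    finally show ?thesis .
  qed
  then show "B' = B" using B' z by (intro ext) metis
qed (use z r l in auto)

lemma tendsto_out_current:
  assumes "\<And>k i. k \<le> m \<Longrightarrow> (\<lambda>N. u N k i) \<longlonglongrightarrow> v k i" "k \<le> m"
  shows "(\<lambda>N. out_current m a b (u N) k i) \<longlonglongrightarrow> out_current m a b v k i"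
proof -
  have 1: "(\<lambda>N. b k i *\<^sub>R (u N k i - u N (Suc k) i) + a k i *\<^sub>R (u N k i - u N (Suc k) (i - 1)))
     \<longlonglongrightarrow> b k i *\<^sub>R (v k i - v (Suc k) i) + a k i *\<^sub>R (v k i - v (Suc k) (i - 1))" if "k < m"
    using assms that by (intro tendsto_intros) auto
  have 2: "(\<lambda>N. b (k - 1) i *\<^sub>R (u N k i - u N (k - 1) i) + a (k - 1) (i + 1) *\<^sub>R (u N k i - u N (k - 1) (i + 1)))
     \<longlonglongrightarrow> b (k - 1) i *\<^sub>R (v k i - v (k - 1) i) + a (k - 1) (i + 1) *\<^sub>R (v k i - v (k - 1) (i + 1))"
    using assms by (intro tendsto_intros) auto
  show ?thesis unfolding out_current_def
    by (intro tendsto_add) (use 1 2 in \<open>auto intro: tendsto_eq_intros\<close>)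
qed

context strip
begin

text \<open>Once \<open>d\<close> is fixed by the wanted accuracy, a window reaching
  \<open>d\<close> rows beyond the given point suffices in \<open>decay\<close>, and the equations
  hold on it for all large \<open>N\<close>. The convergence is pointwise, which is enough because
  currents are local.\<close>

lemma tendsto_zero_if_eventually_harmonic:
  fixes E :: "nat \<Rightarrow> nat \<Rightarrow> int \<Rightarrow> 'v::real_normed_vector"
  assumes bd: "\<forall>\<^sub>F N in sequentially. \<forall>k i. k \<le> m \<longrightarrow> norm (E N k i) \<le> M"
    and h: "\<And>R. \<forall>\<^sub>F N in sequentially. \<forall>k i. k \<le> m \<longrightarrow> \<bar>i\<bar> \<le> int R \<longrightarrow>
              E N k i = 0 \<or> (0 < k \<and> k < m \<and> current (E N) k i = 0)"
    and k: "k \<le> m"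
  shows "(\<lambda>N. E N k i) \<longlonglongrightarrow> 0"
proof -
  obtain \<theta> where th: "0 \<le> \<theta>" "\<theta> < 1" and dec:
    "\<forall>(e :: nat \<Rightarrow> int \<Rightarrow> 'v) M R d k i.
     (\<forall>k i. k \<le> m \<longrightarrow> norm (e k i) \<le> M) \<longrightarrow>
     (\<forall>k i. k \<le> m \<longrightarrow> \<bar>i\<bar> \<le> int R \<longrightarrow> e k i = 0 \<or> (0 < k \<and> k < m \<and> current e k i = 0)) \<longrightarrow>
     k \<le> m \<longrightarrow> \<bar>i\<bar> + int d \<le> int R + 1 \<longrightarrow> norm (e k i) \<le> 2 * M * \<theta> ^ d"
    using decay[where 'v = 'v] by (elim exE conjE) (rule that)
  show ?thesis
  proof (rule tendstoI)
    fix \<epsilon> :: real assume "0 < \<epsilon>"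
    have "(\<lambda>d. 2 * M * \<theta> ^ d) \<longlonglongrightarrow> 2 * M * 0"
      using th by (intro tendsto_mult tendsto_const LIMSEQ_realpow_zero) auto
    then have "\<forall>\<^sub>F d in sequentially. 2 * M * \<theta> ^ d < \<epsilon>"
      using \<open>0 < \<epsilon>\<close> by (auto elim: order_tendstoD)
    then obtain d where d: "2 * M * \<theta> ^ d < \<epsilon>" by (auto simp: eventually_sequentially)
    from bd h[of "nat \<bar>i\<bar> + d"] show "\<forall>\<^sub>F N in sequentially. dist (E N k i) 0 < \<epsilon>"
    proof eventually_elim
      case (elim N)
      have "norm (E N k i) \<le> 2 * M * \<theta> ^ d"
        using dec[rule_format, of "E N" M "nat \<bar>i\<bar> + d" k i d] elim k by auto
      then show ?case using d by simp
    qed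
  qed
qed

lemma abs_current_le:
  "\<exists>C::real. 0 \<le> C \<and> (\<forall>(u :: nat \<Rightarrow> int \<Rightarrow> real) k i. (\<forall>k i. \<bar>u k i\<bar> \<le> 1) \<longrightarrow> 0 < k \<longrightarrow> k < m \<longrightarrow> \<bar>current u k i\<bar> \<le> C)"
proof -
  obtain lo hi where lo: "0 < lo" "lo \<le> hi" and
    bnd: "\<And>k i. k < m \<Longrightarrow> lo \<le> a k i \<and> a k i \<le> hi \<and> lo \<le> b k i \<and> b k i \<le> hi"
    using ex_bounds by blast
  have "\<bar>current u k i\<bar> \<le> 8 * hi" if u: "\<And>k i. \<bar>u k i\<bar> \<le> 1" and k: "0 < k" "k < m" for u :: "nat \<Rightarrow> int \<Rightarrow> real" and k i
  proof -
    have p: "lo \<le> a k i \<and> a k i \<le> hi \<and> lo \<le> b k i \<and> b k i \<le> hi" 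
      "lo \<le> a (k - 1) (i + 1) \<and> a (k - 1) (i + 1) \<le> hi \<and> lo \<le> b (k - 1) i \<and> b (k - 1) i \<le> hi"
      using bnd[of k i] bnd[of "k-1" i] bnd[of "k-1" "i+1"] k by (simp_all add: less_imp_diff_less)
    have d: "\<bar>u k i - u k' i'\<bar> \<le> 2" for k' i' using u[of k i] u[of k' i'] by linarith
    have t: "\<bar>c * (u k i - u k' i')\<bar> \<le> hi * 2" if "lo \<le> c" "c \<le> hi" for c k' i'
      unfolding abs_mult using d that lo by (intro mult_mono) auto
    have 4: "\<bar>x + y + (z + v)\<bar> \<le> 8 * hi"
      if "\<bar>x\<bar> \<le> hi * 2" "\<bar>y\<bar> \<le> hi * 2" "\<bar>z\<bar> \<le> hi * 2" "\<bar>v\<bar> \<le> hi * 2" for x y z v :: real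
      using that by linarith
    show ?thesis
      using k 4 t[of "b k i" "Suc k" i] t[of "a k i" "Suc k" "i - 1"] t[of "b (k - 1) i" "k - 1" i]
        t[of "a (k - 1) (i + 1)" "k - 1" "i + 1"] p by (simp add: out_current_def)
  qed
  note main = this
  show ?thesis
  proof (intro exI[of _ "8 * hi"] conjI allI impI)
    show "\<bar>current u k i\<bar> \<le> 8 * hi" if "\<forall>k i. \<bar>u k i\<bar> \<le> 1" "0 < k" "k < m" for u k i
      by (rule main[OF _ that(2,3)]) (use that(1) in blast)
  qed (use lo in simp)
qed

end

text \<open>An entry of a Schur complement is minus the current at one boundary vertex when another
  one carries potential 1, all other non-interior vertices carry 0 and the interior ones adjust
  harmonically; vertices outside \<open>V\<close> are grounded as well. The bound \<open>K\<close>
  is uniform in \<open>V\<close>, which makes the passage to the limit possible.\<close>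

lemma truncated_response_eq_current:
  assumes w: "w \<in> conductances n m" and n: "1 \<le> n" and m: "1 \<le> m"
  shows "\<exists>K. \<forall>V p q r s. finite V \<longrightarrow> V \<subseteq> cover_vertices m \<longrightarrow> (p, q) \<in> V \<inter> cover_boundary m \<longrightarrow>
       (r, s) \<in> V \<inter> cover_boundary m \<longrightarrow>
       (\<exists>h. (\<forall>k i. \<bar>h k i\<bar> \<le> K) \<and> (\<forall>k i. (k, i) \<notin> V - cover_boundary m \<longrightarrow> h k i = of_bool (k = r \<and> i = s)) \<and>
           (\<forall>k i. (k, i) \<in> V - cover_boundary m \<longrightarrow> out_current m (diagonal n w) (straight n w) h k i = 0) \<and>
           truncated_response n m w V (p, q) (r, s) = - out_current m (diagonal n w) (straight n w) h p q)"
proof -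
  interpret strip n m "diagonal n w" "straight n w" using strip_conductances[OF w n m] .
  obtain C :: real where C: "0 \<le> C" "\<forall>(u :: nat \<Rightarrow> int \<Rightarrow> real) k i. (\<forall>k i. \<bar>u k i\<bar> \<le> 1) \<longrightarrow> 0 < k \<longrightarrow> k < m \<longrightarrow> \<bar>current u k i\<bar> \<le> C"
    using abs_current_le by (elim exE conjE) (rule that)
  obtain K where K: "0 \<le> K" "\<forall>(g :: nat \<Rightarrow> int \<Rightarrow> real) I M.
       (\<forall>k i. (k, i) \<in> I \<longrightarrow> 0 < k \<and> k < m \<and> norm (g k i) \<le> M) \<longrightarrow> 0 \<le> M \<longrightarrow>
       (\<exists>f. (\<forall>k i. norm (f k i) \<le> K * M) \<and> (\<forall>k i. (k, i) \<notin> I \<longrightarrow> f k i = 0) \<and>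
           (\<forall>k i. (k, i) \<in> I \<longrightarrow> current f k i = g k i))"
    using ex_solution[where 'v = real] by (elim exE conjE) (rule that)
  have main: "\<exists>h. (\<forall>k i. \<bar>h k i\<bar> \<le> 1 + K * C) \<and> (\<forall>k i. (k, i) \<notin> V - cover_boundary m \<longrightarrow> h k i = of_bool (k = r \<and> i = s)) \<and>
           (\<forall>k i. (k, i) \<in> V - cover_boundary m \<longrightarrow> current h k i = 0) \<and>
           truncated_response n m w V (p, q) (r, s) = - current h p q"
    if V: "finite V" "V \<subseteq> cover_vertices m" "(p, q) \<in> V \<inter> cover_boundary m" "(r, s) \<in> V \<inter> cover_boundary m"
    for V p q r s
  proof -
    define I where "I = V - cover_boundary m"
    have fI: "finite I" using V by (simp add: I_def)
    have I: "0 < k" "k < m" "k \<le> m" "(k, i) \<in> V" if "(k, i) \<in> I" for k i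
    proof -
      have "k \<le> m" "k \<noteq> 0" "k \<noteq> m" using that V(2) by (auto simp: I_def cover_vertices_def cover_boundary_def)
      then show "0 < k" "k < m" "k \<le> m" "(k, i) \<in> V" using that by (auto simp: I_def)
    qed
    define A where "A = kirchhoff {e \<in> cover_edges m. cover_ends e \<inter> V \<noteq> {}} (lift n w)"
    have row: "(\<Sum>x\<in>F. A (k, i) x * f x) = - current (\<lambda>k i. f (k, i)) k i"
      if "k \<le> m" "(k, i) \<in> V" "finite F" "\<And>x. x \<notin> F \<Longrightarrow> f x = 0" for k i F f
      using kirchhoff_row[OF that] by (simp add: A_def)
    \<comment> \<open>Uniqueness for the Dirichlet problem on the finite set \<open>I\<close>; as
      \<open>f\<close> vanishes elsewhere, the sum of its absolute values over \<open>I\<close> is a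
      global bound.\<close>
    have zero: "f k i = 0"
      if "\<And>k i. (k, i) \<notin> I \<Longrightarrow> f k i = 0" "\<And>k i. (k, i) \<in> I \<Longrightarrow> current f k i = 0" for f :: "nat \<Rightarrow> int \<Rightarrow> real" and k i
    proof (cases "(k, i) \<in> I")
      case True
      show ?thesis
      proof (rule bounded_unique[of f "\<Sum>(k, i)\<in>I. \<bar>f k i\<bar>"])
        show "norm (f k i) \<le> (\<Sum>(k, i)\<in>I. \<bar>f k i\<bar>)" for k i
        proof (cases "(k, i) \<in> I")
          case True
          then show ?thesis using member_le_sum[of "(k, i)" I "\<lambda>(k, i). \<bar>f k i\<bar>"] fI by auto
        next
          case False
          then show ?thesis using that(1)[OF False] by (auto intro: sum_nonneg)
        qed
        show "f k i = 0 \<or> 0 < k \<and> k < m \<and> current f k i = 0" for k i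
          using that I[of k i] by blast
      qed (use I True in auto)
    qed (use that in auto)
    have "\<exists>f :: nat \<Rightarrow> int \<Rightarrow> real. (\<forall>k i. (k, i) \<notin> I \<longrightarrow> f k i = 0) \<and>
        (\<forall>k i. (k, i) \<in> I \<longrightarrow> current f k i = of_bool ((k, i) = y))" for y
    proof -
      have "\<exists>f :: nat \<Rightarrow> int \<Rightarrow> real. (\<forall>k i. norm (f k i) \<le> K * 1) \<and> (\<forall>k i. (k, i) \<notin> I \<longrightarrow> f k i = 0) \<and>
           (\<forall>k i. (k, i) \<in> I \<longrightarrow> current f k i = of_bool ((k, i) = y))"
        by (rule K(2)[rule_format]) (use I in auto)
      then show ?thesis by (elim exE conjE) (intro exI conjI)
    qed
    then have "\<exists>g :: _ \<Rightarrow> nat \<Rightarrow> int \<Rightarrow> real. \<forall>y. (\<forall>k i. (k, i) \<notin> I \<longrightarrow> g y k i = 0) \<and> (\<forall>k i. (k, i) \<in> I \<longrightarrow> current (g y) k i = of_bool ((k, i) = y))"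
      by (intro choice allI)
    then obtain g :: "nat \<times> int \<Rightarrow> nat \<Rightarrow> int \<Rightarrow> real" where g: "\<And>y k i. (k, i) \<notin> I \<Longrightarrow> g y k i = 0"
      "\<And>y k i. (k, i) \<in> I \<Longrightarrow> current (g y) k i = of_bool ((k, i) = y)"
      by blast
    \<comment> \<open>The columns are the Green functions of \<open>I\<close>, negated because
      Kirchhoff rows compute minus the current.\<close>
    define B where "B = (\<lambda>x y. if x \<in> I \<and> y \<in> I then - g y (fst x) (snd x) else 0)"
    have r: "(\<Sum>z\<in>I. A x z * B z y) = of_bool (x = y)" if xy: "x \<in> I" "y \<in> I" for x y
    proof -
      obtain k i where x: "x = (k, i)" by (cases x)
      have "(\<Sum>z\<in>I. A x z * B z y) = - current (\<lambda>k i. B (k, i) y) k i"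
        unfolding x by (rule row) (use xy I x fI in \<open>auto simp: B_def\<close>)
      also have "(\<lambda>k i. B (k, i) y) = (\<lambda>k i. 0 - g y k i)" using xy g(1) by (auto simp: B_def fun_eq_iff)
      also have "- current \<dots> k i = current (g y) k i" by (simp only: out_current_diff) simp
      finally show ?thesis using g(2)[of k i y] xy by (simp add: x)
    qed
    \<comment> \<open>As matrices on \<open>I\<close>, \<open>A (B A - 1) = (A B) A - A = 0\<close>,
      and by \<open>zero\<close> the matrix \<open>A\<close> is injective.\<close>
    have l: "(\<Sum>z\<in>I. B x z * A z y) = of_bool (x = y)" if xy: "x \<in> I" "y \<in> I" for x y
    proof -
      define e where "e = (\<lambda>x. if x \<in> I then (\<Sum>z\<in>I. B x z * A z y) - of_bool (x = y) else 0)"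
      have "e (k, i) = 0" for k i
      proof (rule zero[of "\<lambda>k i. e (k, i)"])
        fix k i assume ki: "(k, i) \<in> I"
        have "- current (\<lambda>k i. e (k, i)) k i = (\<Sum>x\<in>I. A (k, i) x * e x)"
          by (rule row[symmetric]) (use ki I fI in \<open>auto simp: e_def\<close>)
        also have "\<dots> = (\<Sum>x\<in>I. \<Sum>z\<in>I. A (k, i) x * B x z * A z y) - (\<Sum>x\<in>I. A (k, i) x * of_bool (x = y))"
          by (simp add: e_def right_diff_distrib sum_subtractf sum_distrib_left mult.assoc)
        also have "(\<Sum>x\<in>I. \<Sum>z\<in>I. A (k, i) x * B x z * A z y) = (\<Sum>z\<in>I. (\<Sum>x\<in>I. A (k, i) x * B x z) * A z y)"
          by (subst sum.swap) (simp add: sum_distrib_right)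
        also have "\<dots> = (\<Sum>z\<in>I. of_bool ((k, i) = z) * A z y)"
          by (intro sum.cong refl) (simp only: r[OF ki])
        also have "\<dots> = A (k, i) y" using ki fI
          by (simp add: of_bool_def if_distrib[of "\<lambda>z. z * _"] sum.delta' cong: if_cong)
        also have "(\<Sum>x\<in>I. A (k, i) x * of_bool (x = y)) = A (k, i) y" using xy fI
          by (simp add: of_bool_def if_distrib[of "\<lambda>z. _ * z"] sum.delta cong: if_cong)
        finally show "current (\<lambda>k i. e (k, i)) k i = 0" by simp
      qed (simp add: e_def)
      from this[of "fst x" "snd x"] show ?thesis using xy by (simp add: e_def)
    qed
    have B: "inverse_matrix_on I A = B"
      by (rule inverse_matrix_on_eqI[OF fI _ r l]) (auto simp: B_def)
    \<comment> \<open>The interior potential induced by a unit potential at \<open>(r, s)\<close>: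
      minus the inverse applied to the corresponding column of \<open>A\<close>.\<close>
    define f where "f = (\<lambda>x. - (\<Sum>y\<in>I. B x y * A y (r, s)))"
    have f0: "f x = 0" if "x \<notin> I" for x using that by (simp add: f_def B_def)
    have fr: "(\<Sum>z\<in>I. A x z * f z) = - A x (r, s)" if "x \<in> I" for x
    proof -
      have "(\<Sum>z\<in>I. A x z * f z) = - (\<Sum>z\<in>I. \<Sum>y\<in>I. A x z * B z y * A y (r, s))"
        by (simp add: f_def sum_distrib_left sum_negf mult.assoc)
      also have "\<dots> = - (\<Sum>y\<in>I. (\<Sum>z\<in>I. A x z * B z y) * A y (r, s))"
        by (subst sum.swap) (simp add: sum_distrib_right)
      also have "\<dots> = - (\<Sum>y\<in>I. of_bool (x = y) * A y (r, s))"
        by (intro arg_cong[of _ _ uminus] sum.cong refl) (simp only: r[OF that])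
      also have "\<dots> = - A x (r, s)" using that fI
          by (simp add: of_bool_def if_distrib[of "\<lambda>z. z * _"] sum.delta' cong: if_cong)
      finally show ?thesis .
    qed
    have rs: "(r, s) \<notin> I" using V by (auto simp: I_def)
    define \<delta> where "\<delta> = (\<lambda>k i. of_bool (k = r \<and> i = s) :: real)"
    define h where "h = (\<lambda>k i. \<delta> k i + f (k, i))"
    have hrow: "(\<Sum>z\<in>I. A x z * f z) + A x (r, s) = - current h (fst x) (snd x)" if x: "x \<in> V" for x
    proof -
      obtain k i where xx: "x = (k, i)" by (cases x)
      have "(\<Sum>z\<in>insert (r, s) I. A x z * h (fst z) (snd z)) = - current h k i"
        unfolding xx by (subst row) (use x xx V fI f0 in \<open>auto simp: h_def \<delta>_def cover_vertices_def\<close>)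
      moreover have "(\<Sum>z\<in>insert (r, s) I. A x z * h (fst z) (snd z)) = A x (r, s) + (\<Sum>z\<in>I. A x z * h (fst z) (snd z))"
        using rs fI f0 by (simp add: h_def \<delta>_def)
      moreover have "(\<Sum>z\<in>I. A x z * h (fst z) (snd z)) = (\<Sum>z\<in>I. A x z * f z)"
        using rs by (intro sum.cong) (auto simp: h_def \<delta>_def)
      ultimately show ?thesis by (simp add: xx)
    qed
    have hI: "current h k i = 0" if "(k, i) \<in> I" for k i
      using hrow[of "(k, i)"] fr[of "(k, i)"] that by (simp add: I_def)
    have "truncated_response n m w V (p, q) (r, s) = A (p, q) (r, s) + (\<Sum>z\<in>I. A (p, q) z * f z)"
    proof -
      have "(\<Sum>x\<in>I. \<Sum>y\<in>I. A (p, q) x * B x y * A y (r, s)) = - (\<Sum>z\<in>I. A (p, q) z * f z)"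
        by (simp add: f_def sum_distrib_left sum_negf mult.assoc)
      then show ?thesis
        using B by (simp add: truncated_response_def schur_complement_def A_def I_def)
    qed
    also have "\<dots> = - current h p q" using hrow[of "(p, q)"] V by simp
    finally have tr: "truncated_response n m w V (p, q) (r, s) = - current h p q" .
    have hd: "h k i = \<delta> k i" if "(k, i) \<notin> I" for k i using f0 that by (simp add: h_def)
    have dc: "\<bar>current \<delta> k i\<bar> \<le> C" if "0 < k" "k < m" for k i
      using C(2)[rule_format, of \<delta> k i] that by (simp add: \<delta>_def)
    \<comment> \<open>Solving the same problem through \<open>ex_solution\<close> gives a bound
      independent of \<open>V\<close>, and by uniqueness the solution is \<open>f\<close>.\<close>
    obtain f' :: "nat \<Rightarrow> int \<Rightarrow> real" where f': "\<And>k i. \<bar>f' k i\<bar> \<le> K * C" "\<And>k i. (k, i) \<notin> I \<Longrightarrow> f' k i = 0"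
       "\<And>k i. (k, i) \<in> I \<Longrightarrow> current f' k i = - current \<delta> k i"
    proof -
      have "\<exists>f :: nat \<Rightarrow> int \<Rightarrow> real. (\<forall>k i. norm (f k i) \<le> K * C) \<and> (\<forall>k i. (k, i) \<notin> I \<longrightarrow> f k i = 0) \<and>
           (\<forall>k i. (k, i) \<in> I \<longrightarrow> current f k i = - current \<delta> k i)"
        by (rule K(2)[rule_format]) (use I dc C(1) in auto)
      then show ?thesis using that by auto
    qed
    have "f (k, i) - f' k i = 0" for k i
    proof (rule zero)
      show "current (\<lambda>k i. f (k, i) - f' k i) k i = 0" if "(k, i) \<in> I" for k i
        using hI[OF that] f'(3)[OF that] by (simp add: out_current_diff out_current_add h_def)
    qed (simp add: f0 f')
    then have "\<bar>h k i\<bar> \<le> 1 + K * C" for k i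
    proof -
      have "f (k, i) = f' k i" using \<open>f (k, i) - f' k i = 0\<close> by simp
      then show ?thesis using f'(1)[of k i] by (auto simp: h_def \<delta>_def)
    qed
    then show ?thesis using hd hI tr by (intro exI[of _ h]) (auto simp: I_def \<delta>_def)
  qed
  show ?thesis by (intro exI[of _ "1 + K * C"] allI impI main)
qed

lemma exhaustion_eventually:
  assumes "exhaustion m V" "finite B" "B \<subseteq> cover_vertices m"
  shows "\<forall>\<^sub>F N in sequentially. B \<subseteq> V N"
proof -
  have "\<forall>\<^sub>F N in sequentially. x \<in> V N" if "x \<in> B" for x
  proof -
    have "x \<in> (\<Union>N. V N)" using assms that by (auto simp: exhaustion_def)
    then obtain N0 where "x \<in> V N0" by blast
    moreover have "mono V" using assms by (simp add: exhaustion_def)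
    ultimately have "x \<in> V N" if "N \<ge> N0" for N using that monoD by blast
    then show ?thesis by (auto simp: eventually_sequentially)
  qed
  then have "\<forall>\<^sub>F N in sequentially. \<forall>x\<in>B. x \<in> V N" using assms(2) by (intro eventually_ball_finite) auto
  then show ?thesis by (auto elim: eventually_mono)
qed

text \<open>Some exhaustion has to exist: otherwise the condition defining
  \<open>universal_response\<close> would be vacuous and its value undetermined.\<close>

lemma exhaustion_boxes: "exhaustion m (\<lambda>N. {0..m} \<times> {- int N..int N})"
proof -
  have "\<exists>N. - int N \<le> i \<and> i \<le> int N" for i by (intro exI[of _ "nat \<bar>i\<bar>"]) auto
  then show ?thesis by (auto simp: exhaustion_def cover_vertices_def mono_def)
qed

text \<open>The truncated solutions are uniformly bounded and on every window eventually satisfy the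
  same equations as \<open>h\<close>, so they converge to \<open>h\<close> pointwise. The current at
  a vertex involves finitely many values and converges as well.\<close>

lemma universal_response_eq_current:
  assumes w: "w \<in> conductances n m" and n: "1 \<le> n" and m: "1 \<le> m"
    and h: "strip.harmonic m (diagonal n w) (straight n w) (h :: nat \<Rightarrow> int \<Rightarrow> real)"
    and hb: "\<And>k i. k \<le> m \<Longrightarrow> \<bar>h k i\<bar> \<le> M"
    and hd: "\<And>k i. k \<in> {0, m} \<Longrightarrow> h k i = of_bool (k = r \<and> i = s)"
    and p: "p \<in> {0, m}" and r: "r \<in> {0, m}"
  shows "universal_response n m w (p, q) (r, s) = - out_current m (diagonal n w) (straight n w) h p q"
proof -
  interpret strip n m "diagonal n w" "straight n w" using strip_conductances[OF w n m] .
  obtain K where K: "\<forall>V p q r s. finite V \<longrightarrow> V \<subseteq> cover_vertices m \<longrightarrow> (p, q) \<in> V \<inter> cover_boundary m \<longrightarrow>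
       (r, s) \<in> V \<inter> cover_boundary m \<longrightarrow>
       (\<exists>h. (\<forall>k i. \<bar>h k i\<bar> \<le> K) \<and> (\<forall>k i. (k, i) \<notin> V - cover_boundary m \<longrightarrow> h k i = of_bool (k = r \<and> i = s)) \<and>
           (\<forall>k i. (k, i) \<in> V - cover_boundary m \<longrightarrow> current h k i = 0) \<and>
           truncated_response n m w V (p, q) (r, s) = - current h p q)"
    using truncated_response_eq_current[OF w n m] by (elim exE) (rule that)
  have lim: "(\<lambda>N. truncated_response n m w (V N) (p, q) (r, s)) \<longlonglongrightarrow> - current h p q" if V: "exhaustion m V" for V
  proof -
    define P where "P = (\<lambda>N g. (\<forall>k i. \<bar>g k i\<bar> \<le> K) \<and> (\<forall>k i. (k, i) \<notin> V N - cover_boundary m \<longrightarrow> g k i = of_bool (k = r \<and> i = s)) \<and>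
           (\<forall>k i. (k, i) \<in> V N - cover_boundary m \<longrightarrow> current g k i = 0) \<and>
           truncated_response n m w (V N) (p, q) (r, s) = - current g p q)"
    \<comment> \<open>Such a potential is known to exist only once \<open>V N\<close> contains both
      boundary vertices, so the choice is meaningful for large \<open>N\<close> only.\<close>
    define H where "H = (\<lambda>N. SOME g. P N g)"
    have "\<forall>\<^sub>F N in sequentially. {(p, q), (r, s)} \<subseteq> V N"
      using p r by (intro exhaustion_eventually[OF V]) (auto simp: cover_vertices_def)
    then have PH: "\<forall>\<^sub>F N in sequentially. P N (H N)"
    proof eventually_elim
      case (elim N)
      have "finite (V N)" "V N \<subseteq> cover_vertices m" using V by (auto simp: exhaustion_def)
      moreover have "(p, q) \<in> V N \<inter> cover_boundary m" "(r, s) \<in> V N \<inter> cover_boundary m"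
        using elim p r by (auto simp: cover_boundary_def)
      ultimately have "\<exists>g. P N g" unfolding P_def using K by blast
      then show ?case unfolding H_def by (rule someI_ex)
    qed
    define E where "E = (\<lambda>N k i. h k i - H N k i)"
    have E0: "(\<lambda>N. E N k i) \<longlonglongrightarrow> 0" if "k \<le> m" for k i
    proof (rule tendsto_zero_if_eventually_harmonic[where M = "M + K"])
      show "\<forall>\<^sub>F N in sequentially. \<forall>k i. k \<le> m \<longrightarrow> norm (E N k i) \<le> M + K"
        using PH
      proof eventually_elim
        case (elim N)
        show ?case
        proof (intro allI impI)
          fix k i assume "k \<le> m"
          then have "\<bar>h k i\<bar> \<le> M" "\<bar>H N k i\<bar> \<le> K" using hb elim by (auto simp: P_def)
          then show "norm (E N k i) \<le> M + K" by (simp add: E_def)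
        qed
      qed
      show "\<forall>\<^sub>F N in sequentially. \<forall>k i. k \<le> m \<longrightarrow> \<bar>i\<bar> \<le> int R \<longrightarrow>
              E N k i = 0 \<or> (0 < k \<and> k < m \<and> current (E N) k i = 0)" for R
      proof -
        have "\<forall>\<^sub>F N in sequentially. {0..m} \<times> {- int R..int R} \<subseteq> V N"
          by (intro exhaustion_eventually[OF V]) (auto simp: cover_vertices_def)
        with PH show ?thesis
        proof eventually_elim
          case (elim N)
          show ?case
          proof (intro allI impI)
            fix k i assume ki: "k \<le> m" "\<bar>i\<bar> \<le> int R"
            show "E N k i = 0 \<or> (0 < k \<and> k < m \<and> current (E N) k i = 0)"
            proof (cases "k \<in> {0, m}")
              case True
              then have "(k, i) \<notin> V N - cover_boundary m" by (auto simp: cover_boundary_def)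
              then have "H N k i = of_bool (k = r \<and> i = s)" using elim(1) unfolding P_def by blast
              then show ?thesis using hd[OF True] by (simp add: E_def)
            next
              case False
              have "(k, i) \<in> {0..m} \<times> {- int R..int R}" using ki by auto
              then have "(k, i) \<in> V N - cover_boundary m" using elim(2) False by (auto simp: cover_boundary_def)
              then have "current (H N) k i = 0" using elim(1) unfolding P_def by blast
              moreover have "0 < k" "k < m" using False ki by auto
              ultimately show ?thesis using h by (simp add: E_def out_current_diff harmonic_def)
            qed
          qed
        qed
      qed
    qed fact
    have "p \<le> m" using p by auto
    then have "(\<lambda>N. current (E N) p q) \<longlonglongrightarrow> current (\<lambda>k i. 0) p q"
      by (intro tendsto_out_current E0)
    from tendsto_diff[OF this tendsto_const[of "current h p q"]]
    have "(\<lambda>N. current (E N) p q - current h p q) \<longlonglongrightarrow> - current h p q" by simp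
    moreover have "\<forall>\<^sub>F N in sequentially. current (E N) p q - current h p q = truncated_response n m w (V N) (p, q) (r, s)"
      using PH by eventually_elim (simp add: E_def out_current_diff P_def)
    ultimately show ?thesis by (rule Lim_transform_eventually)
  qed
  show ?thesis unfolding universal_response_def
  proof (rule the_equality)
    show "l = - current h p q"
      if "\<forall>V. exhaustion m V \<longrightarrow> (\<lambda>N. truncated_response n m w (V N) (p, q) (r, s)) \<longlonglongrightarrow> l" for l
      using LIMSEQ_unique[OF that[rule_format, OF exhaustion_boxes] lim[OF exhaustion_boxes]] .
  qed (use lim in blast)
qed

text \<open>Superposition: boundary data cut off at row \<open>N\<close> are a finite combination of
  unit potentials, and the corresponding harmonic functions converge pointwise to \<open>U\<close>.
  Summing over symmetric windows avoids any question of absolute convergence.\<close>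

lemma universal_response_sums_to_current:
  fixes U :: "nat \<Rightarrow> int \<Rightarrow> 'v::banach"
  assumes w: "w \<in> conductances n m" and n: "1 \<le> n" and m: "1 \<le> m"
    and U: "strip.harmonic m (diagonal n w) (straight n w) U" "\<And>k i. k \<le> m \<Longrightarrow> norm (U k i) \<le> M"
    and p: "p \<in> {0, m}"
  shows "(\<lambda>N. \<Sum>(r, s)\<in>{0, m} \<times> {- int N..int N}. - universal_response n m w (p, q) (r, s) *\<^sub>R U r s)
    \<longlonglongrightarrow> out_current m (diagonal n w) (straight n w) U p q"
proof -
  interpret strip n m "diagonal n w" "straight n w" using strip_conductances[OF w n m] .
  have M: "0 \<le> M" using U(2)[of 0 0] norm_ge_zero order_trans by blast
  obtain K where K: "0 \<le> K" "\<forall>(g :: nat \<Rightarrow> int \<Rightarrow> real) M.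
       (\<forall>k\<in>{0, m}. \<forall>i. norm (g k i) \<le> M) \<longrightarrow> 0 \<le> M \<longrightarrow>
       (\<exists>u. (\<forall>k i. norm (u k i) \<le> K * M) \<and> (\<forall>k\<in>{0, m}. \<forall>i. u k i = g k i) \<and> harmonic u)"
    using ex_harmonic[where 'v = real] by (elim exE conjE) (rule that)
  obtain K' where K': "0 \<le> K'" "\<forall>(g :: nat \<Rightarrow> int \<Rightarrow> 'v) M.
       (\<forall>k\<in>{0, m}. \<forall>i. norm (g k i) \<le> M) \<longrightarrow> 0 \<le> M \<longrightarrow>
       (\<exists>u. (\<forall>k i. norm (u k i) \<le> K' * M) \<and> (\<forall>k\<in>{0, m}. \<forall>i. u k i = g k i) \<and> harmonic u)"
    using ex_harmonic[where 'v = 'v] by (elim exE conjE) (rule that)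
  have "\<exists>h. (\<forall>k i. norm (h k i) \<le> K * 1) \<and> (\<forall>k\<in>{0, m}. \<forall>i. h k i = (of_bool (k = fst y \<and> i = snd y) :: real)) \<and> harmonic h"
    for y :: "nat \<times> int"
    by (rule K(2)[rule_format]) auto
  then have "\<exists>h. \<forall>y. (\<forall>k i. norm (h y k i) \<le> K * 1) \<and>
     (\<forall>k\<in>{0, m}. \<forall>i. h y k i = (of_bool (k = fst y \<and> i = snd y) :: real)) \<and> harmonic (h y)"
    by (intro choice allI)
  then obtain h :: "nat \<times> int \<Rightarrow> nat \<Rightarrow> int \<Rightarrow> real" where h: "\<And>y k i. norm (h y k i) \<le> K * 1"
    "\<And>y k i. k \<in> {0, m} \<Longrightarrow> h y k i = of_bool (k = fst y \<and> i = snd y)" "\<And>y. harmonic (h y)" by blast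
  have L: "- universal_response n m w (p, q) (r, s) = current (h (r, s)) p q" if "r \<in> {0, m}" for r s
    using universal_response_eq_current[OF w n m h(3)[of "(r, s)"], of "K * 1" r s p q] h(1,2) p that by simp
  define B where "B = (\<lambda>N. {0, m} \<times> {- int N..int N})"
  define S where "S = (\<lambda>N k i. \<Sum>y\<in>B N. h y k i *\<^sub>R U (fst y) (snd y))"
  have Sh: "harmonic (S N)" for N
    using h(3) by (simp add: harmonic_def S_def out_current_sum out_current_scaleR)
  have SU: "S N k i = (if \<bar>i\<bar> \<le> int N then U k i else 0)" if k: "k \<in> {0, m}" for N k i
  proof -
    have "S N k i = (\<Sum>y\<in>B N. if (k, i) = y then U k i else 0)"
      unfolding S_def by (intro sum.cong refl) (auto simp: h(2)[OF k])
    also have "\<dots> = (if (k, i) \<in> B N then U k i else 0)" by (simp add: B_def)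
    finally show ?thesis using k by (auto simp: B_def)
  qed
  \<comment> \<open>The termwise estimate grows with \<open>N\<close>. It serves only to identify
    \<open>S N\<close> with the solution from \<open>ex_harmonic\<close>, whose bound depends on the
    boundary data alone.\<close>
  have Sb: "norm (S N k i) \<le> K' * M" if "k \<le> m" for N k i
  proof -
    have "\<exists>u. (\<forall>k i. norm (u k i) \<le> K' * M) \<and> (\<forall>k\<in>{0, m}. \<forall>i. u k i = S N k i) \<and> harmonic u"
      by (rule K'(2)[rule_format]) (use SU U M in auto)
    then obtain u :: "nat \<Rightarrow> int \<Rightarrow> 'v" where u: "\<And>k i. norm (u k i) \<le> K' * M" "\<And>k i. k \<in> {0, m} \<Longrightarrow> u k i = S N k i" "harmonic u" by blast
    have "u k i = S N k i"
    proof (rule harmonic_unique[OF u(3) Sh _ _ u(2) that])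
      show "norm (S N k i) \<le> (\<Sum>y\<in>B N. (K * 1) * norm (U (fst y) (snd y)))" for k i
        unfolding S_def using h(1) by (intro sum_norm_le) (auto intro!: mult_right_mono)
    qed (use u in auto)
    then show ?thesis using u(1)[of k i] by simp
  qed
  have E0: "(\<lambda>N. U k i - S N k i) \<longlonglongrightarrow> 0" if "k \<le> m" for k i
  proof (rule tendsto_zero_if_eventually_harmonic[where E = "\<lambda>N k i. U k i - S N k i" and M = "M + K' * M"])
    have "norm (U k i - S N k i) \<le> M + K' * M" if "k \<le> m" for N k i
      using norm_triangle_ineq4[of "U k i" "S N k i"] U(2)[OF that, of i] Sb[OF that, of N i] by linarith
    then show "\<forall>\<^sub>F N in sequentially. \<forall>k i. k \<le> m \<longrightarrow> norm (U k i - S N k i) \<le> M + K' * M" by simp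
    show "\<forall>\<^sub>F N in sequentially. \<forall>k i. k \<le> m \<longrightarrow> \<bar>i\<bar> \<le> int R \<longrightarrow>
       U k i - S N k i = 0 \<or> (0 < k \<and> k < m \<and> current (\<lambda>k i. U k i - S N k i) k i = 0)" for R
      using eventually_ge_at_top[of R]
    proof eventually_elim
      case (elim N)
      show ?case
      proof (intro allI impI)
        fix k i assume ki: "k \<le> m" "\<bar>i\<bar> \<le> int R"
        show "U k i - S N k i = 0 \<or> (0 < k \<and> k < m \<and> current (\<lambda>k i. U k i - S N k i) k i = 0)"
          using SU[of k N i] ki elim Sh[of N] U(1)
          by (cases "k \<in> {0, m}") (auto simp: out_current_diff harmonic_def)
      qed
    qed
  qed fact
  have "p \<le> m" using p by auto
  then have "(\<lambda>N. current (\<lambda>k i. U k i - S N k i) p q) \<longlonglongrightarrow> current (\<lambda>k i. 0) p q"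
    by (intro tendsto_out_current E0)
  then have "(\<lambda>N. current U p q - current (\<lambda>k i. U k i - S N k i) p q) \<longlonglongrightarrow> current U p q - 0"
    by (intro tendsto_diff tendsto_const) simp
  moreover have "current U p q - current (\<lambda>k i. U k i - S N k i) p q =
      (\<Sum>(r, s)\<in>{0, m} \<times> {- int N..int N}. - universal_response n m w (p, q) (r, s) *\<^sub>R U r s)" for N
  proof -
    have "current (S N) p q = (\<Sum>y\<in>B N. current (h y) p q *\<^sub>R U (fst y) (snd y))"
      by (simp add: S_def out_current_sum out_current_scaleR)
    also have "\<dots> = (\<Sum>y\<in>B N. - universal_response n m w (p, q) y *\<^sub>R U (fst y) (snd y))"
      by (intro sum.cong) (auto simp: B_def simp flip: L)
    finally show ?thesis by (simp add: out_current_diff B_def case_prod_beta)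
  qed
  ultimately show ?thesis by simp
qed

definition same_response :: "nat \<Rightarrow> nat \<Rightarrow> (edge \<Rightarrow> real) \<Rightarrow> (edge \<Rightarrow> real) \<Rightarrow> bool" where
  "same_response n m w w' \<longleftrightarrow> (\<forall>u\<in>cover_boundary m. \<forall>v\<in>cover_boundary m.
     universal_response n m w' u v = universal_response n m w u v)"

text \<open>Equality of response matrices extends from unit potentials to all bounded boundary data,
  because both boundary currents are limits of the same sums.\<close>

lemma same_response_harmonic:
  fixes U :: "nat \<Rightarrow> int \<Rightarrow> 'v::banach"
  assumes w: "w \<in> conductances n m" "w' \<in> conductances n m" and n: "1 \<le> n" and m: "1 \<le> m"
    and same: "same_response n m w w'"
    and U: "strip.harmonic m (diagonal n w) (straight n w) U" "\<And>k i. k \<le> m \<Longrightarrow> norm (U k i) \<le> M"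
  shows "\<exists>U' M'. strip.harmonic m (diagonal n w') (straight n w') U' \<and> (\<forall>k i. k \<le> m \<longrightarrow> norm (U' k i) \<le> M') \<and>
     (\<forall>k\<in>{0, m}. \<forall>i. U' k i = U k i \<and>
        out_current m (diagonal n w') (straight n w') U' k i = out_current m (diagonal n w) (straight n w) U k i)"
proof -
  interpret w': strip n m "diagonal n w'" "straight n w'" using strip_conductances[OF w(2) n m] .
  have M: "0 \<le> M" using U(2)[of 0 0] norm_ge_zero order_trans by blast
  obtain K where K: "0 \<le> K" "\<forall>(g :: nat \<Rightarrow> int \<Rightarrow> 'v) M.
       (\<forall>k\<in>{0, m}. \<forall>i. norm (g k i) \<le> M) \<longrightarrow> 0 \<le> M \<longrightarrow>
       (\<exists>u. (\<forall>k i. norm (u k i) \<le> K * M) \<and> (\<forall>k\<in>{0, m}. \<forall>i. u k i = g k i) \<and> w'.harmonic u)"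
    using w'.ex_harmonic[where 'v = 'v] by (elim exE conjE) (rule that)
  have "\<exists>u. (\<forall>k i. norm (u k i) \<le> K * M) \<and> (\<forall>k\<in>{0, m}. \<forall>i. u k i = U k i) \<and> w'.harmonic u"
    by (rule K(2)[rule_format]) (use U M in auto)
  then obtain U' :: "nat \<Rightarrow> int \<Rightarrow> 'v" where U': "\<And>k i. norm (U' k i) \<le> K * M"
    "\<And>k i. k \<in> {0, m} \<Longrightarrow> U' k i = U k i" "w'.harmonic U'" by blast
  have "out_current m (diagonal n w') (straight n w') U' k i = out_current m (diagonal n w) (straight n w) U k i"
    if k: "k \<in> {0, m}" for k i
  proof -
    have "(\<Sum>(r, s)\<in>{0, m} \<times> {- int N..int N}. - universal_response n m w' (k, i) (r, s) *\<^sub>R U' r s) =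
      (\<Sum>(r, s)\<in>{0, m} \<times> {- int N..int N}. - universal_response n m w (k, i) (r, s) *\<^sub>R U r s)" for N
      using same k U'(2) by (intro sum.cong) (auto simp: same_response_def cover_boundary_def)
    then show ?thesis
      using universal_response_sums_to_current[OF w(2) n m U'(3), of "K * M" k i]
        universal_response_sums_to_current[OF w(1) n m U, of k i] U'(1) k LIMSEQ_unique by auto
  qed
  then show ?thesis using U' by (intro exI[of _ U'] exI[of _ "K * M"]) auto
qed

text \<open>The assumption is applied to the harmonic extension of a unit potential at one boundary
  vertex, whose currents are the entries of the response.\<close>

lemma same_responseI:
  assumes w: "w \<in> conductances n m" "w' \<in> conductances n m" and n: "1 \<le> n" and m: "1 \<le> m"
    and ex: "\<And>(U :: nat \<Rightarrow> int \<Rightarrow> real) M. \<lbrakk>strip.harmonic m (diagonal n w) (straight n w) U;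
        \<And>k i. k \<le> m \<Longrightarrow> norm (U k i) \<le> M\<rbrakk> \<Longrightarrow>
      \<exists>U' M'. strip.harmonic m (diagonal n w') (straight n w') U' \<and> (\<forall>k i. k \<le> m \<longrightarrow> norm (U' k i) \<le> M') \<and>
     (\<forall>k\<in>{0, m}. \<forall>i. U' k i = U k i \<and>
        out_current m (diagonal n w') (straight n w') U' k i = out_current m (diagonal n w) (straight n w) U k i)"
  shows "same_response n m w w'"
  unfolding same_response_def
proof (intro ballI)
  interpret w: strip n m "diagonal n w" "straight n w" using strip_conductances[OF w(1) n m] .
  fix u v assume "u \<in> cover_boundary m" "v \<in> cover_boundary m"
  then obtain p q r s where uv: "u = (p, q)" "v = (r, s)" "p \<in> {0, m}" "r \<in> {0, m}"
    by (cases u; cases v) (auto simp: cover_boundary_def)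
  obtain K where K: "0 \<le> K" "\<forall>(g :: nat \<Rightarrow> int \<Rightarrow> real) M.
       (\<forall>k\<in>{0, m}. \<forall>i. norm (g k i) \<le> M) \<longrightarrow> 0 \<le> M \<longrightarrow>
       (\<exists>u. (\<forall>k i. norm (u k i) \<le> K * M) \<and> (\<forall>k\<in>{0, m}. \<forall>i. u k i = g k i) \<and> w.harmonic u)"
    using w.ex_harmonic[where 'v = real] by (elim exE conjE) (rule that)
  have "\<exists>h. (\<forall>k i. norm (h k i) \<le> K * 1) \<and> (\<forall>k\<in>{0, m}. \<forall>i. h k i = (of_bool (k = r \<and> i = s) :: real)) \<and> w.harmonic h"
    by (rule K(2)[rule_format]) auto
  then obtain h :: "nat \<Rightarrow> int \<Rightarrow> real" where h: "\<And>k i. norm (h k i) \<le> K * 1"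
    "\<And>k i. k \<in> {0, m} \<Longrightarrow> h k i = of_bool (k = r \<and> i = s)" "w.harmonic h" by blast
  obtain h' M' where h': "strip.harmonic m (diagonal n w') (straight n w') h'" "\<And>k i. k \<le> m \<Longrightarrow> norm (h' k i) \<le> M'"
     "\<And>k i. k \<in> {0, m} \<Longrightarrow> h' k i = h k i"
     "\<And>k i. k \<in> {0, m} \<Longrightarrow> out_current m (diagonal n w') (straight n w') h' k i = out_current m (diagonal n w) (straight n w) h k i"
    using ex[OF h(3) h(1)] by blast
  have "universal_response n m w (p, q) (r, s) = - out_current m (diagonal n w) (straight n w) h p q"
    using universal_response_eq_current[OF w(1) n m h(3), of "K * 1" r s p q] h uv by simp
  moreover have "universal_response n m w' (p, q) (r, s) = - out_current m (diagonal n w') (straight n w') h' p q"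
    using universal_response_eq_current[OF w(2) n m h'(1), of M' r s p q] h' h(2) uv by simp
  ultimately show "universal_response n m w' u v = universal_response n m w u v" using h'(4) uv by simp
qed

section \<open>Transfer maps on twisted periodic sequences\<close>

lemma prod_periodic_shift:
  fixes g :: "int \<Rightarrow> 'a::comm_monoid_mult"
  assumes "\<And>i. g (i + int n) = g i"
  shows "(\<Prod>l<n. g (i + int l)) = (\<Prod>l<n. g (int l))"
proof -
  have step: "(\<Prod>l<n. g (i + 1 + int l)) = (\<Prod>l<n. g (i + int l))" for i
  proof (cases n)
    case (Suc k)
    have "(\<Prod>l<n. g (i + 1 + int l)) = (\<Prod>l<k. g (i + 1 + int l)) * g (i + int n)"
      by (simp add: Suc algebra_simps)
    also have "\<dots> = g i * (\<Prod>l<k. g (i + int (Suc l)))" using assms by (simp add: algebra_simps)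
    also have "\<dots> = (\<Prod>l<n. g (i + int l))" unfolding Suc by (simp only: prod.lessThan_Suc_shift) simp
    finally show ?thesis .
  qed simp
  show ?thesis
  proof (induction i rule: int_induct[of _ 0])
    case (step1 i)
    then show ?case using step[of i] by simp
  next
    case (step2 i)
    then show ?case using step[of "i - 1"] by simp
  qed simp
qed

lemma prod_periodic_down:
  fixes g :: "int \<Rightarrow> 'a::comm_monoid_mult"
  assumes "\<And>i. g (i + int n) = g i"
  shows "(\<Prod>l<n. g (i - int l)) = (\<Prod>l<n. g (int l))"
proof -
  have "(\<Prod>l<n. g (i - int l)) = (\<Prod>l<n. g (i - int (n - Suc l)))"
    by (rule prod.nat_diff_reindex[symmetric])
  also have "\<dots> = (\<Prod>l<n. g ((i - int n + 1) + int l))"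
    by (intro prod.cong refl arg_cong[of _ _ g]) auto
  also have "\<dots> = (\<Prod>l<n. g (int l))" by (intro prod_periodic_shift assms)
  finally show ?thesis .
qed

definition ratio :: "nat \<Rightarrow> (int \<Rightarrow> real) \<Rightarrow> (int \<Rightarrow> real) \<Rightarrow> real" where
  "ratio n a b = (\<Prod>l<n. a (int l) / b (int l))"

lemma ratio_down:
  assumes "\<And>i. a (i + int n) = a i" "\<And>i. b (i + int n) = b i"
  shows "(\<Prod>l<n. a (i - int l) / b (i - int l)) = ratio n a b"
  unfolding ratio_def using prod_periodic_down[of "\<lambda>i. a i / b i" n i] assms by simp

lemma ratio_pos: "(\<And>i. 0 < a i) \<Longrightarrow> (\<And>i. 0 < b i) \<Longrightarrow> 0 < ratio n a b"
  by (simp add: ratio_def prod_pos)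

text \<open>Unrolling \<open>u i = (f i + \<tau> * a i * u (i - 1)) / b i\<close> once around the
  period gives this polynomial in \<open>\<tau>\<close> plus
  \<open>\<tau> ^ n * ratio n a b * u i\<close>. At a singular value of the layer it is, up to a
  nonzero factor, the residue of \<open>layer_inv\<close>.\<close>

definition layer_num :: "nat \<Rightarrow> (int \<Rightarrow> real) \<Rightarrow> (int \<Rightarrow> real) \<Rightarrow> 'a::real_normed_field \<Rightarrow> (int \<Rightarrow> 'a) \<Rightarrow> int \<Rightarrow> 'a" where
  "layer_num n a b \<tau> f i =
     (\<Sum>j<n. \<tau> ^ j * of_real (\<Prod>l<j. a (i - int l) / b (i - int l)) * (f (i - int j) / of_real (b (i - int j))))"

text \<open>The inverse of \<open>u \<mapsto> (\<lambda>i. b i * u i - \<tau> * a i * u (i - 1))\<close> on \<open>n\<close>-periodic sequences.\<close>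

definition layer_inv :: "nat \<Rightarrow> (int \<Rightarrow> real) \<Rightarrow> (int \<Rightarrow> real) \<Rightarrow> 'a::real_normed_field \<Rightarrow> (int \<Rightarrow> 'a) \<Rightarrow> int \<Rightarrow> 'a" where
  "layer_inv n a b \<tau> f i = layer_num n a b \<tau> f i / (1 - \<tau> ^ n * of_real (ratio n a b))"

text \<open>The sum telescopes, and the term after a full turn is the first one times
  \<open>\<tau> ^ n * ratio n a b\<close>. The identity includes singular \<open>\<tau>\<close>,
  where \<open>layer_num\<close> thus solves the homogeneous equation.\<close>

lemma layer_num_eq:
  fixes f :: "int \<Rightarrow> 'a::real_normed_field"
  assumes a: "\<And>i. a (i + int n) = a i" and b: "\<And>i. b (i + int n) = b i" "\<And>i. 0 < b i"
    and f: "\<And>i. f (i + int n) = f i"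
  shows "of_real (b i) * layer_num n a b \<tau> f i - \<tau> * of_real (a i) * layer_num n a b \<tau> f (i - 1) =
     (1 - \<tau> ^ n * of_real (ratio n a b)) * f i"
proof -
  define t where "t = (\<lambda>j. \<tau> ^ j * of_real (\<Prod>l<j. a (i - int l) / b (i - int l)) * (f (i - int j) / of_real (b (i - int j))))"
  have b0: "of_real (b i) \<noteq> (0 :: 'a)" using b(2)[of i] by simp
  have per: "b (i - int n) = b i" "f (i - int n) = f i" using b(1)[of "i - int n"] f[of "i - int n"] by simp_all
  have "\<tau> * of_real (a i) * layer_num n a b \<tau> f (i - 1) = of_real (b i) * (\<Sum>j<n. t (Suc j))"
  proof -
    have "\<tau> * of_real (a i) * (\<tau> ^ j * of_real (\<Prod>l<j. a (i - 1 - int l) / b (i - 1 - int l)) * (f (i - 1 - int j) / of_real (b (i - 1 - int j)))) =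
        of_real (b i) * t (Suc j)" for j
    proof -
      have "(\<Prod>l<Suc j. a (i - int l) / b (i - int l)) = a i / b i * (\<Prod>l<j. a (i - 1 - int l) / b (i - 1 - int l))"
        by (subst prod.lessThan_Suc_shift) (simp add: algebra_simps)
      moreover have "i - int (Suc j) = i - 1 - int j" by simp
      ultimately show ?thesis using b0 by (simp only: t_def) (simp add: field_simps)
    qed
    then show ?thesis by (simp add: layer_num_def sum_distrib_left)
  qed
  moreover have "layer_num n a b \<tau> f i = (\<Sum>j<n. t j)" by (simp add: layer_num_def t_def)
  moreover have "(\<Sum>j<n. t j) - (\<Sum>j<n. t (Suc j)) = t 0 - t n"
    using sum_lessThan_telescope'[of t n] by (simp add: sum_subtractf)
  ultimately have "of_real (b i) * layer_num n a b \<tau> f i - \<tau> * of_real (a i) * layer_num n a b \<tau> f (i - 1) = of_real (b i) * (t 0 - t n)"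
    by (metis right_diff_distrib)
  also have "t n = \<tau> ^ n * of_real (ratio n a b) * (f i / of_real (b i))"
    using ratio_down[of a n b i, OF a b(1)] per by (simp add: t_def del: of_real_prod of_real_divide)
  also have "t 0 = f i / of_real (b i)" by (simp add: t_def)
  finally show ?thesis using b0 by (simp add: field_simps)
qed

lemma layer_inv_eq:
  fixes f :: "int \<Rightarrow> 'a::real_normed_field"
  assumes "\<And>i. a (i + int n) = a i" "\<And>i. b (i + int n) = b i" "\<And>i. 0 < b i"
    "\<And>i. f (i + int n) = f i" and ns: "\<tau> ^ n * of_real (ratio n a b) \<noteq> 1"
  shows "of_real (b i) * layer_inv n a b \<tau> f i - \<tau> * of_real (a i) * layer_inv n a b \<tau> f (i - 1) = f i"
proof -
  have "of_real (b i) * layer_inv n a b \<tau> f i - \<tau> * of_real (a i) * layer_inv n a b \<tau> f (i - 1) =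
     (of_real (b i) * layer_num n a b \<tau> f i - \<tau> * of_real (a i) * layer_num n a b \<tau> f (i - 1)) / (1 - \<tau> ^ n * of_real (ratio n a b))"
    by (simp add: layer_inv_def diff_divide_distrib)
  also have "\<dots> = f i" using layer_num_eq[of a n b f i \<tau>] assms by simp
  finally show ?thesis .
qed

lemma layer_num_periodic:
  fixes f :: "int \<Rightarrow> 'a::real_normed_field"
  assumes "\<And>i. a (i + int n) = a i" "\<And>i. b (i + int n) = b i" "\<And>i. f (i + int n) = f i"
  shows "layer_num n a b \<tau> f (i + int n) = layer_num n a b \<tau> f i"
proof -
  have "a (i + int n - l) = a (i - l)" "b (i + int n - l) = b (i - l)" "f (i + int n - l) = f (i - l)" for l
    using assms[of "i - l"] by (simp_all add: algebra_simps)
  then show ?thesis by (simp add: layer_num_def)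
qed

lemma layer_inv_periodic:
  fixes f :: "int \<Rightarrow> 'a::real_normed_field"
  assumes "\<And>i. a (i + int n) = a i" "\<And>i. b (i + int n) = b i" "\<And>i. f (i + int n) = f i"
  shows "layer_inv n a b \<tau> f (i + int n) = layer_inv n a b \<tau> f i"
  using layer_num_periodic[of a n b f \<tau> i, OF assms] by (simp add: layer_inv_def)

lemma layer_kernel_iterate:
  fixes d :: "int \<Rightarrow> 'a::real_normed_field"
  assumes "\<And>i. 0 < b i" "\<And>i. of_real (b i) * d i = \<tau> * of_real (a i) * d (i - 1)"
  shows "d i = \<tau> ^ j * of_real (\<Prod>l<j. a (i - int l) / b (i - int l)) * d (i - int j)"
proof (induction j)
  case (Suc j)
  have "of_real (b (i - int j)) \<noteq> (0 :: 'a)" using assms(1)[of "i - int j"] by simp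
  then have "d (i - int j) = \<tau> * of_real (a (i - int j) / b (i - int j)) * d (i - int (Suc j))"
    using assms(2)[of "i - int j"] by (simp add: field_simps)
  then show ?case by (subst Suc) (simp add: mult_ac)
qed simp

text \<open>Over one period the difference of two solutions is multiplied by
  \<open>\<tau> ^ n * ratio n a b\<close>, which is not 1, and yet it returns to its value.\<close>

lemma layer_inv_unique:
  fixes f u :: "int \<Rightarrow> 'a::real_normed_field"
  assumes ab: "\<And>i. a (i + int n) = a i" "\<And>i. b (i + int n) = b i" "\<And>i. 0 < b i"
    and f: "\<And>i. f (i + int n) = f i" and u: "\<And>i. u (i + int n) = u i"
    and ns: "\<tau> ^ n * of_real (ratio n a b) \<noteq> 1"
    and eq: "\<And>i. of_real (b i) * u i - \<tau> * of_real (a i) * u (i - 1) = f i"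
  shows "u = layer_inv n a b \<tau> f"
proof
  fix i
  define d where "d = (\<lambda>i. u i - layer_inv n a b \<tau> f i)"
  have "of_real (b i) * d i = \<tau> * of_real (a i) * d (i - 1)" for i
    using eq[of i] layer_inv_eq[of a n b f \<tau> i, OF ab f ns] by (simp add: d_def algebra_simps)
  then have "d i = \<tau> ^ n * of_real (\<Prod>l<n. a (i - int l) / b (i - int l)) * d (i - int n)"
    by (intro layer_kernel_iterate ab(3))
  also have "d (i - int n) = d i"
    using u[of "i - int n"] layer_inv_periodic[of a n b f \<tau> "i - int n", OF ab(1,2) f] by (simp add: d_def)
  finally have "(1 - \<tau> ^ n * of_real (ratio n a b)) * d i = 0"
    using ratio_down[of a n b i] ab by (simp add: algebra_simps)
  then show "u i = layer_inv n a b \<tau> f i" using ns by (simp add: d_def)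
qed

text \<open>\<open>u\<close> is the twisted potential of the current column and \<open>f\<close> the
  right-hand side of the equation for its outgoing layer. Harmonicity at the next column, solved for
  the layer after it, yields the next right-hand side. The vertex weights \<open>C\<close> are
  separate data: after layer 0 is removed, the weight of column 1 still contains conductances of
  that layer.\<close>

fun transfer :: "nat \<Rightarrow> nat \<Rightarrow> (nat \<Rightarrow> int \<Rightarrow> real) \<Rightarrow> (nat \<Rightarrow> int \<Rightarrow> real) \<Rightarrow> (nat \<Rightarrow> int \<Rightarrow> real) \<Rightarrow>
    'a::real_normed_field \<Rightarrow> (int \<Rightarrow> 'a) \<Rightarrow> (int \<Rightarrow> 'a) \<Rightarrow> int \<Rightarrow> 'a" where
  "transfer n 0 a b C \<tau> u f = u"
| "transfer n (Suc m) a b C \<tau> u f =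
    transfer n m (\<lambda>k. a (Suc k)) (\<lambda>k. b (Suc k)) (\<lambda>k. C (Suc k)) \<tau> (layer_inv n (a 0) (b 0) \<tau> f)
      (\<lambda>i. of_real (C 1 i) * layer_inv n (a 0) (b 0) \<tau> f i - of_real (b 0 i) * u i + of_real (a 0 (i + 1)) * u (i + 1) / \<tau>)"

definition layers :: "nat \<Rightarrow> nat \<Rightarrow> (nat \<Rightarrow> int \<Rightarrow> real) \<Rightarrow> (nat \<Rightarrow> int \<Rightarrow> real) \<Rightarrow> (nat \<Rightarrow> int \<Rightarrow> real) \<Rightarrow> bool" where
  "layers n m a b C \<longleftrightarrow> (\<forall>k<m. \<forall>i. 0 < a k i \<and> 0 < b k i \<and> a k (i + int n) = a k i \<and> b k (i + int n) = b k i) \<and>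
     (\<forall>k\<le>m. \<forall>i. C k (i + int n) = C k i)"

lemma layers_Suc:
  assumes "layers n (Suc m) a b C"
  shows "layers n m (\<lambda>k. a (Suc k)) (\<lambda>k. b (Suc k)) (\<lambda>k. C (Suc k))"
  using assms by (auto simp: layers_def)

lemma layers_0:
  assumes "layers n (Suc m) a b C"
  shows "0 < a 0 i" "0 < b 0 i" "a 0 (i + int n) = a 0 i" "b 0 (i + int n) = b 0 i" "C 0 (i + int n) = C 0 i" "C 1 (i + int n) = C 1 i"
  using assms by (auto simp: layers_def)

lemma next_source_periodic:
  fixes u f :: "int \<Rightarrow> 'a::real_normed_field"
  assumes "layers n (Suc m) a b C" "\<And>i. u (i + int n) = u i" "\<And>i. v (i + int n) = v i"
  shows "of_real (C 1 (i + int n)) * v (i + int n) - of_real (b 0 (i + int n)) * u (i + int n) + of_real (a 0 (i + int n + 1)) * u (i + int n + 1) / \<tau> =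
    of_real (C 1 i) * v i - of_real (b 0 i) * u i + of_real (a 0 (i + 1)) * u (i + 1) / \<tau>"
  using layers_0[OF assms(1)] assms(2,3) layers_0(3)[OF assms(1), of "i + 1"] assms(2)[of "i + 1"]
  by (simp add: algebra_simps)

text \<open>The potentials of all columns at once. Harmonic functions arrive in this form, whereas
  \<open>transfer\<close> displays the rational dependence on \<open>\<tau>\<close>;
  \<open>transfer_unique\<close> and \<open>transfer_ex\<close> link the two.\<close>

definition transfer_chain :: "nat \<Rightarrow> nat \<Rightarrow> (nat \<Rightarrow> int \<Rightarrow> real) \<Rightarrow> (nat \<Rightarrow> int \<Rightarrow> real) \<Rightarrow> (nat \<Rightarrow> int \<Rightarrow> real) \<Rightarrow>
    'a::real_normed_field \<Rightarrow> (int \<Rightarrow> 'a) \<Rightarrow> (nat \<Rightarrow> int \<Rightarrow> 'a) \<Rightarrow> bool" where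
  "transfer_chain n m a b C \<tau> f U \<longleftrightarrow> (\<forall>k\<le>m. \<forall>i. U k (i + int n) = U k i) \<and>
    (0 < m \<longrightarrow> (\<forall>i. of_real (b 0 i) * U 1 i - \<tau> * of_real (a 0 i) * U 1 (i - 1) = f i)) \<and>
    (\<forall>k i. Suc k < m \<longrightarrow> of_real (b (Suc k) i) * U (Suc (Suc k)) i - \<tau> * of_real (a (Suc k) i) * U (Suc (Suc k)) (i - 1) =
       of_real (C (Suc k) i) * U (Suc k) i - of_real (b k i) * U k i + of_real (a k (i + 1)) * U k (i + 1) / \<tau>)"

definition nonsingular :: "nat \<Rightarrow> nat \<Rightarrow> (nat \<Rightarrow> int \<Rightarrow> real) \<Rightarrow> (nat \<Rightarrow> int \<Rightarrow> real) \<Rightarrow> 'a::real_normed_field \<Rightarrow> bool" where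
  "nonsingular n m a b \<tau> \<longleftrightarrow> \<tau> \<noteq> 0 \<and> (\<forall>k<m. \<tau> ^ n * of_real (ratio n (a k) (b k)) \<noteq> 1)"

lemma nonsingular_Suc:
  "nonsingular n (Suc m) a b \<tau> \<longleftrightarrow> \<tau> ^ n * of_real (ratio n (a 0) (b 0)) \<noteq> 1 \<and>
     nonsingular n m (\<lambda>k. a (Suc k)) (\<lambda>k. b (Suc k)) \<tau>"
  by (auto simp: nonsingular_def less_Suc_eq_0_disj)

lemma transfer_chain_Suc:
  assumes "transfer_chain n (Suc m) a b C \<tau> f U"
  shows "transfer_chain n m (\<lambda>k. a (Suc k)) (\<lambda>k. b (Suc k)) (\<lambda>k. C (Suc k)) \<tau>
    (\<lambda>i. of_real (C 1 i) * U 1 i - of_real (b 0 i) * U 0 i + of_real (a 0 (i + 1)) * U 0 (i + 1) / \<tau>) (\<lambda>k. U (Suc k))"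
  using assms by (auto simp: transfer_chain_def)

lemma transfer_unique:
  assumes "layers n m a b C" "\<forall>i. f (i + int n) = f i" "nonsingular n m a b \<tau>" "transfer_chain n m a b C \<tau> f U"
  shows "U m = transfer n m a b C \<tau> (U 0) f"
  using assms
proof (induction m arbitrary: a b C f U)
  case (Suc m)
  note L0 = layers_0[OF Suc.prems(1)]
  have per: "U k (i + int n) = U k i" if "k \<le> Suc m" for k i
    using Suc.prems(4) that by (simp add: transfer_chain_def)
  have v: "U 1 = layer_inv n (a 0) (b 0) \<tau> f"
  proof (rule layer_inv_unique)
    show "of_real (b 0 i) * U 1 i - \<tau> * of_real (a 0 i) * U 1 (i - 1) = f i" for i
      using Suc.prems(4) by (simp add: transfer_chain_def)
  qed (use Suc.prems L0 per[of 1] in \<open>auto simp: nonsingular_def\<close>)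
  define g where "g = (\<lambda>i. of_real (C 1 i) * U 1 i - of_real (b 0 i) * U 0 i + of_real (a 0 (i + 1)) * U 0 (i + 1) / \<tau>)"
  have "U (Suc m) = transfer n m (\<lambda>k. a (Suc k)) (\<lambda>k. b (Suc k)) (\<lambda>k. C (Suc k)) \<tau> (U (Suc 0)) g"
  proof (rule Suc.IH[OF layers_Suc[OF Suc.prems(1)]])
    show "\<forall>i. g (i + int n) = g i"
      unfolding g_def using per[of 0] per[of 1] by (intro allI next_source_periodic[OF Suc.prems(1)]) auto
    show "nonsingular n m (\<lambda>k. a (Suc k)) (\<lambda>k. b (Suc k)) \<tau>" using Suc.prems(3) by (simp add: nonsingular_Suc)
    show "transfer_chain n m (\<lambda>k. a (Suc k)) (\<lambda>k. b (Suc k)) (\<lambda>k. C (Suc k)) \<tau> g (\<lambda>k. U (Suc k))"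
      unfolding g_def by (rule transfer_chain_Suc[OF Suc.prems(4)])
  qed
  then show ?case using v by (simp add: g_def)
qed simp

lemma transfer_ex:
  assumes "layers n m a b C" "\<forall>i. u (i + int n) = u i" "\<forall>i. f (i + int n) = f i" "nonsingular n m a b \<tau>"
  shows "\<exists>U. U 0 = u \<and> U m = transfer n m a b C \<tau> u f \<and> transfer_chain n m a b C \<tau> f U"
  using assms
proof (induction m arbitrary: a b C u f)
  case 0
  then show ?case by (intro exI[of _ "\<lambda>_. u"]) (auto simp: transfer_chain_def)
next
  case (Suc m)
  note L0 = layers_0[OF Suc.prems(1)]
  define v where "v = layer_inv n (a 0) (b 0) \<tau> f"
  define g where "g = (\<lambda>i. of_real (C 1 i) * v i - of_real (b 0 i) * u i + of_real (a 0 (i + 1)) * u (i + 1) / \<tau>)"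
  have v: "v (i + int n) = v i" for i
    unfolding v_def using L0 Suc.prems by (intro layer_inv_periodic) auto
  have veq: "of_real (b 0 i) * v i - \<tau> * of_real (a 0 i) * v (i - 1) = f i" for i
    unfolding v_def using L0 Suc.prems by (intro layer_inv_eq) (auto simp: nonsingular_def)
  have g: "g (i + int n) = g i" for i
    unfolding g_def using Suc.prems(2) v by (intro next_source_periodic[OF Suc.prems(1)]) auto
  have "\<exists>U. U 0 = v \<and> U m = transfer n m (\<lambda>k. a (Suc k)) (\<lambda>k. b (Suc k)) (\<lambda>k. C (Suc k)) \<tau> v g \<and>
    transfer_chain n m (\<lambda>k. a (Suc k)) (\<lambda>k. b (Suc k)) (\<lambda>k. C (Suc k)) \<tau> g U"
    using Suc.prems(4) by (intro Suc.IH layers_Suc[OF Suc.prems(1)] allI v g) (simp add: nonsingular_Suc)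
  then obtain U where U: "U 0 = v" "U m = transfer n m (\<lambda>k. a (Suc k)) (\<lambda>k. b (Suc k)) (\<lambda>k. C (Suc k)) \<tau> v g"
    "transfer_chain n m (\<lambda>k. a (Suc k)) (\<lambda>k. b (Suc k)) (\<lambda>k. C (Suc k)) \<tau> g U" by blast
  show ?case
  proof (intro exI[of _ "case_nat u U"] conjI)
    show "case_nat u U (Suc m) = transfer n (Suc m) a b C \<tau> u f" using U(2) by (simp add: v_def g_def)
    show "transfer_chain n (Suc m) a b C \<tau> f (case_nat u U)"
      unfolding transfer_chain_def
    proof (intro conjI allI impI)
      show "case_nat u U k (i + int n) = case_nat u U k i" if "k \<le> Suc m" for k i
        using that U(3) Suc.prems(2) by (cases k) (auto simp: transfer_chain_def)
      show "of_real (b 0 i) * case_nat u U 1 i - \<tau> * of_real (a 0 i) * case_nat u U 1 (i - 1) = f i" for i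
        using veq U(1) by simp
      show "of_real (b (Suc k) i) * case_nat u U (Suc (Suc k)) i - \<tau> * of_real (a (Suc k) i) * case_nat u U (Suc (Suc k)) (i - 1) =
         of_real (C (Suc k) i) * case_nat u U (Suc k) i - of_real (b k i) * case_nat u U k i + of_real (a k (i + 1)) * case_nat u U k (i + 1) / \<tau>"
        if "Suc k < Suc m" for k i
      proof (cases k)
        case 0
        then show ?thesis using U(1,3) that by (simp add: g_def transfer_chain_def)
      next
        case (Suc l)
        then show ?thesis using U(3) that by (simp add: transfer_chain_def)
      qed
    qed
  qed simp
qed

lemma finite_singular:
  assumes "1 \<le> n"
  shows "finite {\<tau> :: 'a::real_normed_field. \<not> nonsingular n m a b \<tau>}"
proof -
  have "finite {\<tau> :: 'a. \<tau> ^ n * of_real c = 1}" for c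
  proof -
    define r :: "'a poly" where "r = 1 - monom (of_real c) n"
    have r: "poly r \<tau> = 1 - \<tau> ^ n * of_real c" for \<tau> by (simp add: r_def poly_monom)
    have "poly r 0 = 1" using r[of 0] assms by (simp add: zero_power)
    then have "r \<noteq> 0" by auto
    then have "finite {\<tau>. poly r \<tau> = 0}" by (rule poly_roots_finite)
    then show ?thesis by (rule finite_subset[rotated]) (auto simp: r)
  qed
  then have "finite ({0 :: 'a} \<union> (\<Union>k<m. {\<tau>. \<tau> ^ n * of_real (ratio n (a k) (b k)) = 1}))" by blast
  then show ?thesis by (rule finite_subset[rotated]) (auto simp: nonsingular_def)
qed

section \<open>Continuity and rationality of the transfer maps in the multiplier\<close>

lemma isCont_layer_num:
  fixes f :: "'a::real_normed_field \<Rightarrow> int \<Rightarrow> 'a"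
  assumes "\<And>i. isCont (\<lambda>\<tau>. f \<tau> i) \<tau>0" "\<And>i. 0 < b i"
  shows "isCont (\<lambda>\<tau>. layer_num n a b \<tau> (f \<tau>) i) \<tau>0"
proof -
  have "of_real (b i) \<noteq> (0 :: 'a)" for i using assms(2)[of i] by simp
  then show ?thesis unfolding layer_num_def using assms(1) by (intro continuous_intros) auto
qed

lemma isCont_layer_inv:
  fixes f :: "'a::real_normed_field \<Rightarrow> int \<Rightarrow> 'a"
  assumes "\<And>i. isCont (\<lambda>\<tau>. f \<tau> i) \<tau>0" "\<And>i. 0 < b i" "\<tau>0 ^ n * of_real (ratio n a b) \<noteq> 1"
  shows "isCont (\<lambda>\<tau>. layer_inv n a b \<tau> (f \<tau>) i) \<tau>0"
  unfolding layer_inv_def using assms isCont_layer_num[OF assms(1,2)]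
  by (intro continuous_intros) auto

text \<open>Continuity closes the finite gaps left by identities of rational functions, and it keeps
  the output finite near a \<open>\<tau>0\<close> at which no layer is singular.\<close>

lemma isCont_transfer:
  fixes u f :: "'a::real_normed_field \<Rightarrow> int \<Rightarrow> 'a"
  assumes "layers n m a b C" "\<And>i. isCont (\<lambda>\<tau>. u \<tau> i) \<tau>0" "\<And>i. isCont (\<lambda>\<tau>. f \<tau> i) \<tau>0" "nonsingular n m a b \<tau>0"
  shows "isCont (\<lambda>\<tau>. transfer n m a b C \<tau> (u \<tau>) (f \<tau>) i) \<tau>0"
  using assms
proof (induction m arbitrary: a b C u f)
  case (Suc m)
  note L0 = layers_0[OF Suc.prems(1)]
  have v: "isCont (\<lambda>\<tau>. layer_inv n (a 0) (b 0) \<tau> (f \<tau>) i) \<tau>0" for i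
    using L0 Suc.prems by (intro isCont_layer_inv) (auto simp: nonsingular_def)
  show ?case unfolding transfer.simps
    by (rule Suc.IH[OF layers_Suc[OF Suc.prems(1)]])
      (use v Suc.prems in \<open>auto simp: nonsingular_Suc nonsingular_def intro!: continuous_intros\<close>)
qed simp

lemma layer_num_of_real:
  "layer_num n a b (of_real \<tau>) (\<lambda>i. of_real (f i)) i = (of_real (layer_num n a b \<tau> f i) :: 'a::real_normed_field)"
  by (simp add: layer_num_def)

lemma layer_inv_of_real:
  "layer_inv n a b (of_real \<tau>) (\<lambda>i. of_real (f i)) i = (of_real (layer_inv n a b \<tau> f i) :: 'a::real_normed_field)"
  by (simp add: layer_inv_def layer_num_of_real)

lemma transfer_of_real:
  "transfer n m a b C (of_real \<tau>) (\<lambda>i. of_real (u i)) (\<lambda>i. of_real (f i)) i =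
    (of_real (transfer n m a b C \<tau> u f i) :: 'a::real_normed_field)"
proof (induction m arbitrary: a b C u f)
  case (Suc m)
  show ?case unfolding transfer.simps layer_inv_of_real
    by (subst Suc[symmetric]) (simp add: layer_inv_of_real)
qed simp

text \<open>Nothing is claimed at the zeros of the denominator, so conventional values of division
  by 0 do not matter; identities are then obtained off finite sets.\<close>

definition rational_fun :: "(complex \<Rightarrow> complex) \<Rightarrow> bool" where
  "rational_fun f \<longleftrightarrow> (\<exists>p q. q \<noteq> 0 \<and> (\<forall>z. poly q z \<noteq> 0 \<longrightarrow> f z = poly p z / poly q z))"

lemma rational_fun_const: "rational_fun (\<lambda>z. c)"
  unfolding rational_fun_def by (intro exI[of _ "[:c:]"] exI[of _ 1]) auto

lemma rational_fun_id: "rational_fun (\<lambda>z. z)"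
  unfolding rational_fun_def by (intro exI[of _ "[:0, 1:]"] exI[of _ 1]) auto

lemma rational_fun_add:
  assumes "rational_fun f" "rational_fun g"
  shows "rational_fun (\<lambda>z. f z + g z)"
proof -
  obtain p q p' q' where "q \<noteq> 0" "\<And>z. poly q z \<noteq> 0 \<Longrightarrow> f z = poly p z / poly q z"
    "q' \<noteq> 0" "\<And>z. poly q' z \<noteq> 0 \<Longrightarrow> g z = poly p' z / poly q' z"
    using assms unfolding rational_fun_def by blast
  then show ?thesis unfolding rational_fun_def
    by (intro exI[of _ "p * q' + p' * q"] exI[of _ "q * q'"]) (auto simp: field_simps)
qed

lemma rational_fun_mult:
  assumes "rational_fun f" "rational_fun g"
  shows "rational_fun (\<lambda>z. f z * g z)"
proof -
  obtain p q p' q' where "q \<noteq> 0" "\<And>z. poly q z \<noteq> 0 \<Longrightarrow> f z = poly p z / poly q z"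
    "q' \<noteq> 0" "\<And>z. poly q' z \<noteq> 0 \<Longrightarrow> g z = poly p' z / poly q' z"
    using assms unfolding rational_fun_def by blast
  then show ?thesis unfolding rational_fun_def
    by (intro exI[of _ "p * p'"] exI[of _ "q * q'"]) auto
qed

lemma rational_fun_divide_poly:
  assumes "rational_fun f" "r \<noteq> 0"
  shows "rational_fun (\<lambda>z. f z / poly r z)"
proof -
  obtain p q where "q \<noteq> 0" "\<And>z. poly q z \<noteq> 0 \<Longrightarrow> f z = poly p z / poly q z"
    using assms unfolding rational_fun_def by blast
  then show ?thesis using assms unfolding rational_fun_def
    by (intro exI[of _ p] exI[of _ "q * r"]) auto
qed

lemma rational_fun_power: "rational_fun f \<Longrightarrow> rational_fun (\<lambda>z. f z ^ j)"
  by (induction j) (auto intro: rational_fun_const rational_fun_mult)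

lemma rational_fun_sum: "(\<And>x. x \<in> A \<Longrightarrow> rational_fun (f x)) \<Longrightarrow> rational_fun (\<lambda>z. \<Sum>x\<in>A. f x z)"
  by (induction A rule: infinite_finite_induct) (auto intro: rational_fun_const rational_fun_add)

lemma rational_fun_diff:
  assumes "rational_fun f" "rational_fun g"
  shows "rational_fun (\<lambda>z. f z - g z)"
  using rational_fun_add[OF assms(1) rational_fun_mult[OF rational_fun_const[of "-1"] assms(2)]] by simp

lemma rational_fun_zero:
  assumes "rational_fun f" "infinite {z. f z = 0}"
  shows "finite {z. f z \<noteq> 0}"
proof -
  obtain p q where q: "q \<noteq> 0" "\<And>z. poly q z \<noteq> 0 \<Longrightarrow> f z = poly p z / poly q z"
    using assms unfolding rational_fun_def by blast
  have fin: "finite {z. poly q z = 0}" using q(1) by (rule poly_roots_finite)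
  have "p = 0"
  proof (rule ccontr)
    assume "p \<noteq> 0"
    then have "finite {z. poly p z = 0}" by (rule poly_roots_finite)
    moreover have "{z. f z = 0} \<subseteq> {z. poly p z = 0} \<union> {z. poly q z = 0}" using q(2) by auto
    ultimately show False using assms(2) fin finite_subset by blast
  qed
  then have "{z. f z \<noteq> 0} \<subseteq> {z. poly q z = 0}" using q(2) by auto
  then show ?thesis using fin finite_subset by blast
qed

lemma rational_fun_layer_inv:
  assumes "\<And>i. rational_fun (\<lambda>\<tau>. f \<tau> i)" "1 \<le> n"
  shows "rational_fun (\<lambda>\<tau>. layer_inv n a b \<tau> (f \<tau>) i)"
proof -
  define r :: "complex poly" where "r = 1 - monom (of_real (ratio n a b)) n"
  have r: "poly r \<tau> = 1 - \<tau> ^ n * of_real (ratio n a b)" for \<tau> :: complex by (simp add: r_def poly_monom)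
  have "poly r 0 = 1" using r[of 0] assms(2) by (simp add: zero_power)
  then have "r \<noteq> 0" by auto
  have "rational_fun (\<lambda>\<tau>. layer_num n a b \<tau> (f \<tau>) i)"
    unfolding layer_num_def divide_inverse of_real_inverse[symmetric]
    by (intro rational_fun_sum rational_fun_mult rational_fun_power rational_fun_id rational_fun_const assms)
  from rational_fun_divide_poly[OF this \<open>r \<noteq> 0\<close>] show ?thesis by (simp add: layer_inv_def r)
qed

lemma rational_fun_transfer:
  assumes "\<And>i. rational_fun (\<lambda>\<tau>. u \<tau> i)" "\<And>i. rational_fun (\<lambda>\<tau>. f \<tau> i)" "1 \<le> n"
  shows "rational_fun (\<lambda>\<tau>. transfer n m a b C \<tau> (u \<tau>) (f \<tau>) i)"
  using assms
proof (induction m arbitrary: a b C u f)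
  case (Suc m)
  have v: "rational_fun (\<lambda>\<tau>. layer_inv n (a 0) (b 0) \<tau> (f \<tau>) i)" for i
    using Suc.prems by (intro rational_fun_layer_inv) auto
  have d: "rational_fun (\<lambda>\<tau>. g \<tau> / \<tau>)" if "rational_fun g" for g
    using rational_fun_divide_poly[OF that, of "[:0, 1:]"] by simp
  show ?case unfolding transfer.simps
    by (rule Suc.IH) (intro v rational_fun_add rational_fun_diff rational_fun_mult rational_fun_const d Suc.prems)+
qed simp

section \<open>The response determines the transfer maps\<close>

definition total_weight :: "nat \<Rightarrow> (nat \<Rightarrow> int \<Rightarrow> real) \<Rightarrow> (nat \<Rightarrow> int \<Rightarrow> real) \<Rightarrow> nat \<Rightarrow> int \<Rightarrow> real" where
  "total_weight m a b k i = (if k < m then a k i + b k i else 0) + (if 0 < k then b (k - 1) i + a (k - 1) (i + 1) else 0)"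

lemma (in strip) layers_total_weight: "layers n m a b (total_weight m a b)"
proof -
  have "a (k - 1) (i + int n + 1) = a (k - 1) (i + 1)" if "0 < k" "k \<le> m" for k i
    using a_per[of "k - 1" "i + 1"] that by (simp add: algebra_simps)
  then show ?thesis using a_pos b_pos a_per b_per by (auto simp: layers_def total_weight_def)
qed

text \<open>With the twist by the powers of \<open>- 1 / \<tau>\<close> the inverse of a layer has nonnegative coefficients
  for small \<open>\<tau> > 0\<close>.\<close>

lemma out_current_twist:
  fixes \<tau> :: complex
  assumes "\<tau> \<noteq> 0"
  shows "out_current m a b (\<lambda>k i. (- 1 / \<tau>) powi i * u k i) k i = (- 1 / \<tau>) powi i *
    (of_real (total_weight m a b k i) * u k i -
      (if k < m then of_real (b k i) * u (Suc k) i - \<tau> * of_real (a k i) * u (Suc k) (i - 1) else 0) -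
      (if 0 < k then of_real (b (k - 1) i) * u (k - 1) i - of_real (a (k - 1) (i + 1)) * u (k - 1) (i + 1) / \<tau> else 0))"
proof -
  define s where "s = - 1 / \<tau>"
  have s: "s \<noteq> 0" using assms by (simp add: s_def)
  have "s powi (i - 1) = s powi i * (- \<tau>)" using s assms by (simp add: power_int_diff) (simp add: s_def)
  moreover have "s powi (i + 1) = - (s powi i) / \<tau>" using s by (simp add: power_int_add) (simp add: s_def)
  ultimately show ?thesis unfolding s_def[symmetric]
    using assms by (simp add: out_current_def total_weight_def scaleR_conv_of_real algebra_simps)
qed

lemma periodic_bounded:
  fixes u :: "nat \<Rightarrow> int \<Rightarrow> 'v::real_normed_vector"
  assumes "1 \<le> n" "\<And>k i. k \<le> m \<Longrightarrow> u k (i + int n) = u k i"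
  shows "\<exists>M. \<forall>k i. k \<le> m \<longrightarrow> norm (u k i) \<le> M"
proof -
  define M where "M = (\<Sum>(k, i)\<in>{..m} \<times> {0..<int n}. norm (u k i))"
  have "norm (u k i) \<le> M" if k: "k \<le> m" for k i
  proof -
    have "norm (u k (i mod int n)) \<le> M"
      unfolding M_def using member_le_sum[of "(k, i mod int n)" "{..m} \<times> {0..<int n}" "\<lambda>(k, i). norm (u k i)"] k assms(1)
      by auto
    then show ?thesis using periodic_mod[of "u k" "int n" i] assms(2)[OF k] by simp
  qed
  then show ?thesis by blast
qed

lemma infinite_unit_circle: "infinite {z :: complex. norm z = 1}"
proof
  assume fin: "finite {z :: complex. norm z = 1}"
  define N where "N = Suc (card {z :: complex. norm z = 1})"
  have "norm z = 1" if "z ^ N = 1" for z :: complex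
  proof -
    have "norm z ^ N = 1" using that by (metis norm_one norm_power)
    then show ?thesis using power_eq_imp_eq_base[of "norm z" N 1] by (simp add: N_def)
  qed
  then have "{z :: complex. z ^ N = 1} \<subseteq> {z. norm z = 1}" by blast
  then have "card {z :: complex. z ^ N = 1} \<le> card {z :: complex. norm z = 1}" using fin by (rule card_mono[rotated])
  moreover have "card {z :: complex. z ^ N = 1} = N" by (rule card_roots_unity_eq) (simp add: N_def)
  ultimately show False by (simp add: N_def)
qed

abbreviation vertex_weight :: "nat \<Rightarrow> nat \<Rightarrow> (edge \<Rightarrow> real) \<Rightarrow> nat \<Rightarrow> int \<Rightarrow> real" where
  "vertex_weight n m w \<equiv> total_weight m (diagonal n w) (straight n w)"

context
  fixes n m :: nat and w w' :: "edge \<Rightarrow> real"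
  assumes n: "1 \<le> n" and m: "1 \<le> m" and w: "w \<in> conductances n m" "w' \<in> conductances n m"
    and same: "same_response n m w w'"
begin

interpretation w: strip n m "diagonal n w" "straight n w" using strip_conductances[OF w(1) n m] .
interpretation w': strip n m "diagonal n w'" "straight n w'" using strip_conductances[OF w(2) n m] .

text \<open>A periodic potential twisted by powers of a number of norm 1 is bounded, so
  \<open>same_response_harmonic\<close> applies. \<open>J\<close> is the twisted current leaving
  column 0: potential and current there are Cauchy data, and the transfer map computes the potential
  of the last column from them.\<close>

lemma transfer_eq_on_circle:
  fixes u J :: "int \<Rightarrow> complex"
  assumes \<tau>: "norm \<tau> = 1" and ns: "nonsingular n m (diagonal n w) (straight n w) \<tau>" "nonsingular n m (diagonal n w') (straight n w') \<tau>"
    and u: "\<forall>i. u (i + int n) = u i" and J: "\<forall>i. J (i + int n) = J i"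
  shows "transfer n m (diagonal n w) (straight n w) (vertex_weight n m w) \<tau> u (\<lambda>i. of_real (vertex_weight n m w 0 i) * u i - J i) =
    transfer n m (diagonal n w') (straight n w') (vertex_weight n m w') \<tau> u (\<lambda>i. of_real (vertex_weight n m w' 0 i) * u i - J i)"
proof -
  have \<tau>0: "\<tau> \<noteq> 0" using \<tau> by auto
  define s where "s = - 1 / \<tau>"
  have s: "norm s = 1" "s \<noteq> 0" using \<tau> \<tau>0 by (simp_all add: s_def norm_divide)
  have ns1: "norm (s powi i) = 1" for i using s by (simp add: norm_power_int)
  define f where "f = (\<lambda>i. of_real (vertex_weight n m w 0 i) * u i - J i)"
  define f' where "f' = (\<lambda>i. of_real (vertex_weight n m w' 0 i) * u i - J i)"
  have L: "layers n m (diagonal n w) (straight n w) (vertex_weight n m w)" "layers n m (diagonal n w') (straight n w') (vertex_weight n m w')"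
    by (rule w.layers_total_weight w'.layers_total_weight)+
  have f: "\<forall>i. f (i + int n) = f i" "\<forall>i. f' (i + int n) = f' i"
    using L u J by (auto simp: f_def f'_def layers_def)
  obtain u1 where u1: "u1 0 = u" "u1 m = transfer n m (diagonal n w) (straight n w) (vertex_weight n m w) \<tau> u f"
    "transfer_chain n m (diagonal n w) (straight n w) (vertex_weight n m w) \<tau> f u1"
    using transfer_ex[OF L(1) u f(1) ns(1)] by blast
  define U where "U = (\<lambda>k i. s powi i * u1 k i)"
  have cur: "w.current U k i = s powi i *
    (of_real (vertex_weight n m w k i) * u1 k i -
      (if k < m then of_real (straight n w k i) * u1 (Suc k) i - \<tau> * of_real (diagonal n w k i) * u1 (Suc k) (i - 1) else 0) -
      (if 0 < k then of_real (straight n w (k - 1) i) * u1 (k - 1) i - of_real (diagonal n w (k - 1) (i + 1)) * u1 (k - 1) (i + 1) / \<tau> else 0))" for k i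
    unfolding U_def s_def by (rule out_current_twist[OF \<tau>0])
  have hU: "w.harmonic U"
    unfolding w.harmonic_def
  proof (intro allI impI)
    fix k i assume k: "0 < k" "k < m"
    then obtain l where l: "k = Suc l" by (cases k) auto
    show "w.current U k i = 0"
      using u1(3) k l by (simp add: cur transfer_chain_def)
  qed
  have cur0: "w.current U 0 i = s powi i * J i" for i
    using u1(1,3) m by (simp add: cur transfer_chain_def f_def)
  have per1: "u1 k (i + int n) = u1 k i" if "k \<le> m" for k i using u1(3) that by (simp add: transfer_chain_def)
  obtain M where M: "\<And>k i. k \<le> m \<Longrightarrow> norm (u1 k i) \<le> M" using periodic_bounded[of n m u1, OF n per1] by blast
  have "norm (U k i) \<le> M" if "k \<le> m" for k i using M[OF that] ns1 by (simp add: U_def norm_mult)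
  from same_response_harmonic[OF w n m same hU this]
  obtain U' M' where U': "w'.harmonic U'" "\<And>k i. k \<le> m \<Longrightarrow> norm (U' k i) \<le> M'"
    "\<And>k i. k \<in> {0, m} \<Longrightarrow> U' k i = U k i" "\<And>k i. k \<in> {0, m} \<Longrightarrow> w'.current U' k i = w.current U k i" by blast
  \<comment> \<open>\<open>U'\<close> comes from an existence statement that says nothing about
    periodicity. Translating it by a period and multiplying it by \<open>s powi int n\<close> give
    bounded harmonic functions with equal boundary values, so they coincide.\<close>
  have shift: "U' k (i + int n) = s powi int n * U' k i" if k: "k \<le> m" for k i
  proof (rule w'.harmonic_unique[where u = "\<lambda>k i. U' k (i + int n)" and v = "\<lambda>k i. s powi int n * U' k i"])
    have c1: "w'.current (\<lambda>k i. U' k (i + int n)) k i = w'.current U' k (i + int n)" for k i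
    proof -
      have e: "i + int n - 1 = i - 1 + int n" "i + int n + 1 = i + 1 + int n" by simp_all
      show ?thesis unfolding out_current_def e by (simp only: straight_periodic diagonal_periodic)
    qed
    show "w'.harmonic (\<lambda>k i. U' k (i + int n))" using U'(1) by (simp add: w'.harmonic_def c1)
    have c2: "w'.current (\<lambda>k i. s powi int n * U' k i) k i = s powi int n * w'.current U' k i" for k i
      by (simp add: out_current_def algebra_simps)
    show "w'.harmonic (\<lambda>k i. s powi int n * U' k i)" using U'(1) by (simp only: w'.harmonic_def c2) auto
    show "norm (U' k (i + int n)) \<le> M'" if "k \<le> m" for k i using U'(2)[OF that] .
    show "norm (s powi int n * U' k i) \<le> M'" if "k \<le> m" for k i
      unfolding norm_mult ns1 using U'(2)[OF that] by simp
    show "U' k (i + int n) = s powi int n * U' k i" if "k \<in> {0, m}" for k i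
      using U'(3)[OF that] per1[of k i] that s by (auto simp: U_def power_int_add)
  qed fact
  define V where "V = (\<lambda>k i. U' k i / s powi i)"
  have UV: "U' = (\<lambda>k i. s powi i * V k i)" using s by (simp add: V_def fun_eq_iff)
  have cur': "w'.current U' k i = s powi i *
    (of_real (vertex_weight n m w' k i) * V k i -
      (if k < m then of_real (straight n w' k i) * V (Suc k) i - \<tau> * of_real (diagonal n w' k i) * V (Suc k) (i - 1) else 0) -
      (if 0 < k then of_real (straight n w' (k - 1) i) * V (k - 1) i - of_real (diagonal n w' (k - 1) (i + 1)) * V (k - 1) (i + 1) / \<tau> else 0))" for k i
    unfolding UV s_def by (rule out_current_twist[OF \<tau>0])
  have V0: "V 0 = u" and Vm: "V m = u1 m" using U'(3) u1(1) s by (auto simp: V_def U_def fun_eq_iff)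
  have "transfer_chain n m (diagonal n w') (straight n w') (vertex_weight n m w') \<tau> f' V"
    unfolding transfer_chain_def
  proof (intro conjI allI impI)
    show "V k (i + int n) = V k i" if "k \<le> m" for k i
      using shift[OF that, of i] s by (simp add: V_def power_int_add field_simps)
    show "of_real (straight n w' 0 i) * V 1 i - \<tau> * of_real (diagonal n w' 0 i) * V 1 (i - 1) = f' i" for i
    proof -
      have "w'.current U' 0 i = s powi i * J i" using U'(4)[of 0 i] cur0 by simp
      then have "s powi i * (of_real (vertex_weight n m w' 0 i) * V 0 i -
          (of_real (straight n w' 0 i) * V 1 i - \<tau> * of_real (diagonal n w' 0 i) * V 1 (i - 1))) = s powi i * J i"
        using cur'[of 0 i] m by simp
      then have "of_real (vertex_weight n m w' 0 i) * V 0 i -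
          (of_real (straight n w' 0 i) * V 1 i - \<tau> * of_real (diagonal n w' 0 i) * V 1 (i - 1)) = J i"
        using s by (simp only: mult_cancel_left) auto
      then show ?thesis by (simp add: f'_def V0 algebra_simps)
    qed
    show "of_real (straight n w' (Suc k) i) * V (Suc (Suc k)) i - \<tau> * of_real (diagonal n w' (Suc k) i) * V (Suc (Suc k)) (i - 1) =
       of_real (vertex_weight n m w' (Suc k) i) * V (Suc k) i - of_real (straight n w' k i) * V k i + of_real (diagonal n w' k (i + 1)) * V k (i + 1) / \<tau>"
      if "Suc k < m" for k i
    proof -
      have "s powi i * (of_real (vertex_weight n m w' (Suc k) i) * V (Suc k) i -
          (of_real (straight n w' (Suc k) i) * V (Suc (Suc k)) i - \<tau> * of_real (diagonal n w' (Suc k) i) * V (Suc (Suc k)) (i - 1)) -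
          (of_real (straight n w' k i) * V k i - of_real (diagonal n w' k (i + 1)) * V k (i + 1) / \<tau>)) = 0"
        using U'(1) cur'[of "Suc k" i] that by (simp add: w'.harmonic_def)
      moreover have "s powi i \<noteq> 0" using s by simp
      ultimately show ?thesis by (simp only: mult_eq_0_iff) (simp add: algebra_simps)
    qed
  qed
  from transfer_unique[OF L(2) f(2) ns(2) this] show ?thesis
    using V0 Vm u1(2) by (simp add: f_def f'_def)
qed

text \<open>The difference is rational in \<open>\<tau>\<close> and vanishes at infinitely many
  points of the unit circle, hence off a finite set; continuity at the nonsingular
  \<open>\<tau>\<close> covers that point as well.\<close>

lemma transfer_eq:
  fixes u J :: "int \<Rightarrow> complex"
  assumes ns: "nonsingular n m (diagonal n w) (straight n w) \<tau>" "nonsingular n m (diagonal n w') (straight n w') \<tau>"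
    and u: "\<forall>i. u (i + int n) = u i" and J: "\<forall>i. J (i + int n) = J i"
  shows "transfer n m (diagonal n w) (straight n w) (vertex_weight n m w) \<tau> u (\<lambda>i. of_real (vertex_weight n m w 0 i) * u i - J i) i =
    transfer n m (diagonal n w') (straight n w') (vertex_weight n m w') \<tau> u (\<lambda>i. of_real (vertex_weight n m w' 0 i) * u i - J i) i"
proof -
  define F where "F = (\<lambda>\<tau>. transfer n m (diagonal n w) (straight n w) (vertex_weight n m w) \<tau> u (\<lambda>i. of_real (vertex_weight n m w 0 i) * u i - J i) i -
    transfer n m (diagonal n w') (straight n w') (vertex_weight n m w') \<tau> u (\<lambda>i. of_real (vertex_weight n m w' 0 i) * u i - J i) i)"
  have L: "layers n m (diagonal n w) (straight n w) (vertex_weight n m w)" "layers n m (diagonal n w') (straight n w') (vertex_weight n m w')"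
    by (rule w.layers_total_weight w'.layers_total_weight)+
  have rat: "rational_fun F" unfolding F_def
    by (intro rational_fun_diff rational_fun_transfer rational_fun_const n)
  define X where "X = {\<tau>. \<not> nonsingular n m (diagonal n w) (straight n w) \<tau>} \<union> {\<tau> :: complex. \<not> nonsingular n m (diagonal n w') (straight n w') \<tau>}"
  have "finite X" unfolding X_def by (intro finite_UnI finite_singular n)
  then have "infinite ({z. norm z = 1} - X)" using infinite_unit_circle by simp
  moreover have "{z. norm z = 1} - X \<subseteq> {z. F z = 0}"
    using transfer_eq_on_circle[OF _ _ _ u J] by (auto simp: F_def X_def)
  ultimately have "infinite {z. F z = 0}" using finite_subset by blast
  then have "finite {z. F z \<noteq> 0}" by (rule rational_fun_zero[OF rat])
  then have "\<forall>\<^sub>F z in at \<tau>. F z = 0"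
    by (auto simp: eventually_at_topological intro!: exI[of _ "- ({z. F z \<noteq> 0} - {\<tau>})"] finite_imp_closed)
  then have "(F \<longlongrightarrow> 0) (at \<tau>)" by (rule tendsto_eventually)
  moreover have "isCont F \<tau>"
    unfolding F_def by (intro continuous_intros isCont_transfer[OF L(1)] isCont_transfer[OF L(2)] ns)
  then have "(F \<longlongrightarrow> F \<tau>) (at \<tau>)" by (simp add: isCont_def)
  ultimately have "F \<tau> = 0" using LIM_unique by blast
  then show ?thesis by (simp add: F_def)
qed

text \<open>The positivity arguments below take place on the positive real axis.\<close>

lemma transfer_eq_real:
  fixes u J :: "int \<Rightarrow> real"
  assumes ns: "nonsingular n m (diagonal n w) (straight n w) \<tau>" "nonsingular n m (diagonal n w') (straight n w') \<tau>"
    and u: "\<forall>i. u (i + int n) = u i" and J: "\<forall>i. J (i + int n) = J i"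
  shows "transfer n m (diagonal n w) (straight n w) (vertex_weight n m w) \<tau> u (\<lambda>i. vertex_weight n m w 0 i * u i - J i) i =
    transfer n m (diagonal n w') (straight n w') (vertex_weight n m w') \<tau> u (\<lambda>i. vertex_weight n m w' 0 i * u i - J i) i"
proof -
  have "nonsingular n m a b (complex_of_real \<tau>) \<longleftrightarrow> nonsingular n m a b \<tau>" for a b
    by (simp add: nonsingular_def flip: of_real_power of_real_mult)
  then have "transfer n m (diagonal n w) (straight n w) (vertex_weight n m w) (complex_of_real \<tau>) (\<lambda>i. of_real (u i)) (\<lambda>i. of_real (vertex_weight n m w 0 i) * of_real (u i) - of_real (J i)) i =
    transfer n m (diagonal n w') (straight n w') (vertex_weight n m w') (of_real \<tau>) (\<lambda>i. of_real (u i)) (\<lambda>i. of_real (vertex_weight n m w' 0 i) * of_real (u i) - of_real (J i)) i"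
    using ns u J by (intro transfer_eq) auto
  then show ?thesis
    by (simp only: transfer_of_real of_real_eq_iff flip: of_real_mult of_real_diff)
qed

end

section \<open>Recovering the network with decreasing ratios\<close>

lemma layer_num_ge:
  fixes f :: "int \<Rightarrow> real"
  assumes "\<And>i. 0 < a i" "\<And>i. 0 < b i" "0 < \<tau>" "\<And>i. 0 \<le> f i" "1 \<le> n"
  shows "f i / b i \<le> layer_num n a b \<tau> f i"
proof -
  define t where "t = (\<lambda>j. \<tau> ^ j * (\<Prod>l<j. a (i - int l) / b (i - int l)) * (f (i - int j) / b (i - int j)))"
  have "0 \<le> t j" for j
    unfolding t_def using assms less_imp_le by (intro mult_nonneg_nonneg prod_nonneg divide_nonneg_nonneg zero_le_power) blast+
  then have "sum t {0} \<le> sum t {..<n}" using assms(5) by (intro sum_mono2) auto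
  then show ?thesis by (simp add: t_def layer_num_def)
qed

text \<open>Below the singular value the denominator lies between 0 and 1, so dividing by it can
  only enlarge the nonnegative numerator.\<close>

lemma layer_inv_ge:
  fixes f :: "int \<Rightarrow> real"
  assumes pos: "\<And>i. 0 < a i" "\<And>i. 0 < b i" "0 < \<tau>" and f: "\<And>i. 0 \<le> f i" and n: "1 \<le> n" and ns: "\<tau> ^ n * ratio n a b < 1"
  shows "f i / b i \<le> layer_inv n a b \<tau> f i"
proof -
  have 1: "0 < 1 - \<tau> ^ n * ratio n a b" "1 - \<tau> ^ n * ratio n a b \<le> 1"
    using ns pos(3) ratio_pos[of a b n, OF pos(1,2)] by simp_all
  have "0 \<le> f i / b i" using f[of i] pos(2)[of i] by simp
  moreover have 2: "f i / b i \<le> layer_num n a b \<tau> f i" by (rule layer_num_ge[OF pos f n])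
  ultimately have "layer_num n a b \<tau> f i * (1 - \<tau> ^ n * ratio n a b) \<le> layer_num n a b \<tau> f i"
    using 1 by (intro mult_left_le) auto
  then have "layer_num n a b \<tau> f i \<le> layer_inv n a b \<tau> f i"
    using 1(1) by (simp add: layer_inv_def pos_le_divide_eq)
  then show ?thesis using 2 by simp
qed

text \<open>The actual vertex weight has the further summand \<open>a k (i + 1)\<close>. The
  inequality compensates the negative term of the next source in \<open>transfer_ge\<close>, and it
  is inherited when layers are removed.\<close>

definition dominant :: "nat \<Rightarrow> (nat \<Rightarrow> int \<Rightarrow> real) \<Rightarrow> (nat \<Rightarrow> int \<Rightarrow> real) \<Rightarrow> (nat \<Rightarrow> int \<Rightarrow> real) \<Rightarrow> bool" where
  "dominant m a b C \<longleftrightarrow> (\<forall>k i. Suc k < m \<longrightarrow> a (Suc k) i + b (Suc k) i + b k i \<le> C (Suc k) i)"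

lemma dominant_Suc:
  "dominant (Suc m) a b C \<Longrightarrow> dominant m (\<lambda>k. a (Suc k)) (\<lambda>k. b (Suc k)) (\<lambda>k. C (Suc k))"
  by (simp add: dominant_def)

text \<open>A growth principle: if the source of a layer is at least \<open>(a + b) * u\<close>, the
  next potential is at least \<open>u\<close>. By \<open>dominant\<close> the next source has the
  same property, the term with \<open>1 / \<tau>\<close> being nonnegative. All layers are below
  their singular values, so their inverses preserve nonnegativity.\<close>

lemma transfer_ge:
  fixes u f :: "int \<Rightarrow> real"
  assumes "layers n m a b C" "dominant m a b C" "1 \<le> n" "0 < \<tau>"
    and "\<forall>k<m. \<tau> ^ n * ratio n (a k) (b k) < 1"
    and "\<forall>i. 0 \<le> u i" "0 < m \<longrightarrow> (\<forall>i. (a 0 i + b 0 i) * u i \<le> f i)"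
  shows "u i \<le> transfer n m a b C \<tau> u f i"
  using assms
proof (induction m arbitrary: a b C u f)
  case (Suc m)
  note L0 = layers_0[OF Suc.prems(1)]
  define v where "v = layer_inv n (a 0) (b 0) \<tau> f"
  define g where "g = (\<lambda>i. C 1 i * v i - b 0 i * u i + a 0 (i + 1) * u (i + 1) / \<tau>)"
  have f: "(a 0 i + b 0 i) * u i \<le> f i" "0 \<le> u i" for i using Suc.prems by auto
  have f0: "0 \<le> f i" for i using f[of i] L0(1,2)[of i] mult_nonneg_nonneg[of "a 0 i + b 0 i" "u i"] by linarith
  have vu: "u i \<le> v i" for i
  proof -
    have "f i / b 0 i \<le> v i" unfolding v_def using Suc.prems L0 f0 by (intro layer_inv_ge) auto
    moreover have "u i * b 0 i \<le> (a 0 i + b 0 i) * u i" using f(2)[of i] L0(1)[of i] by (simp add: algebra_simps)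
    then have "u i \<le> f i / b 0 i" using f(1)[of i] L0(2)[of i] by (simp add: pos_le_divide_eq)
    ultimately show ?thesis by linarith
  qed
  have v0: "0 \<le> v i" for i using vu[of i] f(2)[of i] by linarith
  have "v i \<le> transfer n m (\<lambda>k. a (Suc k)) (\<lambda>k. b (Suc k)) (\<lambda>k. C (Suc k)) \<tau> v g i"
  proof (rule Suc.IH[OF layers_Suc[OF Suc.prems(1)] dominant_Suc[OF Suc.prems(2)] Suc.prems(3,4)])
    show "0 < m \<longrightarrow> (\<forall>i. (a (Suc 0) i + b (Suc 0) i) * v i \<le> g i)"
    proof (intro impI allI)
      fix i assume "0 < m"
      then have "(a (Suc 0) i + b (Suc 0) i + b 0 i) * v i \<le> C (Suc 0) i * v i"
        using Suc.prems(2) v0 by (intro mult_right_mono) (auto simp: dominant_def)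
      moreover have "b 0 i * u i \<le> b 0 i * v i" using vu L0(2)[of i] by simp
      moreover have "0 \<le> a 0 (i + 1) * u (i + 1) / \<tau>" using f(2)[of "i+1"] L0(1)[of "i+1"] Suc.prems(4) by simp
      ultimately show "(a (Suc 0) i + b (Suc 0) i) * v i \<le> g i" by (simp add: g_def algebra_simps)
    qed
  qed (use Suc.prems(5) v0 in auto)
  then show ?case using vu[of i] by (simp add: v_def g_def)
qed simp

lemma layer_num_uminus: "layer_num n a b \<tau> (\<lambda>i. - f i) i = - layer_num n a b \<tau> f i"
  by (simp add: layer_num_def sum_negf)

lemma transfer_uminus:
  "transfer n m a b C \<tau> (\<lambda>i. - u i) (\<lambda>i. - f i) i = - transfer n m a b C \<tau> u f i"
proof (induction m arbitrary: a b C u f)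
  case (Suc m)
  have "layer_inv n (a 0) (b 0) \<tau> (\<lambda>i. - f i) = (\<lambda>i. - layer_inv n (a 0) (b 0) \<tau> f i)"
    by (simp add: layer_inv_def layer_num_uminus fun_eq_iff)
  then show ?case unfolding transfer.simps by (subst Suc[symmetric]) (simp add: algebra_simps)
qed simp

text \<open>At the singular value \<open>layer_num\<close> solves the homogeneous recurrence, whose
  coefficients are positive, so a positive value propagates around the whole period.\<close>

lemma layer_num_singular_pos:
  fixes f :: "int \<Rightarrow> real"
  assumes a: "\<And>i. a (i + int n) = a i" and b: "\<And>i. b (i + int n) = b i" and pos: "\<And>i. 0 < a i" "\<And>i. 0 < b i" "0 < \<tau>"
    and f: "\<And>i. f (i + int n) = f i" and n: "1 \<le> n"
    and sing: "\<tau> ^ n * ratio n a b = 1" and N: "0 < layer_num n a b \<tau> f i"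
  shows "0 < layer_num n a b \<tau> f k"
proof -
  define d where "d = layer_num n a b \<tau> f"
  have eq: "of_real (b i) * d i = \<tau> * of_real (a i) * d (i - 1)" for i
    using layer_num_eq[of a n b f i \<tau>, OF a b pos(2) f] sing by (simp add: d_def)
  define j where "j = nat ((k - i) mod int n)"
  have "d k = \<tau> ^ j * of_real (\<Prod>l<j. a (k - int l) / b (k - int l)) * d (k - int j)"
    by (rule layer_kernel_iterate[of b d \<tau> a k j, OF pos(2) eq])
  also have "d (k - int j) = d i"
  proof -
    have "int j = (k - i) mod int n" using n by (simp add: j_def)
    then have "k - int j = i + ((k - i) div int n) * int n"
      using div_mult_mod_eq[of "k - i" "int n"] by linarith
    then show ?thesis using periodic_mult[of d "int n" i] layer_num_periodic[of a n b f \<tau>, OF a b f] by (simp add: d_def)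
  qed
  finally have "d k = (\<tau> ^ j * (\<Prod>l<j. a (k - int l) / b (k - int l))) * d i" by simp
  moreover have "0 < \<tau> ^ j * (\<Prod>l<j. a (k - int l) / b (k - int l))"
    using pos by (intro mult_pos_pos prod_pos divide_pos_pos zero_less_power) auto
  ultimately show ?thesis using N by (simp add: d_def)
qed

text \<open>As \<open>\<tau>\<close> increases to the first singular value, which for decreasing ratios belongs to
  layer \<open>0\<close>, the output diverges with the sign of the residue functional of that layer.\<close>

lemma transfer_blowup:
  fixes u f :: "int \<Rightarrow> real"
  assumes L: "layers n (Suc m) a b C" and D: "dominant (Suc m) a b C" and n: "1 \<le> n"
    and sorted: "\<And>k. k < Suc m \<Longrightarrow> ratio n (a k) (b k) \<le> ratio n (a 0) (b 0)"
    and \<tau>0: "0 < \<tau>0" "\<tau>0 ^ n * ratio n (a 0) (b 0) = 1"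
    and u: "\<And>i. u (i + int n) = u i" and f: "\<And>i. f (i + int n) = f i"
    and N: "0 < layer_num n (a 0) (b 0) \<tau>0 f i0"
  shows "filterlim (\<lambda>\<tau>. transfer n (Suc m) a b C \<tau> u f i) at_top (at_left \<tau>0)"
proof -
  note L0 = layers_0[OF L]
  define v where "v = (\<lambda>\<tau>. layer_inv n (a 0) (b 0) \<tau> f)"
  have r: "0 < ratio n (a 0) (b 0)" using L0 by (intro ratio_pos)
  have near: "\<forall>\<^sub>F \<tau> in at_left \<tau>0. \<tau>0 / 2 < \<tau> \<and> \<tau> < \<tau>0"
    using \<tau>0 eventually_at_left_real[of "\<tau>0 / 2" \<tau>0] by (auto elim: eventually_mono)
  have sub: "\<tau> ^ n * ratio n (a 0) (b 0) < 1" if "\<tau>0 / 2 < \<tau>" "\<tau> < \<tau>0" for \<tau>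
  proof -
    have "\<tau> ^ n < \<tau>0 ^ n" using that n \<tau>0 by (intro power_strict_mono) auto
    from mult_strict_right_mono[OF this r] show ?thesis using \<tau>0(2) by simp
  qed
  have vtop: "filterlim (\<lambda>\<tau>. v \<tau> k) at_top (at_left \<tau>0)" for k
  proof -
    have "((\<lambda>\<tau>. layer_num n (a 0) (b 0) \<tau> f k) \<longlongrightarrow> layer_num n (a 0) (b 0) \<tau>0 f k) (at_left \<tau>0)"
    proof -
      have "isCont (\<lambda>\<tau>. layer_num n (a 0) (b 0) \<tau> f k) \<tau>0" using L0 by (intro isCont_layer_num) auto
      then show ?thesis by (auto simp: isCont_def filterlim_at_split)
    qed
    moreover have "0 < layer_num n (a 0) (b 0) \<tau>0 f k"
      using layer_num_singular_pos[of "a 0" n "b 0" \<tau>0 f i0 k] L0 \<tau>0 f n N by blast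
    moreover have "filterlim (\<lambda>\<tau>. inverse (1 - \<tau> ^ n * ratio n (a 0) (b 0))) at_top (at_left \<tau>0)"
    proof (rule filterlim_inverse_at_top)
      have "((\<lambda>\<tau>. 1 - \<tau> ^ n * ratio n (a 0) (b 0)) \<longlongrightarrow> 1 - \<tau>0 ^ n * ratio n (a 0) (b 0)) (at_left \<tau>0)"
        by (intro tendsto_intros)
      then show "((\<lambda>\<tau>. 1 - \<tau> ^ n * ratio n (a 0) (b 0)) \<longlongrightarrow> 0) (at_left \<tau>0)" using \<tau>0 by simp
      show "\<forall>\<^sub>F \<tau> in at_left \<tau>0. 0 < 1 - \<tau> ^ n * ratio n (a 0) (b 0)"
        using near by eventually_elim (use sub in auto)
    qed
    ultimately show ?thesis
      unfolding v_def layer_inv_def divide_inverse by (auto intro: filterlim_tendsto_pos_mult_at_top)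
  qed
  \<comment> \<open>Threshold for \<open>v\<close>: it is at least \<open>\<bar>u i\<bar>\<close>,
    and multiplied by \<open>b 0 i\<close> it pays for both terms of the next source that contain
    \<open>u\<close>, whatever their signs. The 2 comes from \<open>1 / \<tau> < 2 / \<tau>0\<close>
    near \<open>\<tau>0\<close>.\<close>
  define c where "c = (\<lambda>i. \<bar>u i\<bar> + a 0 (i + 1) * \<bar>u (i + 1)\<bar> * 2 / (\<tau>0 * b 0 i))"
  have "\<forall>\<^sub>F \<tau> in at_left \<tau>0. c k \<le> v \<tau> k" for k
    using vtop[of k] by (simp add: filterlim_at_top)
  \<comment> \<open>By periodicity the comparison concerns finitely many indices, so it eventually
    holds for all of them at once.\<close>
  then have ev: "\<forall>\<^sub>F \<tau> in at_left \<tau>0. \<forall>k\<in>{0..<int n}. c k \<le> v \<tau> k"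
    by (intro eventually_ball_finite) auto
  have "\<forall>\<^sub>F \<tau> in at_left \<tau>0. v \<tau> i \<le> transfer n (Suc m) a b C \<tau> u f i"
    using ev near
  proof eventually_elim
    case (elim \<tau>)
    have \<tau>: "0 < \<tau>" using elim \<tau>0 by linarith
    have vper: "v \<tau> (k + int n) = v \<tau> k" for k
      unfolding v_def using L0 f by (intro layer_inv_periodic) auto
    have cper: "c (k + int n) = c k" for k
      using L0(3)[of "k + 1"] L0(4)[of k] u[of k] u[of "k + 1"] by (simp add: c_def algebra_simps)
    have cv: "c k \<le> v \<tau> k" for k
    proof -
      have "k mod int n \<in> {0..<int n}" using n by auto
      then have "c (k mod int n) \<le> v \<tau> (k mod int n)" using elim by blast
      then show ?thesis using periodic_mod[of c "int n" k, OF cper] periodic_mod[of "v \<tau>" "int n" k, OF vper] by simp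
    qed
    have c0: "\<bar>u k\<bar> \<le> c k" for k
      using L0(1)[of "k+1"] L0(2)[of k] \<tau>0 by (simp add: c_def)
    have v0: "0 \<le> v \<tau> k" for k using cv[of k] c0[of k] by linarith
    define g where "g = (\<lambda>i. C 1 i * v \<tau> i - b 0 i * u i + a 0 (i + 1) * u (i + 1) / \<tau>)"
    have "v \<tau> i \<le> transfer n m (\<lambda>k. a (Suc k)) (\<lambda>k. b (Suc k)) (\<lambda>k. C (Suc k)) \<tau> (v \<tau>) g i"
    proof (rule transfer_ge[OF layers_Suc[OF L] dominant_Suc[OF D] n \<tau>])
      show "\<forall>k<m. \<tau> ^ n * ratio n (a (Suc k)) (b (Suc k)) < 1"
      proof (intro allI impI)
        fix k assume "k < m"
        then have "\<tau> ^ n * ratio n (a (Suc k)) (b (Suc k)) \<le> \<tau> ^ n * ratio n (a 0) (b 0)"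
          using sorted \<tau> by (intro mult_left_mono) auto
        then show "\<tau> ^ n * ratio n (a (Suc k)) (b (Suc k)) < 1" using sub[of \<tau>] elim by linarith
      qed
      show "0 < m \<longrightarrow> (\<forall>i. (a (Suc 0) i + b (Suc 0) i) * v \<tau> i \<le> g i)"
      proof (intro impI allI)
        fix i assume "0 < m"
        then have 1: "(a (Suc 0) i + b (Suc 0) i + b 0 i) * v \<tau> i \<le> C (Suc 0) i * v \<tau> i"
          using D v0 by (intro mult_right_mono) (auto simp: dominant_def)
        have "b 0 i * c i \<le> b 0 i * v \<tau> i" using cv L0(2)[of i] by simp
        moreover have "b 0 i * c i = b 0 i * \<bar>u i\<bar> + a 0 (i + 1) * \<bar>u (i + 1)\<bar> * (2 / \<tau>0)"
          using L0(2)[of i] \<tau>0 by (simp add: c_def field_simps)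
        moreover have "b 0 i * u i \<le> b 0 i * \<bar>u i\<bar>" using L0(2)[of i] by simp
        moreover have "- (a 0 (i + 1) * u (i + 1) / \<tau>) \<le> a 0 (i + 1) * \<bar>u (i + 1)\<bar> * (2 / \<tau>0)"
        proof -
          have "- (a 0 (i + 1) * u (i + 1) / \<tau>) \<le> a 0 (i + 1) * \<bar>u (i + 1)\<bar> * (1 / \<tau>)"
          proof -
            have "a 0 (i + 1) * (- u (i + 1)) / \<tau> \<le> a 0 (i + 1) * \<bar>u (i + 1)\<bar> / \<tau>"
              using L0(1)[of "i+1"] \<tau> by (intro divide_right_mono mult_left_mono) auto
            then show ?thesis by simp
          qed
          also have "\<dots> \<le> a 0 (i + 1) * \<bar>u (i + 1)\<bar> * (2 / \<tau>0)"
            using L0(1)[of "i+1"] elim \<tau>0 \<tau> by (intro mult_left_mono) (auto simp: field_simps)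
          finally show ?thesis .
        qed
        ultimately show "(a (Suc 0) i + b (Suc 0) i) * v \<tau> i \<le> g i"
          using 1 by (simp add: g_def algebra_simps)
      qed
    qed (use v0 in auto)
    then show ?case by (simp add: v_def g_def)
  qed
  then show ?thesis by (rule filterlim_at_top_mono[OF vtop])
qed

text \<open>The open positive half-space of \<open>e\<close> lies in the closed one of
  \<open>e'\<close>, which forces parallel normals: were two coefficient quotients different, a
  vector supported on these two indices would lie in the first but not in the second.\<close>

lemma proportional_functionals:
  fixes e e' :: "nat \<Rightarrow> real"
  assumes pos: "\<And>j. j < n \<Longrightarrow> 0 < e j" "\<And>j. j < n \<Longrightarrow> 0 < e' j"
    and imp: "\<And>x. 0 < (\<Sum>j<n. e j * x j) \<Longrightarrow> 0 \<le> (\<Sum>j<n. e' j * x j)"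
    and ij: "i < n" "j < n"
  shows "e' i * e j = e' j * e i"
proof -
  have le: "e' j * e i \<le> e' i * e j" if ij: "i < n" "j < n" for i j
  proof (rule ccontr)
    assume "\<not> ?thesis"
    then have lt: "e' i * e j < e' j * e i" by simp
    then have ne: "i \<noteq> j" by auto
    \<comment> \<open>Half of the perturbation that is admissible: \<open>x\<close> pairs with
      \<open>e\<close> to \<open>e i * \<epsilon>\<close>, which is positive, and with
      \<open>e'\<close> to minus half the assumed gap.\<close>
    define \<epsilon> where "\<epsilon> = (e' j * e i - e' i * e j) / (2 * e' i)"
    have \<epsilon>: "0 < \<epsilon>" using lt pos(2)[OF ij(1)] by (simp add: \<epsilon>_def)
    define x where "x = (\<lambda>l. if l = i then e j + \<epsilon> else if l = j then - e i else 0)"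
    have S: "(\<Sum>l<n. h l * x l) = h i * (e j + \<epsilon>) - h j * e i" for h
    proof -
      have "(\<Sum>l<n. h l * x l) = (\<Sum>l<n. (if l = i then h i * (e j + \<epsilon>) else 0) + (if l = j then - h j * e i else 0))"
        using ne by (intro sum.cong) (auto simp: x_def)
      then show ?thesis using ij by (simp add: sum.distrib)
    qed
    have "0 < (\<Sum>l<n. e l * x l)" unfolding S using pos(1)[OF ij(1)] \<epsilon> by (simp add: algebra_simps)
    then have "0 \<le> (\<Sum>l<n. e' l * x l)" by (rule imp)
    then have "0 \<le> e' i * e j + e' i * \<epsilon> - e' j * e i" unfolding S by (simp add: algebra_simps)
    moreover have "e' i * \<epsilon> = (e' j * e i - e' i * e j) / 2" using pos(2)[OF ij(1)] by (simp add: \<epsilon>_def)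
    ultimately show False using lt by (simp add: field_simps)
  qed
  show ?thesis using le[OF ij] le[OF ij(2,1)] by linarith
qed

section \<open>Comparing two networks with decreasing ratios layer by layer\<close>

definition sorted_layers :: "nat \<Rightarrow> nat \<Rightarrow> (nat \<Rightarrow> int \<Rightarrow> real) \<Rightarrow> (nat \<Rightarrow> int \<Rightarrow> real) \<Rightarrow> bool" where
  "sorted_layers n m a b \<longleftrightarrow> (\<forall>k l. k \<le> l \<longrightarrow> l < m \<longrightarrow> ratio n (a l) (b l) \<le> ratio n (a k) (b k))"

text \<open>Equality of the transfer maps of two networks whose potentials in the first column differ
  by the gauge factor \<open>g\<close>; dually, the currents entering it differ by \<open>1 / g\<close>.\<close>

definition equal_transfer ::
  "nat \<Rightarrow> nat \<Rightarrow> (nat \<Rightarrow> int \<Rightarrow> real) \<Rightarrow> (nat \<Rightarrow> int \<Rightarrow> real) \<Rightarrow> (nat \<Rightarrow> int \<Rightarrow> real) \<Rightarrow>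
   (nat \<Rightarrow> int \<Rightarrow> real) \<Rightarrow> (nat \<Rightarrow> int \<Rightarrow> real) \<Rightarrow> (nat \<Rightarrow> int \<Rightarrow> real) \<Rightarrow> (int \<Rightarrow> real) \<Rightarrow> bool" where
  "equal_transfer n m a b C a' b' C' g \<longleftrightarrow> (\<exists>X. finite X \<and> (\<forall>\<tau>>0. \<tau> \<notin> X \<longrightarrow>
     (\<forall>u J. (\<forall>i. u (i + int n) = u i) \<longrightarrow> (\<forall>i. J (i + int n) = J i) \<longrightarrow>
       transfer n m a b C \<tau> u (\<lambda>i. C 0 i * u i - J i) =
       transfer n m a' b' C' \<tau> (\<lambda>i. g i * u i) (\<lambda>i. C' 0 i * (g i * u i) - J i / g i))))"

lemma equal_transfer_sym:
  assumes "equal_transfer n m a b C a' b' C' g" "\<And>i. 0 < g i" "\<And>i. g (i + int n) = g i"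
  shows "equal_transfer n m a' b' C' a b C (\<lambda>i. 1 / g i)"
proof -
  obtain X where X1: "finite X" and X2: "\<forall>\<tau>>0. \<tau> \<notin> X \<longrightarrow>
     (\<forall>u J. (\<forall>i. u (i + int n) = u i) \<longrightarrow> (\<forall>i. J (i + int n) = J i) \<longrightarrow>
       transfer n m a b C \<tau> u (\<lambda>i. C 0 i * u i - J i) =
       transfer n m a' b' C' \<tau> (\<lambda>i. g i * u i) (\<lambda>i. C' 0 i * (g i * u i) - J i / g i))"
    using assms(1) unfolding equal_transfer_def by (elim exE conjE) (rule that)
  note X = X1 X2[rule_format]
  have g0: "g i \<noteq> 0" for i using assms(2)[of i] by simp
  show ?thesis unfolding equal_transfer_def
  proof (intro exI[of _ X] conjI allI impI X(1))
    fix \<tau> :: real and u J :: "int \<Rightarrow> real" assume *: "0 < \<tau>" "\<tau> \<notin> X" "\<forall>i. u (i + int n) = u i" "\<forall>i. J (i + int n) = J i"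
    have "transfer n m a b C \<tau> (\<lambda>i. u i / g i) (\<lambda>i. C 0 i * (u i / g i) - g i * J i) =
       transfer n m a' b' C' \<tau> (\<lambda>i. g i * (u i / g i)) (\<lambda>i. C' 0 i * (g i * (u i / g i)) - g i * J i / g i)"
      using * assms(3) by (intro X(2)) auto
    then show "transfer n m a' b' C' \<tau> u (\<lambda>i. C' 0 i * u i - J i) =
      transfer n m a b C \<tau> (\<lambda>i. 1 / g i * u i) (\<lambda>i. C 0 i * (1 / g i * u i) - J i / (1 / g i))"
      using g0 by (simp add: mult.commute)
  qed
qed

lemma eventually_at_left_not_in_finite:
  assumes "finite X" "0 < (\<tau>0 :: real)"
  shows "\<forall>\<^sub>F \<tau> in at_left \<tau>0. 0 < \<tau> \<and> \<tau> \<notin> X"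
proof -
  have "\<forall>\<^sub>F \<tau> in at \<tau>0. \<tau> \<notin> X"
    using assms(1) by (auto simp: eventually_at_topological intro!: exI[of _ "- (X - {\<tau>0})"] finite_imp_closed)
  then have "\<forall>\<^sub>F \<tau> in at_left \<tau>0. \<tau> \<notin> X" by (simp add: eventually_at_split)
  moreover have "\<forall>\<^sub>F \<tau> in at_left \<tau>0. 0 < \<tau>"
    using eventually_at_left_real[OF assms(2)] by (auto elim: eventually_mono)
  ultimately show ?thesis by eventually_elim simp
qed

lemma ex_singular:
  assumes "0 < (r :: real)" "1 \<le> n"
  shows "\<exists>\<tau>>0. \<tau> ^ n * r = 1"
  using assms by (intro exI[of _ "root n (1 / r)"]) (simp add: real_root_pow_pos2 less_imp_le)

text \<open>If the first ratio of the unprimed network were larger, its output would diverge at a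
  point \<open>\<tau>0\<close> where every layer of the primed network is still regular and the
  output continuous.\<close>

lemma equal_transfer_ratio_le:
  assumes L: "layers n (Suc m) a b C" "layers n (Suc m) a' b' C'" and D: "dominant (Suc m) a b C" and n: "1 \<le> n"
    and S: "sorted_layers n (Suc m) a b" "sorted_layers n (Suc m) a' b'"
    and g: "\<And>i. 0 < g i" "\<And>i. g (i + int n) = g i"
    and E: "equal_transfer n (Suc m) a b C a' b' C' g"
  shows "ratio n (a 0) (b 0) \<le> ratio n (a' 0) (b' 0)"
proof (rule ccontr)
  assume "\<not> ?thesis"
  then have less: "ratio n (a' 0) (b' 0) < ratio n (a 0) (b 0)" by simp
  note L0 = layers_0[OF L(1)] and L0' = layers_0[OF L(2)]
  have r: "0 < ratio n (a 0) (b 0)" using L0 by (intro ratio_pos)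
  obtain \<tau>0 where \<tau>0: "0 < \<tau>0" "\<tau>0 ^ n * ratio n (a 0) (b 0) = 1" using ex_singular[OF r n] by blast
  obtain X where X1: "finite X" and X2: "\<forall>\<tau>>0. \<tau> \<notin> X \<longrightarrow>
     (\<forall>u J. (\<forall>i. u (i + int n) = u i) \<longrightarrow> (\<forall>i. J (i + int n) = J i) \<longrightarrow>
       transfer n (Suc m) a b C \<tau> u (\<lambda>i. C 0 i * u i - J i) =
       transfer n (Suc m) a' b' C' \<tau> (\<lambda>i. g i * u i) (\<lambda>i. C' 0 i * (g i * u i) - J i / g i))"
    using E unfolding equal_transfer_def by (elim exE conjE) (rule that)
  note X = X1 X2[rule_format]
  \<comment> \<open>Zero potential and \<open>J\<close> equal to -1 make the source constantly 1, so
    the functional is visibly positive.\<close>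
  define u J :: "int \<Rightarrow> real" where "u = (\<lambda>i. 0)" and "J = (\<lambda>i. - 1)"
  have "1 / b 0 0 \<le> layer_num n (a 0) (b 0) \<tau>0 (\<lambda>i. 1) 0"
    using L0 \<tau>0 n by (intro layer_num_ge) auto
  then have N: "0 < layer_num n (a 0) (b 0) \<tau>0 (\<lambda>i. C 0 i * u i - J i) 0"
    using L0(2)[of 0] by (simp add: u_def J_def) (meson divide_pos_pos less_le_trans zero_less_one)
  have top: "filterlim (\<lambda>\<tau>. transfer n (Suc m) a b C \<tau> u (\<lambda>i. C 0 i * u i - J i) 0) at_top (at_left \<tau>0)"
    using S(1) by (intro transfer_blowup[OF L(1) D n _ \<tau>0 _ _ N]) (auto simp: sorted_layers_def u_def J_def)
  define F where "F = (\<lambda>\<tau>. transfer n (Suc m) a' b' C' \<tau> (\<lambda>i. g i * u i) (\<lambda>i. C' 0 i * (g i * u i) - J i / g i) 0)"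
  have ns: "nonsingular n (Suc m) a' b' \<tau>0"
    unfolding nonsingular_def
  proof (intro conjI allI impI)
    fix k assume "k < Suc m"
    then have "ratio n (a' k) (b' k) < ratio n (a 0) (b 0)" using S(2) less by (force simp: sorted_layers_def)
    then have "\<tau>0 ^ n * ratio n (a' k) (b' k) < \<tau>0 ^ n * ratio n (a 0) (b 0)" using \<tau>0 by (intro mult_strict_left_mono) auto
    then show "\<tau>0 ^ n * of_real (ratio n (a' k) (b' k)) \<noteq> 1" using \<tau>0 by simp
  qed (use \<tau>0 in auto)
  have "isCont F \<tau>0" unfolding F_def
    by (rule isCont_transfer[OF L(2) _ _ ns]) (use g(1) in \<open>auto intro!: continuous_intros\<close>)
  then have "(F \<longlongrightarrow> F \<tau>0) (at_left \<tau>0)" by (auto simp: isCont_def filterlim_at_split)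
  then have "\<forall>\<^sub>F \<tau> in at_left \<tau>0. F \<tau> < F \<tau>0 + 1" by (rule order_tendstoD) simp
  moreover have "\<forall>\<^sub>F \<tau> in at_left \<tau>0. F \<tau>0 + 1 \<le> transfer n (Suc m) a b C \<tau> u (\<lambda>i. C 0 i * u i - J i) 0"
    using top by (simp add: filterlim_at_top)
  ultimately have "\<forall>\<^sub>F \<tau> in at_left \<tau>0. False"
    using eventually_at_left_not_in_finite[OF X(1) \<tau>0(1)]
  proof eventually_elim
    case (elim \<tau>)
    have "transfer n (Suc m) a b C \<tau> u (\<lambda>i. C 0 i * u i - J i) 0 = F \<tau>"
      unfolding F_def using elim by (subst X(2)) (auto simp: u_def J_def)
    then show ?case using elim by linarith
  qed
  then show False by (simp add: trivial_limit_at_left_real)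
qed

text \<open>A positive functional on one side and a negative one on the other would drive equal
  outputs to opposite infinities. A vanishing functional yields no contradiction, hence the weak
  inequality.\<close>

lemma equal_transfer_functional:
  assumes L: "layers n (Suc m) a b C" "layers n (Suc m) a' b' C'"
    and D: "dominant (Suc m) a b C" "dominant (Suc m) a' b' C'" and n: "1 \<le> n"
    and S: "sorted_layers n (Suc m) a b" "sorted_layers n (Suc m) a' b'"
    and g: "\<And>i. 0 < g i" "\<And>i. g (i + int n) = g i"
    and E: "equal_transfer n (Suc m) a b C a' b' C' g"
    and \<tau>0: "0 < \<tau>0" "\<tau>0 ^ n * ratio n (a 0) (b 0) = 1" "\<tau>0 ^ n * ratio n (a' 0) (b' 0) = 1"
    and u: "\<And>i. u (i + int n) = u i" and J: "\<And>i. J (i + int n) = J i"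
    and N: "0 < layer_num n (a 0) (b 0) \<tau>0 (\<lambda>i. C 0 i * u i - J i) k"
  shows "0 \<le> layer_num n (a' 0) (b' 0) \<tau>0 (\<lambda>i. C' 0 i * (g i * u i) - J i / g i) k"
proof (rule ccontr)
  assume "\<not> ?thesis"
  then have N': "0 < layer_num n (a' 0) (b' 0) \<tau>0 (\<lambda>i. - (C' 0 i * (g i * u i) - J i / g i)) k"
    unfolding layer_num_uminus by linarith
  note L0 = layers_0[OF L(1)] and L0' = layers_0[OF L(2)]
  obtain X where X1: "finite X" and X2: "\<forall>\<tau>>0. \<tau> \<notin> X \<longrightarrow>
     (\<forall>u J. (\<forall>i. u (i + int n) = u i) \<longrightarrow> (\<forall>i. J (i + int n) = J i) \<longrightarrow>
       transfer n (Suc m) a b C \<tau> u (\<lambda>i. C 0 i * u i - J i) =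
       transfer n (Suc m) a' b' C' \<tau> (\<lambda>i. g i * u i) (\<lambda>i. C' 0 i * (g i * u i) - J i / g i))"
    using E unfolding equal_transfer_def by (elim exE conjE) (rule that)
  note X = X1 X2[rule_format]
  have "filterlim (\<lambda>\<tau>. transfer n (Suc m) a b C \<tau> u (\<lambda>i. C 0 i * u i - J i) 0) at_top (at_left \<tau>0)"
    using S(1) L0 u J by (intro transfer_blowup[OF L(1) D(1) n _ \<tau>0(1,2) _ _ N]) (auto simp: sorted_layers_def)
  then have "\<forall>\<^sub>F \<tau> in at_left \<tau>0. 1 \<le> transfer n (Suc m) a b C \<tau> u (\<lambda>i. C 0 i * u i - J i) 0"
    by (simp add: filterlim_at_top)
  moreover have "filterlim (\<lambda>\<tau>. transfer n (Suc m) a' b' C' \<tau> (\<lambda>i. - (g i * u i)) (\<lambda>i. - (C' 0 i * (g i * u i) - J i / g i)) 0) at_top (at_left \<tau>0)"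
    using S(2) L0' u J g by (intro transfer_blowup[OF L(2) D(2) n _ \<tau>0(1,3) _ _ N']) (auto simp: sorted_layers_def)
  then have "\<forall>\<^sub>F \<tau> in at_left \<tau>0. 1 \<le> transfer n (Suc m) a' b' C' \<tau> (\<lambda>i. - (g i * u i)) (\<lambda>i. - (C' 0 i * (g i * u i) - J i / g i)) 0"
    by (simp add: filterlim_at_top)
  ultimately have "\<forall>\<^sub>F \<tau> in at_left \<tau>0. False"
    using eventually_at_left_not_in_finite[OF X(1) \<tau>0(1)]
  proof eventually_elim
    case (elim \<tau>)
    have "transfer n (Suc m) a b C \<tau> u (\<lambda>i. C 0 i * u i - J i) 0 =
       transfer n (Suc m) a' b' C' \<tau> (\<lambda>i. g i * u i) (\<lambda>i. C' 0 i * (g i * u i) - J i / g i) 0"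
      using elim u J by (subst X(2)) auto
    then show ?case using elim by (simp only: transfer_uminus)
  qed
  then show False by (simp add: trivial_limit_at_left_real)
qed

lemma layer_num_as_sum:
  "layer_num n a b \<tau> f i = (\<Sum>j<n. (\<tau> ^ j * (\<Prod>l<j. a (i - int l) / b (i - int l)) / b (i - int j)) * f (i - int j))"
  for f :: "int \<Rightarrow> real"
  by (simp add: layer_num_def)

lemma ex_periodic_values:
  assumes "1 \<le> n"
  obtains h :: "int \<Rightarrow> real" where "\<And>i. h (i + int n) = h i" "\<And>j. j < n \<Longrightarrow> h (i - int j) = x j"
proof
  show "x (nat ((i - (k + int n)) mod int n)) = x (nat ((i - k) mod int n))" for k
  proof -
    have "i - (k + int n) = (i - k) + (- 1) * int n" by simp
    then show ?thesis by (simp only: mod_mult_self1)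
  qed
  show "x (nat ((i - (i - int j)) mod int n)) = x j" if "j < n" for j
    using that by simp
qed

text \<open>Comparing signs for \<open>u = 0\<close> makes the residue functionals proportional in
  \<open>J\<close> up to the gauge; the quotient of their first two coefficients is
  \<open>\<tau>0 * a 0 i / b 0 (i - 1)\<close>, whence the first claim. Comparing signs for suitable
  pairs of \<open>u\<close> and \<open>J\<close> gives the second.\<close>

lemma first_layers_gauge_equivalent:
  assumes L: "layers n (Suc m) a b C" "layers n (Suc m) a' b' C'"
    and D: "dominant (Suc m) a b C" "dominant (Suc m) a' b' C'" and n: "1 \<le> n"
    and S: "sorted_layers n (Suc m) a b" "sorted_layers n (Suc m) a' b'"
    and g: "\<And>i. 0 < g i" "\<And>i. g (i + int n) = g i"
    and E: "equal_transfer n (Suc m) a b C a' b' C' g"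
  shows "a' 0 i * b 0 (i - 1) * g i = a 0 i * b' 0 (i - 1) * g (i - 1)"
    and "C 0 i = C' 0 i * (g i)\<^sup>2"
proof -
  note L0 = layers_0[OF L(1)] and L0' = layers_0[OF L(2)]
  have g0: "g i \<noteq> 0" for i using g(1)[of i] by simp
  have "ratio n (a' 0) (b' 0) \<le> ratio n (a 0) (b 0)"
    by (rule equal_transfer_ratio_le[OF L(2,1) D(2) n S(2,1) _ _ equal_transfer_sym[OF E g]]) (use g in auto)
  moreover have "ratio n (a 0) (b 0) \<le> ratio n (a' 0) (b' 0)"
    by (rule equal_transfer_ratio_le[OF L D(1) n S g E])
  ultimately have req: "ratio n (a' 0) (b' 0) = ratio n (a 0) (b 0)" by simp
  have r: "0 < ratio n (a 0) (b 0)" using L0 by (intro ratio_pos)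
  obtain \<tau>0 where \<tau>0: "0 < \<tau>0" "\<tau>0 ^ n * ratio n (a 0) (b 0) = 1" using ex_singular[OF r n] by blast
  have \<tau>0': "\<tau>0 ^ n * ratio n (a' 0) (b' 0) = 1" using req \<tau>0 by simp
  note fct = equal_transfer_functional[OF L D n S g E \<tau>0 \<tau>0']
  define e where "e = (\<lambda>j. \<tau>0 ^ j * (\<Prod>l<j. a 0 (i - int l) / b 0 (i - int l)) / b 0 (i - int j))"
  define e' where "e' = (\<lambda>j. \<tau>0 ^ j * (\<Prod>l<j. a' 0 (i - int l) / b' 0 (i - int l)) / b' 0 (i - int j))"
  have N: "layer_num n (a 0) (b 0) \<tau>0 f i = (\<Sum>j<n. e j * f (i - int j))" 
    "layer_num n (a' 0) (b' 0) \<tau>0 f i = (\<Sum>j<n. e' j * f (i - int j))" for f :: "int \<Rightarrow> real"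
    unfolding layer_num_as_sum e_def e'_def by simp_all
  have epos: "0 < e j" "0 < e' j" for j
    unfolding e_def e'_def using L0 L0' \<tau>0 by (auto intro!: mult_pos_pos prod_pos divide_pos_pos)
  have proportional: "(e' k / g (i - int k)) * e j = (e' j / g (i - int j)) * e k" if "k < n" "j < n" for k j
  proof (rule proportional_functionals[of n e "\<lambda>j. e' j / g (i - int j)"])
    fix x :: "nat \<Rightarrow> real" assume x: "0 < (\<Sum>j<n. e j * x j)"
    obtain h :: "int \<Rightarrow> real" where h: "\<And>i. h (i + int n) = h i" "\<And>j. j < n \<Longrightarrow> h (i - int j) = x j"
      using ex_periodic_values[OF n] by blast
    have "0 < layer_num n (a 0) (b 0) \<tau>0 (\<lambda>i. C 0 i * 0 - (- h i)) i"
      using x h by (simp add: N)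
    then have "0 \<le> layer_num n (a' 0) (b' 0) \<tau>0 (\<lambda>i. C' 0 i * (g i * 0) - (- h i) / g i) i"
      by (rule fct[rotated 2]) (use h in auto)
    then show "0 \<le> (\<Sum>j<n. e' j / g (i - int j) * x j)" using h by (simp add: N)
  qed (use that epos g in auto)
  show "a' 0 i * b 0 (i - 1) * g i = a 0 i * b' 0 (i - 1) * g (i - 1)"
  \<comment> \<open>For \<open>n = 1\<close> the functional has a single coefficient, and the claim
    comes from the equality of the ratios instead.\<close>
  proof (cases "n = 1")
    case True
    have "b 0 (i - 1) = b 0 i" "b' 0 (i - 1) = b' 0 i" "g (i - 1) = g i"
      using L0(4)[of "i - 1"] L0'(4)[of "i - 1"] g(2)[of "i - 1"] True by simp_all
    moreover have "a 0 i / b 0 i = a' 0 i / b' 0 i"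
      using req ratio_down[of "a 0" n "b 0" i, OF L0(3,4)] ratio_down[of "a' 0" n "b' 0" i, OF L0'(3,4)] True by simp
    ultimately show ?thesis using L0(2)[of i] L0'(2)[of i] by (simp add: field_simps)
  next
    case False
    then have "(e' 0 / g i) * e 1 = (e' 1 / g (i - 1)) * e 0" using proportional[of 0 1] n by simp
    then show ?thesis using L0(2)[of i] L0'(2)[of i] L0(2)[of "i-1"] L0'(2)[of "i-1"] g0 \<tau>0
      by (simp add: e_def e'_def field_simps)
  qed
  \<comment> \<open>The defect of the second claim, divided by \<open>g i\<close>. Taking
    \<open>u = - d\<close> turns its contribution to the primed source into \<open>- d * d\<close>,
    of constant sign, while \<open>J\<close> is chosen to keep the unprimed functional equal to
    \<open>\<epsilon> * E1\<close>. Letting \<open>\<epsilon>\<close> tend to 0 leaves the weighted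
    sum of squares \<open>E2\<close> nonpositive.\<close>
  define d where "d = (\<lambda>i. C' 0 i * g i - C 0 i / g i)"
  have dper: "d (k + int n) = d k" for k using L0(5) L0'(5) g(2) by (simp add: d_def)
  define E1 where "E1 = (\<Sum>j<n. e j)"
  define E2 where "E2 = (\<Sum>j<n. e' j * (d (i - int j) * d (i - int j)))"
  define E3 where "E3 = (\<Sum>j<n. e' j / g (i - int j))"
  have E1: "0 < E1" unfolding E1_def using epos n by (intro sum_pos) (auto simp: lessThan_empty_iff)
  have E3: "0 < E3" unfolding E3_def using epos g n by (intro sum_pos) (auto simp: lessThan_empty_iff)
  have "E2 \<le> \<epsilon> * E3" if "0 < \<epsilon>" for \<epsilon>
  proof -
    define u where "u = (\<lambda>k. - d k)"
    define J where "J = (\<lambda>k. C 0 k * u k - \<epsilon>)"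
    have "0 < layer_num n (a 0) (b 0) \<tau>0 (\<lambda>i. C 0 i * u i - J i) i"
      using that E1 by (simp add: N J_def E1_def sum_distrib_right[symmetric])
    then have "0 \<le> layer_num n (a' 0) (b' 0) \<tau>0 (\<lambda>i. C' 0 i * (g i * u i) - J i / g i) i"
      by (rule fct[rotated 2]) (use dper L0(5) in \<open>auto simp: u_def J_def\<close>)
    also have "(\<lambda>i. C' 0 i * (g i * u i) - J i / g i) = (\<lambda>k. \<epsilon> / g k - d k * d k)"
      using g0 by (auto simp: J_def u_def d_def fun_eq_iff field_simps)
    also have "layer_num n (a' 0) (b' 0) \<tau>0 \<dots> i = \<epsilon> * E3 - E2"
      by (simp add: N E3_def E2_def sum_subtractf sum_distrib_left algebra_simps)
    finally show ?thesis by simp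
  qed
  then have "E2 \<le> 0"
  proof -
    assume le: "\<And>\<epsilon>. 0 < \<epsilon> \<Longrightarrow> E2 \<le> \<epsilon> * E3"
    show ?thesis
    proof (rule field_le_epsilon)
      fix \<epsilon> :: real assume "0 < \<epsilon>"
      then show "E2 \<le> 0 + \<epsilon>" using le[of "\<epsilon> / E3"] E3 by simp
    qed
  qed
  moreover have "e' 0 * (d i * d i) \<le> E2"
  proof -
    have "(\<Sum>j\<in>{0}. e' j * (d (i - int j) * d (i - int j))) \<le> E2"
      unfolding E2_def using epos n by (intro sum_mono2) (auto simp: less_imp_le)
    then show ?thesis by simp
  qed
  ultimately have "e' 0 * (d i * d i) \<le> 0" by simp
  then have "d i = 0" using epos(2)[of 0] by (auto simp: mult_le_0_iff not_le)
  then show "C 0 i = C' 0 i * (g i)\<^sup>2" using g0[of i] by (simp add: d_def field_simps power2_eq_square)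
qed

text \<open>Arbitrary data \<open>v\<close>, \<open>J\<close> at column 1 are produced by data at
  column 0: \<open>f\<close> is layer 0 applied to \<open>v\<close>, and \<open>u\<close> solves
  \<open>b 0 i * u i - a 0 (i + 1) * u (i + 1) / \<tau> = J i\<close>. By the gauge relations the
  primed network produces \<open>G i * v i\<close> and \<open>J i / G i\<close> from the
  corresponding data.\<close>

lemma equal_transfer_peel:
  assumes L: "layers n (Suc m) a b C" "layers n (Suc m) a' b' C'" and n: "1 \<le> n"
    and g: "\<And>i. 0 < g i" "\<And>i. g (i + int n) = g i"
    and E: "equal_transfer n (Suc m) a b C a' b' C' g"
    and G: "\<And>i. 0 < G i" "\<And>i. G (i + int n) = G i"
    and b': "\<And>i. b' 0 i = b 0 i / (g i * G i)" and a': "\<And>i. a' 0 i = a 0 i / (g i * G (i - 1))"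
    and C: "\<And>i. C 0 i = C' 0 i * (g i)\<^sup>2"
  shows "equal_transfer n m (\<lambda>k. a (Suc k)) (\<lambda>k. b (Suc k)) (\<lambda>k. C (Suc k))
    (\<lambda>k. a' (Suc k)) (\<lambda>k. b' (Suc k)) (\<lambda>k. C' (Suc k)) G"
proof -
  note L0 = layers_0[OF L(1)] and L0' = layers_0[OF L(2)]
  obtain X where X1: "finite X" and X2: "\<forall>\<tau>>0. \<tau> \<notin> X \<longrightarrow>
     (\<forall>u J. (\<forall>i. u (i + int n) = u i) \<longrightarrow> (\<forall>i. J (i + int n) = J i) \<longrightarrow>
       transfer n (Suc m) a b C \<tau> u (\<lambda>i. C 0 i * u i - J i) =
       transfer n (Suc m) a' b' C' \<tau> (\<lambda>i. g i * u i) (\<lambda>i. C' 0 i * (g i * u i) - J i / g i))"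
    using E unfolding equal_transfer_def by (elim exE conjE) (rule that)
  have gG: "g i \<noteq> 0" "G i \<noteq> 0" for i using g(1)[of i] G(1)[of i] by simp_all
  \<comment> \<open>The equation for \<open>u\<close> is the transpose of a layer equation.
    Reversing the index turns it into a layer with \<open>1 / \<tau>\<close> in place of
    \<open>\<tau>\<close>, which \<open>layer_inv\<close> solves.\<close>
  define ar br where "ar = (\<lambda>i. a 0 (1 - i))" and "br = (\<lambda>i. b 0 (- i))"
  have rper: "ar (i + int n) = ar i" "br (i + int n) = br i" for i
    using L0(3)[of "1 - i - int n"] L0(4)[of "- i - int n"] by (simp_all add: ar_def br_def algebra_simps)
  \<comment> \<open>Also excluded are the finitely many values at which layer 0 of either network,
    or the reversed layer at \<open>1 / \<tau>\<close>, cannot be inverted.\<close>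
  define Y where "Y = X \<union> {\<tau>. \<not> nonsingular n 1 a b \<tau>} \<union> {\<tau>. \<not> nonsingular n 1 a' b' \<tau>} \<union>
     inverse -` {\<tau>. \<not> nonsingular n 1 (\<lambda>_. ar) (\<lambda>_. br) \<tau>}"
  have "finite Y" unfolding Y_def
    using X1 n by (intro finite_UnI finite_singular finite_vimageI) (auto intro: injI)
  moreover have "transfer n m (\<lambda>k. a (Suc k)) (\<lambda>k. b (Suc k)) (\<lambda>k. C (Suc k)) \<tau> v (\<lambda>i. C (Suc 0) i * v i - J i) =
     transfer n m (\<lambda>k. a' (Suc k)) (\<lambda>k. b' (Suc k)) (\<lambda>k. C' (Suc k)) \<tau> (\<lambda>i. G i * v i) (\<lambda>i. C' (Suc 0) i * (G i * v i) - J i / G i)"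
    if \<tau>: "0 < \<tau>" "\<tau> \<notin> Y" and v: "\<forall>i. v (i + int n) = v i" and J: "\<forall>i. J (i + int n) = J i" for \<tau> :: real and v J
  proof -
    have ns: "\<tau> ^ n * of_real (ratio n (a 0) (b 0)) \<noteq> 1" "\<tau> ^ n * of_real (ratio n (a' 0) (b' 0)) \<noteq> 1"
      "(inverse \<tau>) ^ n * of_real (ratio n ar br) \<noteq> 1"
      using \<tau> by (auto simp: Y_def nonsingular_def)
    define ur where "ur = layer_inv n ar br (inverse \<tau>) (\<lambda>i. J (- i))"
    define u where "u = (\<lambda>i. ur (- i))"
    have Jr: "J (- (i + int n)) = J (- i)" for i using J[rule_format, of "- i - int n"] by simp
    have urper: "ur (i + int n) = ur i" for i
      unfolding ur_def by (rule layer_inv_periodic) (rule rper Jr)+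
    have u: "u (i + int n) = u i" for i using urper[of "- i - int n"] by (simp add: u_def)
    have ueq: "b 0 i * u i - a 0 (i + 1) * u (i + 1) / \<tau> = J i" for i
    proof -
      have "of_real (br (- i)) * ur (- i) - inverse \<tau> * of_real (ar (- i)) * ur (- i - 1) = J (- (- i))"
        unfolding ur_def using L0(2) by (intro layer_inv_eq rper Jr ns) (simp add: br_def)
      moreover have "- i - 1 = - (i + 1)" by simp
      ultimately show ?thesis by (simp only: u_def ar_def br_def) (simp add: divide_inverse mult_ac add.commute)
    qed
    define f where "f = (\<lambda>i. b 0 i * v i - \<tau> * a 0 i * v (i - 1))"
    have vper1: "v (i + int n - 1) = v (i - 1)" for i using v[rule_format, of "i - 1"] by (simp add: algebra_simps)
    have f: "f (i + int n) = f i" for i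
      using L0(3,4) v vper1 by (simp add: f_def)
    define J0 where "J0 = (\<lambda>i. C 0 i * u i - f i)"
    have J0: "\<forall>i. J0 (i + int n) = J0 i" using L0(5) u f by (simp add: J0_def)
    have inv: "v = layer_inv n (a 0) (b 0) \<tau> f"
      using L0 v f ns by (intro layer_inv_unique) (auto simp: f_def)
    define f' where "f' = (\<lambda>i. f i / g i)"
    have inv': "(\<lambda>i. G i * v i) = layer_inv n (a' 0) (b' 0) \<tau> f'"
      using L0' v f ns g G gG by (intro layer_inv_unique) (auto simp: f'_def f_def a' b' field_simps)
    have "transfer n (Suc m) a b C \<tau> u f = transfer n (Suc m) a' b' C' \<tau> (\<lambda>i. g i * u i) f'"
    proof -
      have "f = (\<lambda>i. C 0 i * u i - J0 i)" by (simp add: J0_def)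
      moreover have "f' = (\<lambda>i. C' 0 i * (g i * u i) - J0 i / g i)"
        using gG by (simp add: f'_def J0_def C fun_eq_iff field_simps power2_eq_square)
      ultimately show ?thesis using X2[rule_format, of \<tau> u J0] \<tau> u J0 by (simp add: Y_def)
    qed
    moreover have "(\<lambda>i. of_real (C 1 i) * v i - of_real (b 0 i) * u i + of_real (a 0 (i + 1)) * u (i + 1) / \<tau>) = (\<lambda>i. C (Suc 0) i * v i - J i)"
      by (simp add: fun_eq_iff flip: ueq)
    moreover have "(\<lambda>i. of_real (C' 1 i) * (G i * v i) - of_real (b' 0 i) * (g i * u i) + of_real (a' 0 (i + 1)) * (g (i + 1) * u (i + 1)) / \<tau>) =
       (\<lambda>i. C' (Suc 0) i * (G i * v i) - J i / G i)"
    proof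
      fix i
      have "b' 0 i * (g i * u i) - a' 0 (i + 1) * (g (i + 1) * u (i + 1)) / \<tau> = (b 0 i * u i - a 0 (i + 1) * u (i + 1) / \<tau>) / G i"
        using gG \<tau> by (simp add: a' b' field_simps)
      then show "of_real (C' 1 i) * (G i * v i) - of_real (b' 0 i) * (g i * u i) + of_real (a' 0 (i + 1)) * (g (i + 1) * u (i + 1)) / \<tau> =
        C' (Suc 0) i * (G i * v i) - J i / G i"
        unfolding ueq by simp
    qed
    ultimately show ?thesis unfolding transfer.simps inv[symmetric] inv'[symmetric] by metis
  qed
  ultimately show ?thesis unfolding equal_transfer_def by (intro exI[of _ Y]) auto
qed

text \<open>A diagonal congruence of the Kirchhoff matrix: potentials of column \<open>k\<close> are
  rescaled by \<open>G k\<close>, an edge weight is divided by the factors at both ends and a vertex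
  weight by the square. The potentials of the last column are the output on which both networks
  agree, hence \<open>G m = 1\<close>.\<close>

definition gauge_equivalent ::
  "nat \<Rightarrow> nat \<Rightarrow> (nat \<Rightarrow> int \<Rightarrow> real) \<Rightarrow> (nat \<Rightarrow> int \<Rightarrow> real) \<Rightarrow> (nat \<Rightarrow> int \<Rightarrow> real) \<Rightarrow>
   (nat \<Rightarrow> int \<Rightarrow> real) \<Rightarrow> (nat \<Rightarrow> int \<Rightarrow> real) \<Rightarrow> (nat \<Rightarrow> int \<Rightarrow> real) \<Rightarrow> (nat \<Rightarrow> int \<Rightarrow> real) \<Rightarrow> bool" where
  "gauge_equivalent n m a b C a' b' C' G \<longleftrightarrow> (\<forall>i. G m i = 1) \<and> (\<forall>k\<le>m. \<forall>i. 0 < G k i \<and> G k (i + int n) = G k i) \<and>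
    (\<forall>k<m. \<forall>i. b' k i = b k i / (G k i * G (Suc k) i) \<and> a' k i = a k i / (G k i * G (Suc k) (i - 1)) \<and> C k i = C' k i * (G k i)\<^sup>2)"

text \<open>A single predicate in \<open>m\<close>, so that the induction can change networks and
  gauge at each peeled layer.\<close>

definition gauge_rigid :: "nat \<Rightarrow> nat \<Rightarrow> bool" where
  "gauge_rigid n m \<longleftrightarrow> (\<forall>a b C a' b' C' g. layers n m a b C \<longrightarrow> layers n m a' b' C' \<longrightarrow> dominant m a b C \<longrightarrow> dominant m a' b' C' \<longrightarrow>
      sorted_layers n m a b \<longrightarrow> sorted_layers n m a' b' \<longrightarrow> (\<forall>i. 0 < g i \<and> g (i + int n) = g i) \<longrightarrow>
      equal_transfer n m a b C a' b' C' g \<longrightarrow> (\<exists>G. G 0 = g \<and> gauge_equivalent n m a b C a' b' C' G))"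

theorem sorted_equal_transfer_gauge:
  assumes n: "1 \<le> n"
  shows "gauge_rigid n m"
proof (induction m)
  case 0
  show ?case unfolding gauge_rigid_def
  proof (intro allI impI)
    fix a b C a' b' C' :: "nat \<Rightarrow> int \<Rightarrow> real" and g :: "int \<Rightarrow> real"
    assume g: "\<forall>i. 0 < g i \<and> g (i + int n) = g i" and E: "equal_transfer n 0 a b C a' b' C' g"
    obtain X where X: "finite X" "\<forall>\<tau>>0. \<tau> \<notin> X \<longrightarrow>
     (\<forall>u J. (\<forall>i. u (i + int n) = u i) \<longrightarrow> (\<forall>i. J (i + int n) = J i) \<longrightarrow>
       transfer n 0 a b C \<tau> u (\<lambda>i. C 0 i * u i - J i) =
       transfer n 0 a' b' C' \<tau> (\<lambda>i. g i * u i) (\<lambda>i. C' 0 i * (g i * u i) - J i / g i))"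
      using E unfolding equal_transfer_def by (elim exE conjE) (rule that)
    \<comment> \<open>Without layers the transfer map returns the potential, so one admissible
      \<open>\<tau>\<close> already forces \<open>g\<close> to be 1.\<close>
    have "infinite {0<..(1::real)}" by (simp add: infinite_Ioc)
    then have "\<not> {0<..(1::real)} \<subseteq> X" using X(1) finite_subset by blast
    then obtain \<tau> where "\<tau> \<in> {0<..(1::real)}" "\<tau> \<notin> X" by blast
    then have "(\<lambda>i. 1) = (\<lambda>i. g i * 1)"
      using X(2)[rule_format, of \<tau> "\<lambda>i. 1" "\<lambda>i. 1"] by simp
    then have "g i = 1" for i by (metis mult.right_neutral)
    then show "\<exists>G. G 0 = g \<and> gauge_equivalent n 0 a b C a' b' C' G"
      by (intro exI[of _ "\<lambda>_. g"]) (auto simp: gauge_equivalent_def)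
  qed
next
  case (Suc m)
  show ?case unfolding gauge_rigid_def
  proof (intro allI impI)
    fix a b C a' b' C' :: "nat \<Rightarrow> int \<Rightarrow> real" and g :: "int \<Rightarrow> real"
    assume L: "layers n (Suc m) a b C" "layers n (Suc m) a' b' C'" and D: "dominant (Suc m) a b C" "dominant (Suc m) a' b' C'"
      and S: "sorted_layers n (Suc m) a b" "sorted_layers n (Suc m) a' b'"
      and g': "\<forall>i. 0 < g i \<and> g (i + int n) = g i" and E: "equal_transfer n (Suc m) a b C a' b' C' g"
    note L0 = layers_0[OF L(1)] and L0' = layers_0[OF L(2)]
    have g: "0 < g i" "g (i + int n) = g i" for i using g' by auto
    note fl = first_layers_gauge_equivalent[OF L D n S g E]
    \<comment> \<open>The gauge of the next column is read off from the straight conductances;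
      \<open>fl(1)\<close> says that it fits the diagonal ones as well.\<close>
    define H where "H = (\<lambda>i. b 0 i / (g i * b' 0 i))"
    have H: "0 < H i" "H (i + int n) = H i" for i
      using L0 L0' g by (auto simp: H_def)
    have b': "b' 0 i = b 0 i / (g i * H i)" for i
      using L0(2)[of i] L0'(2)[of i] g(1)[of i] by (simp add: H_def)
    have a': "a' 0 i = a 0 i / (g i * H (i - 1))" for i
      using fl(1)[of i] L0(2)[of "i - 1"] L0'(2)[of "i - 1"] g(1)[of i] g(1)[of "i - 1"] by (simp add: H_def field_simps)
    have S': "sorted_layers n m (\<lambda>k. a (Suc k)) (\<lambda>k. b (Suc k))" "sorted_layers n m (\<lambda>k. a' (Suc k)) (\<lambda>k. b' (Suc k))"
      using S by (auto simp: sorted_layers_def)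
    have "equal_transfer n m (\<lambda>k. a (Suc k)) (\<lambda>k. b (Suc k)) (\<lambda>k. C (Suc k)) (\<lambda>k. a' (Suc k)) (\<lambda>k. b' (Suc k)) (\<lambda>k. C' (Suc k)) H"
      by (rule equal_transfer_peel[OF L n g E H b' a' fl(2)])
    then obtain G where G: "G 0 = H" "gauge_equivalent n m (\<lambda>k. a (Suc k)) (\<lambda>k. b (Suc k)) (\<lambda>k. C (Suc k))
        (\<lambda>k. a' (Suc k)) (\<lambda>k. b' (Suc k)) (\<lambda>k. C' (Suc k)) G"
      using Suc.IH[unfolded gauge_rigid_def, rule_format, OF layers_Suc[OF L(1)] layers_Suc[OF L(2)] dominant_Suc[OF D(1)] dominant_Suc[OF D(2)] S', of H] H
      by blast
    have "gauge_equivalent n (Suc m) a b C a' b' C' (case_nat g G)"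
      unfolding gauge_equivalent_def
    proof (intro conjI allI impI)
      fix k i
      show "0 < case_nat g G k i" "case_nat g G k (i + int n) = case_nat g G k i" if "k \<le> Suc m"
        using that G(2) g by (cases k; simp add: gauge_equivalent_def)+
      show "b' k i = b k i / (case_nat g G k i * case_nat g G (Suc k) i)" if "k < Suc m"
        using that G b' by (cases k) (simp_all add: gauge_equivalent_def)
      show "a' k i = a k i / (case_nat g G k i * case_nat g G (Suc k) (i - 1))" if "k < Suc m"
        using that G a' by (cases k) (simp_all add: gauge_equivalent_def)
      show "C k i = C' k i * (case_nat g G k i)\<^sup>2" if "k < Suc m"
        using that G fl(2) by (cases k) (simp_all add: gauge_equivalent_def)
    qed (use G in \<open>simp add: gauge_equivalent_def\<close>)
    then show "\<exists>G. G 0 = g \<and> gauge_equivalent n (Suc m) a b C a' b' C' G" by (intro exI[of _ "case_nat g G"]) simp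
  qed
qed

section \<open>Triviality of the gauge\<close>

definition layer_ratio :: "nat \<Rightarrow> (edge \<Rightarrow> real) \<Rightarrow> nat \<Rightarrow> real" where
  "layer_ratio n w k = ratio n (diagonal n w k) (straight n w k)"

lemma conductances_eqI:
  assumes "w \<in> conductances n m" "w' \<in> conductances n m"
    and "\<And>k i. k < m \<Longrightarrow> straight n w k i = straight n w' k i"
    and "\<And>k i. k < m \<Longrightarrow> diagonal n w k i = diagonal n w' k i"
  shows "w = w'"
proof (rule PiE_ext[OF assms(1,2)[unfolded conductances_def]])
  fix e assume "e \<in> edges n m"
  then consider k i where "e = Straight k i" "k < m" "0 \<le> i" "i < int n"
    | k i where "e = Diagonal k i" "k < m" "0 \<le> i" "i < int n" by (auto simp: edges_def)
  then show "w e = w' e"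
  proof cases
    case 1
    then show ?thesis using assms(3)[of k i] by (simp add: straight_def lift_def)
  next
    case 2
    then show ?thesis using assms(4)[of k i] by (simp add: diagonal_def lift_def)
  qed
qed

lemma (in strip) dominant_total_weight: "dominant m a b (total_weight m a b)"
  using a_pos[THEN less_imp_le] by (auto simp: dominant_def total_weight_def)

theorem sorted_same_response_unique:
  assumes n: "1 \<le> n" and m: "1 \<le> m" and w: "w \<in> conductances n m" "w' \<in> conductances n m"
    and same: "same_response n m w w'"
    and sorted: "\<And>k l. k \<le> l \<Longrightarrow> l < m \<Longrightarrow> layer_ratio n w l \<le> layer_ratio n w k"
      "\<And>k l. k \<le> l \<Longrightarrow> l < m \<Longrightarrow> layer_ratio n w' l \<le> layer_ratio n w' k"
  shows "w = w'"
proof -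
  interpret w: strip n m "diagonal n w" "straight n w" using strip_conductances[OF w(1) n m] .
  interpret w': strip n m "diagonal n w'" "straight n w'" using strip_conductances[OF w(2) n m] .
  define C where "C = total_weight m (diagonal n w) (straight n w)"
  define C' where "C' = total_weight m (diagonal n w') (straight n w')"
  have L: "layers n m (diagonal n w) (straight n w) C" "layers n m (diagonal n w') (straight n w') C'"
    unfolding C_def C'_def by (rule w.layers_total_weight w'.layers_total_weight)+
  have D: "dominant m (diagonal n w) (straight n w) C" "dominant m (diagonal n w') (straight n w') C'"
    unfolding C_def C'_def by (rule w.dominant_total_weight w'.dominant_total_weight)+
  have S: "sorted_layers n m (diagonal n w) (straight n w)" "sorted_layers n m (diagonal n w') (straight n w')"
    using sorted by (auto simp: sorted_layers_def layer_ratio_def)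
  define X :: "real set" where "X = {\<tau>. \<not> nonsingular n m (diagonal n w) (straight n w) \<tau>} \<union>
    {\<tau>. \<not> nonsingular n m (diagonal n w') (straight n w') \<tau>}"
  have "finite X" unfolding X_def by (intro finite_UnI finite_singular n)
  then have E: "equal_transfer n m (diagonal n w) (straight n w) C (diagonal n w') (straight n w') C' (\<lambda>i. 1)"
    unfolding equal_transfer_def C_def C'_def
    by (intro exI[of _ X] conjI allI impI ext)
      (use transfer_eq_real[OF n m w same] in \<open>auto simp: X_def\<close>)
  have "gauge_rigid n m" by (rule sorted_equal_transfer_gauge[OF n])
  from this[unfolded gauge_rigid_def, rule_format, OF L D S _ E]
  obtain G where G: "G 0 = (\<lambda>i. 1)" "gauge_equivalent n m (diagonal n w) (straight n w) C (diagonal n w') (straight n w') C' G"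
    by auto
  have Gm: "G m i = 1" for i using G(2) by (simp add: gauge_equivalent_def)
  have Gpos: "0 < G k i" and Gper: "G k (i + int n) = G k i" if "k \<le> m" for k i
    using G(2) that by (simp_all add: gauge_equivalent_def)
  have Geq: "straight n w' k i = straight n w k i / (G k i * G (Suc k) i)"
    "diagonal n w' k i = diagonal n w k i / (G k i * G (Suc k) (i - 1))" "C k i = C' k i * (G k i)\<^sup>2" if "k < m" for k i
    using G(2) that by (simp_all add: gauge_equivalent_def)
  \<comment> \<open>In both networks a vertex weight is the sum of the conductances at the vertex.
    Inserting the gauge relations into this sum for the primed network and dividing by
    \<open>G k i\<close> gives harmonicity of \<open>1 / G\<close> in the unprimed one, so the
    reciprocal of the gauge is compared with the constant 1.\<close>
  define h where "h = (\<lambda>k i. 1 / G k i)"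
  have "w.harmonic h"
    unfolding w.harmonic_def
  proof (intro allI impI)
    fix k i assume k: "0 < k" "k < m"
    then obtain l where l: "k = Suc l" by (cases k) auto
    have p: "0 < G k i" "0 < G (Suc k) i" "0 < G (Suc k) (i - 1)" "0 < G l i" "0 < G l (i + 1)"
      using Gpos k l by auto
    have "C k i = (diagonal n w' k i + straight n w' k i + straight n w' l i + diagonal n w' l (i + 1)) * (G k i)\<^sup>2"
      using Geq(3)[OF k(2), of i] k l by (simp add: C'_def total_weight_def)
    also have "\<dots> = G k i * (diagonal n w k i / G (Suc k) (i - 1) + straight n w k i / G (Suc k) i +
       straight n w l i / G l i + diagonal n w l (i + 1) / G l (i + 1))"
    proof -
      have "diagonal n w' k i * (G k i)\<^sup>2 = G k i * (diagonal n w k i / G (Suc k) (i - 1))"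
        "straight n w' k i * (G k i)\<^sup>2 = G k i * (straight n w k i / G (Suc k) i)"
        using Geq(1,2)[OF k(2), of i] p by (simp_all add: power2_eq_square)
      moreover have "straight n w' l i * (G k i)\<^sup>2 = G k i * (straight n w l i / G l i)"
        "diagonal n w' l (i + 1) * (G k i)\<^sup>2 = G k i * (diagonal n w l (i + 1) / G l (i + 1))"
        using Geq(1)[of l i] Geq(2)[of l "i + 1"] k l p by (simp_all add: power2_eq_square)
      ultimately show ?thesis by (simp only: distrib_right distrib_left)
    qed
    finally have "C k i / G k i = diagonal n w k i / G (Suc k) (i - 1) + straight n w k i / G (Suc k) i +
       straight n w l i / G l i + diagonal n w l (i + 1) / G l (i + 1)" using p by simp
    then show "w.current h k i = 0"
      using k l by (simp add: out_current_interior degree4_def neighbour_sum_def h_def C_def total_weight_def add_divide_distrib algebra_simps)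
  qed
  moreover have "w.harmonic (\<lambda>k i. 1 :: real)" by (simp add: w.harmonic_def)
  moreover have "\<exists>M. \<forall>k i. k \<le> m \<longrightarrow> norm (h k i) \<le> M"
    by (rule periodic_bounded[OF n]) (simp add: h_def Gper)
  then obtain M where "\<And>k i. k \<le> m \<Longrightarrow> norm (h k i) \<le> M" by blast
  moreover have "h k i = 1" if "k \<in> {0, m}" for k i using that G(1) Gm by (auto simp: h_def)
  ultimately have "h k i = 1" if "k \<le> m" for k i
    using w.harmonic_unique[of h "\<lambda>k i. 1" M 1 k i] that by simp
  then have G1: "G k i = 1" if "k \<le> m" for k i using that Gpos[OF that, of i] by (simp add: h_def)
  show ?thesis
    by (rule conductances_eqI[OF w]) (use Geq(1,2) G1 in auto)
qed

section \<open>The electrical R-matrix\<close>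

definition middle_weight :: "(int \<Rightarrow> real) \<Rightarrow> (int \<Rightarrow> real) \<Rightarrow> (int \<Rightarrow> real) \<Rightarrow> (int \<Rightarrow> real) \<Rightarrow> int \<Rightarrow> real" where
  "middle_weight a b c d k = a (k + 1) + b k + c (k + 1) + d k"

text \<open>The star-mesh transformation: eliminating middle vertex \<open>k\<close> joins any two
  of its four neighbours by an edge whose conductance is the product of the two removed ones over
  \<open>middle_weight\<close>. In the last clause two parallel edges arise, from middle vertices
  \<open>k\<close> and \<open>k - 1\<close>, so only their sum can be compared.\<close>

definition star_equivalent ::
  "(int \<Rightarrow> real) \<Rightarrow> (int \<Rightarrow> real) \<Rightarrow> (int \<Rightarrow> real) \<Rightarrow> (int \<Rightarrow> real) \<Rightarrow>
   (int \<Rightarrow> real) \<Rightarrow> (int \<Rightarrow> real) \<Rightarrow> (int \<Rightarrow> real) \<Rightarrow> (int \<Rightarrow> real) \<Rightarrow> bool" where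
  "star_equivalent a b c d a' b' c' d' \<longleftrightarrow> (\<forall>k.
     a' (k + 1) * b' k / middle_weight a' b' c' d' k = a (k + 1) * b k / middle_weight a b c d k \<and>
     c' (k + 1) * d' k / middle_weight a' b' c' d' k = c (k + 1) * d k / middle_weight a b c d k \<and>
     b' k * c' (k + 1) / middle_weight a' b' c' d' k = b k * c (k + 1) / middle_weight a b c d k \<and>
     a' (k + 1) * d' k / middle_weight a' b' c' d' k = a (k + 1) * d k / middle_weight a b c d k \<and>
     b' k * d' k / middle_weight a' b' c' d' k + a' k * c' k / middle_weight a' b' c' d' (k - 1) =
       b k * d k / middle_weight a b c d k + a k * c k / middle_weight a b c d (k - 1))"

definition middle_value :: "(int \<Rightarrow> real) \<Rightarrow> (int \<Rightarrow> real) \<Rightarrow> (int \<Rightarrow> real) \<Rightarrow> (int \<Rightarrow> real) \<Rightarrow>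
    (int \<Rightarrow> real) \<Rightarrow> (int \<Rightarrow> real) \<Rightarrow> int \<Rightarrow> real" where
  "middle_value a b c d p q k = (b k * p k + a (k + 1) * p (k + 1) + c (k + 1) * q k + d k * q (k - 1)) / middle_weight a b c d k"

text \<open>Star-mesh at the level of currents: once the middle potential is eliminated, the
  coefficients are the quantities compared in \<open>star_equivalent\<close>.\<close>

lemma left_current_eq:
  assumes "\<And>k. 0 < middle_weight a b c d k"
  shows "b k * (p k - middle_value a b c d p q k) + a k * (p k - middle_value a b c d p q (k - 1)) =
    a (k + 1) * b k / middle_weight a b c d k * (p k - p (k + 1)) + b k * c (k + 1) / middle_weight a b c d k * (p k - q k) +
    (b k * d k / middle_weight a b c d k + a k * c k / middle_weight a b c d (k - 1)) * (p k - q (k - 1)) +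
    a k * b (k - 1) / middle_weight a b c d (k - 1) * (p k - p (k - 1)) + a k * d (k - 1) / middle_weight a b c d (k - 1) * (p k - q (k - 2))"
proof -
  define S T where "S = middle_weight a b c d k" and "T = middle_weight a b c d (k - 1)"
  have pos: "0 < S" "0 < T" using assms by (auto simp: S_def T_def)
  have S: "S = a (k + 1) + b k + c (k + 1) + d k" and T: "T = a k + b (k - 1) + c k + d (k - 1)"
    by (simp_all add: S_def T_def middle_weight_def)
  have 1: "b k * (p k - middle_value a b c d p q k) =
    (a (k + 1) * b k * (p k - p (k + 1)) + b k * c (k + 1) * (p k - q k) + b k * d k * (p k - q (k - 1))) / S"
    using pos unfolding middle_value_def S_def[symmetric] by (simp add: field_simps) (simp add: S algebra_simps)
  have 2: "a k * (p k - middle_value a b c d p q (k - 1)) =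
    (a k * b (k - 1) * (p k - p (k - 1)) + a k * c k * (p k - q (k - 1)) + a k * d (k - 1) * (p k - q (k - 2))) / T"
    using pos unfolding middle_value_def T_def[symmetric] by (simp add: field_simps) (simp add: T algebra_simps)
  show ?thesis unfolding 1 2 S_def[symmetric] T_def[symmetric]
    by (simp add: add_divide_distrib diff_divide_distrib algebra_simps)
qed

lemma right_current_eq:
  assumes "\<And>k. 0 < middle_weight a b c d k"
  shows "c (k + 1) * (q k - middle_value a b c d p q k) + d (k + 1) * (q k - middle_value a b c d p q (k + 1)) =
    b k * c (k + 1) / middle_weight a b c d k * (q k - p k) + c (k + 1) * d k / middle_weight a b c d k * (q k - q (k - 1)) +
    (b (k + 1) * d (k + 1) / middle_weight a b c d (k + 1) + a (k + 1) * c (k + 1) / middle_weight a b c d k) * (q k - p (k + 1)) +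
    a (k + 2) * d (k + 1) / middle_weight a b c d (k + 1) * (q k - p (k + 2)) + c (k + 2) * d (k + 1) / middle_weight a b c d (k + 1) * (q k - q (k + 1))"
proof -
  define S T where "S = middle_weight a b c d k" and "T = middle_weight a b c d (k + 1)"
  have pos: "0 < S" "0 < T" using assms by (auto simp: S_def T_def)
  have S: "S = a (k + 1) + b k + c (k + 1) + d k" and T: "T = a (k + 2) + b (k + 1) + c (k + 2) + d (k + 1)"
    by (simp_all add: S_def T_def middle_weight_def add.assoc)
  have 1: "c (k + 1) * (q k - middle_value a b c d p q k) =
    (b k * c (k + 1) * (q k - p k) + a (k + 1) * c (k + 1) * (q k - p (k + 1)) + c (k + 1) * d k * (q k - q (k - 1))) / S"
    using pos unfolding middle_value_def S_def[symmetric] by (simp add: field_simps) (simp add: S algebra_simps)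
  have 2: "d (k + 1) * (q k - middle_value a b c d p q (k + 1)) =
    (b (k + 1) * d (k + 1) * (q k - p (k + 1)) + a (k + 2) * d (k + 1) * (q k - p (k + 2)) + c (k + 2) * d (k + 1) * (q k - q (k + 1))) / T"
    using pos unfolding middle_value_def T_def[symmetric] by (simp add: field_simps add.assoc) (simp add: T algebra_simps)
  show ?thesis unfolding 1 2 S_def[symmetric] T_def[symmetric]
    by (simp add: add_divide_distrib diff_divide_distrib algebra_simps)
qed

lemma star_equivalent_currents:
  assumes "star_equivalent a b c d a' b' c' d'" "\<And>k. 0 < middle_weight a b c d k" "\<And>k. 0 < middle_weight a' b' c' d' k"
  shows "b' k * (p k - middle_value a' b' c' d' p q k) + a' k * (p k - middle_value a' b' c' d' p q (k - 1)) =
      b k * (p k - middle_value a b c d p q k) + a k * (p k - middle_value a b c d p q (k - 1))"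
    and "c' (k + 1) * (q k - middle_value a' b' c' d' p q k) + d' (k + 1) * (q k - middle_value a' b' c' d' p q (k + 1)) =
      c (k + 1) * (q k - middle_value a b c d p q k) + d (k + 1) * (q k - middle_value a b c d p q (k + 1))"
proof -
  have e: "a' (k + 1) * b' k / middle_weight a' b' c' d' k = a (k + 1) * b k / middle_weight a b c d k"
    "c' (k + 1) * d' k / middle_weight a' b' c' d' k = c (k + 1) * d k / middle_weight a b c d k"
    "b' k * c' (k + 1) / middle_weight a' b' c' d' k = b k * c (k + 1) / middle_weight a b c d k"
    "a' (k + 1) * d' k / middle_weight a' b' c' d' k = a (k + 1) * d k / middle_weight a b c d k"
    "b' k * d' k / middle_weight a' b' c' d' k + a' k * c' k / middle_weight a' b' c' d' (k - 1) =
       b k * d k / middle_weight a b c d k + a k * c k / middle_weight a b c d (k - 1)" for k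
    using assms(1) unfolding star_equivalent_def by blast+
  have e': "a' k * b' (k - 1) / middle_weight a' b' c' d' (k - 1) = a k * b (k - 1) / middle_weight a b c d (k - 1)"
    "a' k * d' (k - 1) / middle_weight a' b' c' d' (k - 1) = a k * d (k - 1) / middle_weight a b c d (k - 1)" for k
    using e(1)[of "k - 1"] e(4)[of "k - 1"] by simp_all
  have e'': "a' (k + 2) * d' (k + 1) / middle_weight a' b' c' d' (k + 1) = a (k + 2) * d (k + 1) / middle_weight a b c d (k + 1)"
     "c' (k + 2) * d' (k + 1) / middle_weight a' b' c' d' (k + 1) = c (k + 2) * d (k + 1) / middle_weight a b c d (k + 1)"
     "b' (k + 1) * d' (k + 1) / middle_weight a' b' c' d' (k + 1) + a' (k + 1) * c' (k + 1) / middle_weight a' b' c' d' k =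
       b (k + 1) * d (k + 1) / middle_weight a b c d (k + 1) + a (k + 1) * c (k + 1) / middle_weight a b c d k" for k
    using e(4)[of "k + 1"] e(2)[of "k + 1"] e(5)[of "k + 1"] by (simp_all add: add.assoc)
  show "b' k * (p k - middle_value a' b' c' d' p q k) + a' k * (p k - middle_value a' b' c' d' p q (k - 1)) =
      b k * (p k - middle_value a b c d p q k) + a k * (p k - middle_value a b c d p q (k - 1))"
    unfolding left_current_eq[of a b c d, OF assms(2)] left_current_eq[of a' b' c' d', OF assms(3)] e e' ..
  show "c' (k + 1) * (q k - middle_value a' b' c' d' p q k) + d' (k + 1) * (q k - middle_value a' b' c' d' p q (k + 1)) =
      c (k + 1) * (q k - middle_value a b c d p q k) + d (k + 1) * (q k - middle_value a b c d p q (k + 1))"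
    unfolding right_current_eq[of a b c d, OF assms(2)] right_current_eq[of a' b' c' d', OF assms(3)] e e'' ..
qed

text \<open>A weighted average with positive weights; this keeps the modified potential bounded in
  \<open>R_matrix_same_response\<close>.\<close>

lemma middle_value_bound:
  assumes "\<And>k. 0 < a k" "\<And>k. 0 < b k" "\<And>k. 0 < c k" "\<And>k. 0 < d k" "\<And>k. \<bar>p k\<bar> \<le> M" "\<And>k. \<bar>q k\<bar> \<le> M"
  shows "\<bar>middle_value a b c d p q k\<bar> \<le> M"
proof -
  have S: "0 < middle_weight a b c d k" using assms(1-4) by (simp add: middle_weight_def add_pos_pos)
  have t: "\<bar>x * y\<bar> \<le> x * M" if "0 < x" "\<bar>y\<bar> \<le> M" for x y :: real
    using that by (simp add: abs_mult)
  have "\<bar>b k * p k + a (k + 1) * p (k + 1) + c (k + 1) * q k + d k * q (k - 1)\<bar> \<le>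
    \<bar>b k * p k\<bar> + \<bar>a (k + 1) * p (k + 1)\<bar> + \<bar>c (k + 1) * q k\<bar> + \<bar>d k * q (k - 1)\<bar>" by linarith
  also have "\<dots> \<le> b k * M + a (k + 1) * M + c (k + 1) * M + d k * M"
    using assms by (intro add_mono t) auto
  also have "\<dots> = M * middle_weight a b c d k" by (simp add: middle_weight_def algebra_simps)
  finally show ?thesis using S by (simp add: middle_value_def pos_divide_le_eq)
qed

section \<open>The formulas for \<open>kappa\<close> and \<open>tau\<close>\<close>

lemma prod_int_interval:
  fixes f :: "int \<Rightarrow> 'a::comm_monoid_mult"
  shows "(\<Prod>k\<in>{i..i + int J - 1}. f k) = (\<Prod>l<J. f (i + int l))"
proof -
  have "(\<lambda>l. i + int l) ` {..<J} = {i..i + int J - 1}"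
  proof (intro equalityI subsetI)
    fix x assume "x \<in> {i..i + int J - 1}"
    then show "x \<in> (\<lambda>l. i + int l) ` {..<J}" by (intro image_eqI[of _ _ "nat (x - i)"]) auto
  qed auto
  moreover have "inj_on (\<lambda>l. i + int l) {..<J}" by (auto intro: inj_onI)
  ultimately show ?thesis using prod.reindex[of "\<lambda>l. i + int l" "{..<J}" f] by simp
qed

lemma sum_int_interval:
  fixes f :: "int \<Rightarrow> 'a::comm_monoid_add"
  shows "(\<Sum>k\<in>{i..i + int J - 1}. f k) = (\<Sum>l<J. f (i + int l))"
proof -
  have "(\<lambda>l. i + int l) ` {..<J} = {i..i + int J - 1}"
  proof (intro equalityI subsetI)
    fix x assume "x \<in> {i..i + int J - 1}"
    then show "x \<in> (\<lambda>l. i + int l) ` {..<J}" by (intro image_eqI[of _ _ "nat (x - i)"]) auto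
  qed auto
  moreover have "inj_on (\<lambda>l. i + int l) {..<J}" by (auto intro: inj_onI)
  ultimately show ?thesis using sum.reindex[of "\<lambda>l. i + int l" "{..<J}" f] by simp
qed

locale two_layers =
  fixes n :: nat and a b c d :: "int \<Rightarrow> real"
  assumes n: "1 \<le> n"
    and pos: "0 < a k" "0 < b k" "0 < c k" "0 < d k"
    and per: "a (k + int n) = a k" "b (k + int n) = b k" "c (k + int n) = c k" "d (k + int n) = d k"
begin

definition "pA i J = (\<Prod>l<J. a (i + int l) * c (i + int l))"
definition "pB i J = (\<Prod>l<J. b (i + int l) * d (i + int l))"

lemma pA_Suc: "pA i (Suc J) = a i * c i * pA (i + 1) J"
  unfolding pA_def by (simp only: prod.lessThan_Suc_shift) (simp add: algebra_simps)

lemma pB_Suc: "pB i (Suc J) = pB i J * (b (i + int J) * d (i + int J))"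
  unfolding pB_def by simp

lemma pA_pos: "0 < pA i J" and pB_pos: "0 < pB i J"
  unfolding pA_def pB_def using pos by (auto intro!: prod_pos)

lemma pA_full: "pA i n = pA 0 n" and pB_full: "pB i n = pB 0 n"
  unfolding pA_def pB_def
  using prod_periodic_shift[of "\<lambda>i. a i * c i" n i] prod_periodic_shift[of "\<lambda>i. b i * d i" n i] per by simp_all

lemma tau_eq:
  "tau n a b c d i = (\<Sum>J<n. (a (i + int J) + c (i + int J)) * pA i J * pB (i + int J) (n - J) +
     (b (i + int J) + d (i + int J)) * pA i (Suc J) * pB (i + int J + 1) (n - Suc J))"
proof -
  have "tau n a b c d i = (\<Sum>j\<in>{0..0 + int n - 1}.
      (a (i + j) + c (i + j)) * (\<Prod>k\<in>{i..i + j - 1}. a k * c k) * (\<Prod>k\<in>{i + j..i + int n - 1}. b k * d k) +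
      (b (i + j) + d (i + j)) * (\<Prod>k\<in>{i..i + j}. a k * c k) * (\<Prod>k\<in>{i + j + 1..i + int n - 1}. b k * d k))"
    by (simp add: tau_def)
  also have "\<dots> = (\<Sum>J<n. (a (i + int J) + c (i + int J)) * pA i J * pB (i + int J) (n - J) +
     (b (i + int J) + d (i + int J)) * pA i (Suc J) * pB (i + int J + 1) (n - Suc J))"
    unfolding sum_int_interval
  proof (intro sum.cong refl)
    fix J assume "J \<in> {..<n}"
    then have J: "J < n" by simp
    have e: "{i..i + (0 + int J) - 1} = {i..i + int J - 1}" "{i..i + (0 + int J)} = {i..i + int (Suc J) - 1}"
      "{i + (0 + int J)..i + int n - 1} = {i + int J..(i + int J) + int (n - J) - 1}"
      "{i + (0 + int J) + 1..i + int n - 1} = {i + int J + 1..(i + int J + 1) + int (n - Suc J) - 1}"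
      using J by auto
    show "(a (i + (0 + int J)) + c (i + (0 + int J))) * (\<Prod>k\<in>{i..i + (0 + int J) - 1}. a k * c k) * (\<Prod>k\<in>{i + (0 + int J)..i + int n - 1}. b k * d k) +
      (b (i + (0 + int J)) + d (i + (0 + int J))) * (\<Prod>k\<in>{i..i + (0 + int J)}. a k * c k) * (\<Prod>k\<in>{i + (0 + int J) + 1..i + int n - 1}. b k * d k) =
      (a (i + int J) + c (i + int J)) * pA i J * pB (i + int J) (n - J) +
     (b (i + int J) + d (i + int J)) * pA i (Suc J) * pB (i + int J + 1) (n - Suc J)"
      unfolding e prod_int_interval pA_def pB_def by simp
  qed
  finally show ?thesis .
qed

text \<open>Regrouped by middle vertices: the term with \<open>a + c\<close> at index
  \<open>i + J + 1\<close> and the term with \<open>b + d\<close> at \<open>i + J\<close> carry the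
  same products and add up to a full \<open>middle_weight\<close>. The isolated term with
  \<open>a i + c i\<close> belongs to \<open>J = n - 1\<close> by periodicity.\<close>

lemma kappa_eq:
  "kappa n a b c d i = (\<Sum>J<n. middle_weight a b c d (i + int J) * pA (i + 1) J * pB (i + int J + 1) (n - Suc J))"
proof -
  obtain p where p: "n = Suc p" using n by (cases n) auto
  have e0: "{i + 1..i + int n - 1} = {i + 1..(i + 1) + int p - 1}" by (auto simp: p)
  have s0: "{1..int n - 1} = {1..1 + int p - 1}" by (auto simp: p)
  define x y where "x = (\<lambda>k. a k + c k)" and "y = (\<lambda>k. b k + d k)"
  have "kappa n a b c d i = x i * pA (i + 1) p + y i * pB (i + 1) p +
    (\<Sum>J<p. x (i + int (Suc J)) * pA (i + 1) J * pB (i + int (Suc J)) (n - Suc J) +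
       y (i + int (Suc J)) * pA (i + 1) (Suc J) * pB (i + int (Suc J) + 1) (n - Suc (Suc J)))"
  proof -
    have "(\<Sum>j\<in>{1..int n - 1}.
        (a (i + j) + c (i + j)) * (\<Prod>k\<in>{i + 1..i + j - 1}. a k * c k) * (\<Prod>k\<in>{i + j..i + int n - 1}. b k * d k) +
        (b (i + j) + d (i + j)) * (\<Prod>k\<in>{i + 1..i + j}. a k * c k) * (\<Prod>k\<in>{i + j + 1..i + int n - 1}. b k * d k)) =
      (\<Sum>J<p. x (i + int (Suc J)) * pA (i + 1) J * pB (i + int (Suc J)) (n - Suc J) +
       y (i + int (Suc J)) * pA (i + 1) (Suc J) * pB (i + int (Suc J) + 1) (n - Suc (Suc J)))"
      unfolding s0 sum_int_interval
    proof (intro sum.cong refl)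
      fix J assume "J \<in> {..<p}"
      then have J: "J < p" by simp
      have e: "{i + 1..i + (1 + int J) - 1} = {i + 1..(i + 1) + int J - 1}" "{i + 1..i + (1 + int J)} = {i + 1..(i + 1) + int (Suc J) - 1}"
        "{i + (1 + int J)..i + int n - 1} = {i + int (Suc J)..(i + int (Suc J)) + int (n - Suc J) - 1}"
        "{i + (1 + int J) + 1..i + int n - 1} = {i + int (Suc J) + 1..(i + int (Suc J) + 1) + int (n - Suc (Suc J)) - 1}"
        "i + (1 + int J) = i + int (Suc J)"
        using J p by auto
      show "(a (i + (1 + int J)) + c (i + (1 + int J))) * (\<Prod>k\<in>{i + 1..i + (1 + int J) - 1}. a k * c k) * (\<Prod>k\<in>{i + (1 + int J)..i + int n - 1}. b k * d k) +
        (b (i + (1 + int J)) + d (i + (1 + int J))) * (\<Prod>k\<in>{i + 1..i + (1 + int J)}. a k * c k) * (\<Prod>k\<in>{i + (1 + int J) + 1..i + int n - 1}. b k * d k) =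
        x (i + int (Suc J)) * pA (i + 1) J * pB (i + int (Suc J)) (n - Suc J) +
        y (i + int (Suc J)) * pA (i + 1) (Suc J) * pB (i + int (Suc J) + 1) (n - Suc (Suc J))"
        unfolding e(1-4) prod_int_interval unfolding e(5) pA_def pB_def x_def y_def by simp
    qed
    then show ?thesis
      unfolding kappa_def e0 prod_int_interval by (simp add: x_def y_def pA_def pB_def)
  qed
  also have "\<dots> = (\<Sum>J<n. y (i + int J) * pA (i + 1) J * pB (i + int J + 1) (n - Suc J)) +
     (\<Sum>J<n. x (i + int J + 1) * pA (i + 1) J * pB (i + int J + 1) (n - Suc J))"
  proof -
    have "(\<Sum>J<n. y (i + int J) * pA (i + 1) J * pB (i + int J + 1) (n - Suc J)) =
      y i * pB (i + 1) p + (\<Sum>J<p. y (i + int (Suc J)) * pA (i + 1) (Suc J) * pB (i + int (Suc J) + 1) (n - Suc (Suc J)))"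
      unfolding p by (subst sum.lessThan_Suc_shift) (simp add: pA_def)
    moreover have "x (i + int p + 1) = x i" using per(1,3)[of i] by (simp add: x_def p algebra_simps)
    then have "(\<Sum>J<n. x (i + int J + 1) * pA (i + 1) J * pB (i + int J + 1) (n - Suc J)) =
      (\<Sum>J<p. x (i + int (Suc J)) * pA (i + 1) J * pB (i + int (Suc J)) (n - Suc J)) + x i * pA (i + 1) p"
      by (simp add: p pB_def algebra_simps)
    ultimately show ?thesis by (simp add: sum.distrib)
  qed
  also have "\<dots> = (\<Sum>J<n. middle_weight a b c d (i + int J) * pA (i + 1) J * pB (i + int J + 1) (n - Suc J))"
    by (simp add: sum.distrib[symmetric] middle_weight_def x_def y_def algebra_simps)
  finally show ?thesis .
qed

abbreviation "\<kappa> \<equiv> kappa n a b c d"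
abbreviation "\<tau> \<equiv> tau n a b c d"
abbreviation "S \<equiv> middle_weight a b c d"

lemma S_pos: "0 < S k" using pos by (simp add: middle_weight_def add_pos_pos)

lemma kappa_pos: "0 < \<kappa> i"
  unfolding kappa_eq using n pA_pos pB_pos S_pos by (intro sum_pos mult_pos_pos) (auto simp: lessThan_empty_iff)

lemma tau_pos: "0 < \<tau> i"
  unfolding tau_eq using n pA_pos pB_pos pos by (intro sum_pos add_pos_pos mult_pos_pos) (auto simp: lessThan_empty_iff)

definition "flux = pA 0 n - pB 0 n"

text \<open>Rescaling the conductances at the middle vertices with quotients given by a periodic \<open>\<kappa>\<close>
  preserves the network obtained by eliminating the middle column iff the left-hand side divided by
  \<open>S i\<close> does not depend on \<open>i\<close>; the formula for \<open>\<kappa>\<close> solves this recursion.\<close>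

lemma kappa_rec: "a (i + 1) * c (i + 1) * \<kappa> (i + 1) - b i * d i * \<kappa> i = flux * S i"
  and tau_kappa: "\<tau> (i + 1) = b i * d i * \<kappa> i + (b i + d i) * flux"
proof -
  \<comment> \<open>Both \<open>b i * d i * \<kappa> i\<close> and
    \<open>a (i + 1) * c (i + 1) * \<kappa> (i + 1)\<close> become sums of \<open>S\<close> times
    \<open>Q\<close>, the latter shifted by one index, so their difference telescopes to the end
    terms of a full period.\<close>
  define Q where "Q = (\<lambda>J. pA (i + 1) J * pB (i + int J + 1) (n - J))"
  have Q0: "Q 0 = pB 0 n" using pB_full by (simp add: Q_def pA_def)
  have Qn: "Q n = pA 0 n" using pA_full by (simp add: Q_def pB_def)
  have Bi: "b (i + int n) * d (i + int n) = b i * d i" using per by simp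
  have QB: "pA (i + 1) J * pB (i + int J + 1) (n - Suc J) * (b i * d i) = Q J" if "J < n" for J
  proof -
    have "n - J = Suc (n - Suc J)" "i + int J + 1 + int (n - Suc J) = i + int n" using that by auto
    then show ?thesis using Bi by (simp add: Q_def pB_Suc)
  qed
  have QA: "a (i + 1) * c (i + 1) * pA (i + 1 + 1) J * pB (i + 1 + int J + 1) (n - Suc J) = Q (Suc J)" for J
    by (simp add: Q_def pA_Suc algebra_simps)
  have Sn: "S (i + int n) = S i" using per(1,3)[of "i + 1"] per(2,4)[of i] by (simp add: middle_weight_def algebra_simps)
  have Bk: "b i * d i * \<kappa> i = (\<Sum>J<n. S (i + int J) * Q J)"
    unfolding kappa_eq sum_distrib_left by (intro sum.cong refl) (simp add: QB[symmetric])
  have Ak: "a (i + 1) * c (i + 1) * \<kappa> (i + 1) = (\<Sum>J<n. S (i + int (Suc J)) * Q (Suc J))"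
    unfolding kappa_eq sum_distrib_left by (intro sum.cong refl) (simp add: QA[symmetric] algebra_simps)
  have "a (i + 1) * c (i + 1) * \<kappa> (i + 1) - b i * d i * \<kappa> i = (\<Sum>J<n. S (i + int (Suc J)) * Q (Suc J) - S (i + int J) * Q J)"
    unfolding Ak Bk by (simp add: sum_subtractf)
  also have "\<dots> = S (i + int n) * Q n - S i * Q 0"
    using sum_lessThan_telescope[of "\<lambda>J. S (i + int J) * Q J" n] by simp
  finally show "a (i + 1) * c (i + 1) * \<kappa> (i + 1) - b i * d i * \<kappa> i = flux * S i"
    by (simp add: Sn Q0 Qn flux_def algebra_simps)
  define y where "y = (\<lambda>k. b k + d k)"
  have yn: "y (i + int n) = y i" using per by (simp add: y_def)
  have "\<tau> (i + 1) = (\<Sum>J<n. (a (i + int J + 1) + c (i + int J + 1)) * Q J + y (i + int (Suc J)) * Q (Suc J))"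
    unfolding tau_eq
    by (intro sum.cong refl) (simp add: QA[symmetric] pA_Suc Q_def y_def algebra_simps)
  also have "\<dots> = (\<Sum>J<n. S (i + int J) * Q J) + (\<Sum>J<n. y (i + int (Suc J)) * Q (Suc J) - y (i + int J) * Q J)"
    by (simp add: sum.distrib[symmetric] middle_weight_def y_def algebra_simps)
  also have "(\<Sum>J<n. y (i + int (Suc J)) * Q (Suc J) - y (i + int J) * Q J) = y (i + int n) * Q n - y i * Q 0"
    using sum_lessThan_telescope[of "\<lambda>J. y (i + int J) * Q J" n] by simp
  finally have "\<tau> (i + 1) = b i * d i * \<kappa> i + (y i * pA 0 n - y i * pB 0 n)"
    by (simp only: Bk yn Q0 Qn)
  then show "\<tau> (i + 1) = b i * d i * \<kappa> i + (b i + d i) * flux"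
    by (simp add: flux_def y_def algebra_simps)
qed

definition "a' k = \<tau> k / (c k * \<kappa> k)"
definition "b' k = \<tau> (k + 1) / (d k * \<kappa> k)"
definition "c' k = \<tau> k / (a k * \<kappa> k)"
definition "d' k = \<tau> (k + 1) / (b k * \<kappa> k)"

lemma kappa_per: "\<kappa> (k + int n) = \<kappa> k"
proof -
  have s: "f (k + int n + l) = f (k + l)" if "\<And>k. f (k + int n) = f k" for f :: "int \<Rightarrow> real" and l
    using that[of "k + l"] by (simp add: algebra_simps)
  have Sp: "S (k + int n) = S k" for k using per(1,3)[of "k + 1"] per(2,4)[of k] by (simp add: middle_weight_def algebra_simps)
  have "pA (k + int n + l) J = pA (k + l) J" "pB (k + int n + l) J = pB (k + l) J" for l J
    unfolding pA_def pB_def using s[of a] s[of b] s[of c] s[of d] per by (simp_all add: add.assoc)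
  then show ?thesis unfolding kappa_eq using s[of S, OF Sp] by (simp add: add.assoc)
qed

lemma tau_per: "\<tau> (k + int n) = \<tau> k"
proof -
  have "\<tau> ((k - 1 + int n) + 1) = \<tau> (k - 1 + 1)"
    unfolding tau_kappa by (simp only: kappa_per per)
  then show ?thesis by (simp add: algebra_simps)
qed

lemma two_layers_R: "two_layers n a' b' c' d'"
proof
  have "\<tau> (k + int n + 1) = \<tau> (k + 1)" for k using tau_per[of "k + 1"] by (simp add: algebra_simps)
  then show "a' (k + int n) = a' k" "b' (k + int n) = b' k" "c' (k + int n) = c' k" "d' (k + int n) = d' k" for k
    by (simp_all add: a'_def b'_def c'_def d'_def tau_per kappa_per per)
qed (use n pos tau_pos kappa_pos in \<open>auto simp: a'_def b'_def c'_def d'_def\<close>)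

text \<open>The R-matrix multiplies \<open>a k\<close>, \<open>c k\<close> by \<open>\<nu> k\<close>
  and \<open>b k\<close>, \<open>d k\<close> by \<open>\<mu> k\<close>. The four invariants with
  mixed products hold once the middle weight is multiplied by
  \<open>\<nu> (k + 1) * \<mu> k\<close>. In the fifth, the two parallel edges change by
  \<open>flux / \<kappa> k\<close> with opposite signs.\<close>

lemma star_equivalent_R: "star_equivalent a b c d a' b' c' d'"
proof -
  define \<nu> \<mu> where "\<nu> = (\<lambda>k. \<tau> k / (a k * c k * \<kappa> k))" and "\<mu> = (\<lambda>k. \<tau> (k + 1) / (b k * d k * \<kappa> k))"
  have lm: "0 < \<nu> k" "0 < \<mu> k" for k using pos tau_pos kappa_pos by (auto simp: \<nu>_def \<mu>_def)
  have p0: "a k \<noteq> 0" "b k \<noteq> 0" "c k \<noteq> 0" "d k \<noteq> 0" "\<kappa> k \<noteq> 0" "\<tau> k \<noteq> 0" "S k \<noteq> 0" for k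
    using pos[of k] kappa_pos[of k] tau_pos[of k] S_pos[of k] by auto
  have sc: "a' k = \<nu> k * a k" "c' k = \<nu> k * c k" "b' k = \<mu> k * b k" "d' k = \<mu> k * d k" for k
    using p0 by (simp_all add: a'_def b'_def c'_def d'_def \<nu>_def \<mu>_def)
  \<comment> \<open>Both recursions combined; in this form the new middle weight factors.\<close>
  have tS: "\<tau> (k + 1) * S k = (a (k + 1) + c (k + 1)) * (b k * d k * \<kappa> k) + (b k + d k) * (a (k + 1) * c (k + 1) * \<kappa> (k + 1))" for k
  proof -
    have "a (k + 1) * c (k + 1) * \<kappa> (k + 1) = b k * d k * \<kappa> k + flux * S k" using kappa_rec[of k] by simp
    then show ?thesis unfolding tau_kappa by (simp add: middle_weight_def algebra_simps)
  qed
  have S': "middle_weight a' b' c' d' k = \<nu> (k + 1) * \<mu> k * S k" for k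
  proof -
    have "\<nu> (k + 1) * \<mu> k * S k = \<tau> (k + 1) * (\<tau> (k + 1) * S k) / (a (k + 1) * c (k + 1) * \<kappa> (k + 1) * (b k * d k * \<kappa> k))"
      by (simp add: \<nu>_def \<mu>_def)
    also have "\<dots> = \<nu> (k + 1) * (a (k + 1) + c (k + 1)) + \<mu> k * (b k + d k)"
      unfolding tS using p0 by (simp add: \<nu>_def \<mu>_def field_simps)
    finally show ?thesis by (simp add: middle_weight_def sc algebra_simps)
  qed
  have main: "\<mu> k * b k * (\<mu> k * d k) / (\<nu> (k + 1) * \<mu> k * S k) + \<nu> k * a k * (\<nu> k * c k) / (\<nu> k * \<mu> (k - 1) * S (k - 1)) =
    b k * d k / S k + a k * c k / S (k - 1)" for k
  proof -
    have "\<mu> k * b k * (\<mu> k * d k) / (\<nu> (k + 1) * \<mu> k * S k) = a (k + 1) * c (k + 1) * \<kappa> (k + 1) / (\<kappa> k * S k)"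
      using p0 lm[of k] by (simp add: \<nu>_def \<mu>_def field_simps)
    also have "\<dots> = (b k * d k * \<kappa> k + flux * S k) / (\<kappa> k * S k)" using kappa_rec[of k] by (simp add: algebra_simps)
    also have "\<dots> = b k * d k / S k + flux / \<kappa> k" using p0 by (simp add: field_simps)
    finally have 1: "\<mu> k * b k * (\<mu> k * d k) / (\<nu> (k + 1) * \<mu> k * S k) = b k * d k / S k + flux / \<kappa> k" .
    have "\<nu> k * a k * (\<nu> k * c k) / (\<nu> k * \<mu> (k - 1) * S (k - 1)) = b (k - 1) * d (k - 1) * \<kappa> (k - 1) / (\<kappa> k * S (k - 1))"
      using p0 lm[of k] by (simp add: \<nu>_def \<mu>_def field_simps)
    also have "\<dots> = (a k * c k * \<kappa> k - flux * S (k - 1)) / (\<kappa> k * S (k - 1))" using kappa_rec[of "k - 1"] by (simp add: algebra_simps)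
    also have "\<dots> = a k * c k / S (k - 1) - flux / \<kappa> k" using p0 by (simp add: field_simps)
    finally show ?thesis using 1 by simp
  qed
  have nz: "\<nu> k \<noteq> 0" "\<mu> k \<noteq> 0" for k using lm[of k] by auto
  show ?thesis unfolding star_equivalent_def S' sc
  proof (intro allI conjI)
    fix k
    show "\<mu> k * b k * (\<mu> k * d k) / (\<nu> (k + 1) * \<mu> k * S k) + \<nu> k * a k * (\<nu> k * c k) / (\<nu> (k - 1 + 1) * \<mu> (k - 1) * S (k - 1)) =
      b k * d k / S k + a k * c k / S (k - 1)" using main[of k] by simp
  qed (use nz p0 in \<open>simp_all add: field_simps\<close>)
qed

text \<open>The factors \<open>\<kappa>\<close> cancel termwise and the quotients of consecutive
  \<open>\<tau>\<close> cancel around the period, which leaves the ratio of the opposite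
  layer.\<close>

lemma ratio_R: "ratio n a' b' = ratio n d c" "ratio n d' c' = ratio n a b"
proof -
  have T: "(\<Prod>l<n. \<tau> (int l + 1)) = (\<Prod>l<n. \<tau> (int l))"
    using prod_periodic_shift[of \<tau> n 1, OF tau_per] by (simp add: add.commute)
  have T0: "(\<Prod>l<n. \<tau> (int l)) \<noteq> 0" "(\<Prod>l<n. \<tau> (int l + 1)) \<noteq> 0" using tau_pos by (auto simp: less_imp_neq[THEN not_sym])
  have p0: "a k \<noteq> 0" "b k \<noteq> 0" "c k \<noteq> 0" "d k \<noteq> 0" "\<kappa> k \<noteq> 0" "\<tau> k \<noteq> 0" for k
    using pos[of k] kappa_pos[of k] tau_pos[of k] by auto
  have "ratio n a' b' = (\<Prod>l<n. \<tau> (int l) / \<tau> (int l + 1) * (d (int l) / c (int l)))"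
    unfolding ratio_def using p0 by (intro prod.cong refl) (simp add: a'_def b'_def)
  also have "\<dots> = (\<Prod>l<n. \<tau> (int l)) / (\<Prod>l<n. \<tau> (int l + 1)) * ratio n d c"
    by (simp only: prod.distrib prod_dividef ratio_def)
  finally show "ratio n a' b' = ratio n d c" using T0 by (simp add: T)
  have "ratio n d' c' = (\<Prod>l<n. \<tau> (int l + 1) / \<tau> (int l) * (a (int l) / b (int l)))"
    unfolding ratio_def using p0 by (intro prod.cong refl) (simp add: c'_def d'_def)
  also have "\<dots> = (\<Prod>l<n. \<tau> (int l + 1)) / (\<Prod>l<n. \<tau> (int l)) * ratio n a b"
    by (simp only: prod.distrib prod_dividef ratio_def)
  finally show "ratio n d' c' = ratio n a b" using T0 by (simp add: T)
qed

end

text \<open>The scale factors of the two triangles at each middle vertex have a quotient \<open>\<theta>\<close>, and the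
  invariants force \<open>\<theta> - 1\<close> to have a constant sign. As its product over a period is \<open>1\<close>,
  it vanishes.\<close>

lemma star_equivalent_unique:
  assumes "two_layers n a b c d" "two_layers n a2 b2 c2 d2"
    and eq: "star_equivalent a b c d a2 b2 c2 d2" and ratio: "ratio n a2 b2 = ratio n a b"
  shows "a2 k = a k \<and> b2 k = b k \<and> c2 k = c k \<and> d2 k = d k"
proof -
  interpret X: two_layers n a b c d by fact
  interpret Y: two_layers n a2 b2 c2 d2 by fact
  have p0: "a k \<noteq> 0" "b k \<noteq> 0" "c k \<noteq> 0" "d k \<noteq> 0" "X.S k \<noteq> 0" for k
    using X.pos[of k] X.S_pos[of k] by auto
  have q0: "a2 k \<noteq> 0" "b2 k \<noteq> 0" "c2 k \<noteq> 0" "d2 k \<noteq> 0" "Y.S k \<noteq> 0" for k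
    using Y.pos[of k] Y.S_pos[of k] by auto
  have e: "a2 (k + 1) * b2 k / Y.S k = a (k + 1) * b k / X.S k"
    "b2 k * c2 (k + 1) / Y.S k = b k * c (k + 1) / X.S k"
    "a2 (k + 1) * d2 k / Y.S k = a (k + 1) * d k / X.S k"
    "b2 k * d2 k / Y.S k + a2 k * c2 k / Y.S (k - 1) = b k * d k / X.S k + a k * c k / X.S (k - 1)" for k
    using eq unfolding star_equivalent_def by blast+
  define l \<mu> where "l = (\<lambda>k. a2 k / a k)" and "\<mu> = (\<lambda>k. b2 k / b k)"
  have lm: "0 < l k" "0 < \<mu> k" for k using X.pos Y.pos by (simp_all add: l_def \<mu>_def)
  have lm0: "l k \<noteq> 0" "\<mu> k \<noteq> 0" for k using lm[of k] by auto
  have sa: "a2 k = l k * a k" and sb: "b2 k = \<mu> k * b k" for k using p0 by (simp_all add: l_def \<mu>_def)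
  have SS: "Y.S k = l (k + 1) * \<mu> k * X.S k" for k
    using e(1)[of k] p0 q0 unfolding sa[of "k + 1"] sb[of k] by (simp add: field_simps)
  have sc: "c2 (k + 1) = l (k + 1) * c (k + 1)" for k
    using e(2)[of k] p0 lm0 unfolding SS sb[of k] by (simp add: field_simps)
  have sc': "c2 k = l k * c k" for k using sc[of "k - 1"] by simp
  have sd: "d2 k = \<mu> k * d k" for k
    using e(3)[of k] p0 lm0 unfolding SS sa[of "k + 1"] by (simp add: field_simps)
  have S1: "l (k + 1) * \<mu> k * X.S k = l (k + 1) * (a (k + 1) + c (k + 1)) + \<mu> k * (b k + d k)" for k
    using SS[of k] by (simp add: middle_weight_def sa sb sc' sd algebra_simps)
  define \<theta> where "\<theta> = (\<lambda>k. \<mu> k / l (k + 1))"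
  have th: "0 < \<theta> k" for k using lm by (simp add: \<theta>_def)
  have th0: "\<theta> k \<noteq> 0" for k using th[of k] by simp
  \<comment> \<open>The invariant of the parallel edges reads
    \<open>\<theta> k * P + Q / \<theta> (k - 1) = P + Q\<close>, so a deviation of
    \<open>\<theta>\<close> from 1 at \<open>k - 1\<close> must be matched at \<open>k\<close> with
    the same sign.\<close>
  have step: "(\<theta> k - 1) * (b k * d k / X.S k) = (\<theta> (k - 1) - 1) * (a k * c k / X.S (k - 1) / \<theta> (k - 1))" for k
  proof -
    define P Q where "P = b k * d k / X.S k" and "Q = a k * c k / X.S (k - 1)"
    have "b2 k * d2 k / Y.S k = \<theta> k * P"
      using lm0 p0 unfolding SS sb sd by (simp add: \<theta>_def P_def field_simps)
    moreover have "a2 k * c2 k / Y.S (k - 1) = Q / \<theta> (k - 1)"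
      using lm0 p0 unfolding SS sa sc' by (simp add: \<theta>_def Q_def field_simps)
    ultimately have "\<theta> k * P + Q / \<theta> (k - 1) = P + Q"
      using e(4)[of k] unfolding P_def Q_def by simp
    then have "(\<theta> k - 1) * P = Q - Q / \<theta> (k - 1)" by (simp add: left_diff_distrib)
    also have "\<dots> = (\<theta> (k - 1) - 1) * (Q / \<theta> (k - 1))"
      using th0[of "k - 1"] by (simp add: field_simps)
    finally show ?thesis by (simp only: P_def Q_def)
  qed
  have w: "0 < b k * d k / X.S k" "0 < a k * c k / X.S (k - 1) / \<theta> (k - 1)" for k
    using X.pos[of k] X.S_pos th by simp_all
  have sgn_eq: "sgn (\<theta> k - 1) = sgn (\<theta> (k - 1) - 1)" for k
  proof -
    have sp: "sgn (x * y) = sgn x" if "0 < y" for x y :: real using that by (simp add: sgn_mult)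
    have "sgn (\<theta> k - 1) = sgn ((\<theta> k - 1) * (b k * d k / X.S k))" by (rule sp[OF w(1), symmetric])
    also have "\<dots> = sgn (\<theta> (k - 1) - 1)" unfolding step by (rule sp[OF w(2)])
    finally show ?thesis .
  qed
  have sgn_const: "sgn (\<theta> k - 1) = sgn (\<theta> 0 - 1)" for k
  proof (induction k rule: int_induct[of _ 0])
    case (step1 k)
    then show ?case using sgn_eq[of "k + 1"] by simp
  next
    case (step2 k)
    then show ?case using sgn_eq[of k] by simp
  qed simp
  \<comment> \<open>Here the equality of the ratios enters: it excludes the nontrivial solution
    given by the R-matrix when the two layers have different ratios.\<close>
  have prod1: "(\<Prod>i<n. \<theta> (int i)) = 1"
  proof -
    have lper: "l (i + int n) = l i" for i by (simp add: l_def X.per Y.per)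
    have "(\<Prod>i<n. l (int i + 1)) = (\<Prod>i<n. l (int i))"
      using prod_periodic_shift[of l n 1, OF lper] by (simp add: add.commute)
    then have "(\<Prod>i<n. \<theta> (int i)) = (\<Prod>i<n. \<mu> (int i)) / (\<Prod>i<n. l (int i))"
      by (simp add: \<theta>_def prod_dividef)
    also have "\<dots> = ratio n a b / ratio n a2 b2"
      by (simp add: \<mu>_def l_def ratio_def prod_dividef)
    also have "\<dots> = 1" using ratio ratio_pos[of a b n, OF X.pos(1,2)] by simp
    finally show ?thesis .
  qed
  have ne: "{..<n} \<noteq> {}" using X.n by (auto simp: lessThan_empty_iff)
  have "\<theta> 0 = 1"
  proof (rule ccontr)
    assume "\<theta> 0 \<noteq> 1"
    then consider "1 < \<theta> 0" | "\<theta> 0 < 1" by linarith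
    then show False
    proof cases
      case 1
      then have "1 < \<theta> k" for k using sgn_const[of k] by (simp add: sgn_if split: if_splits)
      then have "1 < (\<Prod>i<n. \<theta> (int i))" using ne by (intro less_1_prod) auto
      then show False using prod1 by simp
    next
      case 2
      then have "\<theta> k < 1" for k using sgn_const[of k] by (simp add: sgn_if split: if_splits)
      then have "1 < (\<Prod>i<n. inverse (\<theta> (int i)))" using ne th by (intro less_1_prod) (auto simp: one_less_inverse_iff)
      then show False using prod1 by (simp add: prod_inversef[unfolded o_def])
    qed
  qed
  then have "\<theta> k = 1" for k using sgn_const[of k] by (simp add: sgn_if split: if_splits)
  then have ml: "\<mu> k = l (k + 1)" for k using lm0[of "k + 1"] by (simp add: \<theta>_def)
  \<comment> \<open>With equal factors at each middle vertex, its weight is scaled by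
    \<open>l (k + 1)\<close> as a sum and by the square of this factor through the mixed products,
    so the factor is 1.\<close>
  have sq: "l (k + 1) * l (k + 1) * X.S k = l (k + 1) * X.S k" for k
    using S1[of k] unfolding ml by (simp add: middle_weight_def algebra_simps)
  have l1: "l (k + 1) = 1" for k using sq[of k] lm0(1)[of "k + 1"] p0(5)[of k] by simp
  then have "\<mu> k = 1" "l k = 1" using ml l1[of "k - 1"] by simp_all
  then show ?thesis by (simp add: sa sb sc' sd)
qed

section \<open>The R-matrix on two adjacent layers of the network\<close>

lemma ratio_shift:
  assumes "\<And>i. y (i + int n) = y i"
  shows "ratio n x (\<lambda>i. y (i + s)) = ratio n x y"
  unfolding ratio_def prod_dividef using prod_periodic_shift[of y n s, OF assms] by (simp add: add.commute)

lemma edges_mod: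
  assumes n: "1 \<le> n" and "l < m"
  shows "Straight l (i mod int n) \<in> edges n m" "Diagonal l (i mod int n) \<in> edges n m"
proof -
  have "0 \<le> i mod int n" "i mod int n < int n" using n by auto
  then show "Straight l (i mod int n) \<in> edges n m" "Diagonal l (i mod int n) \<in> edges n m"
    using assms(2) by (auto simp: edges_def)
qed

context
  fixes n m j :: nat and w :: "edge \<Rightarrow> real"
  assumes n: "1 \<le> n" and j: "1 \<le> j" "j < m" and w: "w \<in> conductances n m"
begin

abbreviation (input) "R_a \<equiv> diagonal n w (j - 1)"
abbreviation (input) "R_b \<equiv> straight n w (j - 1)"
abbreviation (input) "R_c \<equiv> \<lambda>k. straight n w j (k - 1)"
abbreviation (input) "R_d \<equiv> diagonal n w j"

lemma two_layers_conductances: "two_layers n R_a R_b R_c R_d"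
proof
  have "j - 1 < m" using j by simp
  then show "0 < R_a k" "0 < R_b k" "0 < R_c k" "0 < R_d k" for k
    using conductances_posD[OF w n] j by auto
  show "R_a (k + int n) = R_a k" "R_b (k + int n) = R_b k" "R_c (k + int n) = R_c k" "R_d (k + int n) = R_d k" for k
    using straight_periodic[of n w j "k - 1"] by (simp_all add: straight_periodic diagonal_periodic algebra_simps)
qed (use n in auto)

interpretation T: two_layers n R_a R_b R_c R_d by (rule two_layers_conductances)
interpretation T': two_layers n T.a' T.b' T.c' T.d' by (rule T.two_layers_R)

lemma R_matrix_edge:
  "R_matrix n m j w = (\<lambda>e\<in>edges n m. case e of
      Straight l i \<Rightarrow> if l = j - 1 then T.b' i else if l = j then T.c' (i + 1) else w e
    | Diagonal l i \<Rightarrow> if l = j - 1 then T.a' i else if l = j then T.d' i else w e)"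
  unfolding R_matrix_def Let_def straight_def[symmetric] diagonal_def[symmetric]
    T.a'_def T.b'_def T.c'_def T.d'_def ..

lemma straight_R:
  assumes "l < m"
  shows "straight n (R_matrix n m j w) l i = (if l = j - 1 then T.b' i else if l = j then T.c' (i + 1) else straight n w l i)"
proof -
  have "T.b' (i mod int n) = T.b' i" by (rule periodic_mod) (rule T'.per)
  moreover have "T.c' (i mod int n + 1) = T.c' (i + 1)"
    using periodic_mod[of "\<lambda>i. T.c' (i + 1)" "int n" i] T'.per(3)[of "_ + 1"] by (simp add: algebra_simps)
  ultimately show ?thesis using edges_mod[OF n assms]
    by (simp add: straight_def lift_def R_matrix_edge)
qed

lemma diagonal_R:
  assumes "l < m"
  shows "diagonal n (R_matrix n m j w) l i = (if l = j - 1 then T.a' i else if l = j then T.d' i else diagonal n w l i)"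
proof -
  have "T.a' (i mod int n) = T.a' i" "T.d' (i mod int n) = T.d' i" by (rule periodic_mod, rule T'.per)+
  then show ?thesis using edges_mod[OF n assms]
    by (simp add: diagonal_def lift_def R_matrix_edge)
qed

lemma R_matrix_conductances: "R_matrix n m j w \<in> conductances n m"
  unfolding conductances_def R_matrix_edge
proof (rule restrict_PiE_iff[THEN iffD2], intro ballI)
  fix e assume e: "e \<in> edges n m"
  then have "w e \<in> {0<..}" using w unfolding conductances_def by (rule PiE_mem[rotated])
  then show "(case e of Straight l i \<Rightarrow> if l = j - 1 then T.b' i else if l = j then T.c' (i + 1) else w e
    | Diagonal l i \<Rightarrow> if l = j - 1 then T.a' i else if l = j then T.d' i else w e) \<in> {0<..}"
    using T'.pos by (cases e) auto
qed

lemma layer_ratio_R: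
  assumes "k < m"
  shows "layer_ratio n (R_matrix n m j w) k = layer_ratio n w (transpose (j - 1) j k)"
proof -
  consider "k = j - 1" | "k = j" | "k \<noteq> j - 1" "k \<noteq> j" by blast
  then show ?thesis
  proof cases
    case 1
    have "diagonal n (R_matrix n m j w) k = T.a'" "straight n (R_matrix n m j w) k = T.b'"
      using diagonal_R[OF assms] straight_R[OF assms] 1 by (auto simp: fun_eq_iff)
    then show ?thesis
      using T.ratio_R(1) ratio_shift[of "straight n w j" n R_d "-1", OF straight_periodic] 1
      by (simp add: layer_ratio_def)
  next
    case 2
    have "diagonal n (R_matrix n m j w) k = T.d'" "straight n (R_matrix n m j w) k = (\<lambda>i. T.c' (i + 1))"
      using diagonal_R[OF assms] straight_R[OF assms] 2 j by (auto simp: fun_eq_iff)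
    then show ?thesis
      using T.ratio_R(2) ratio_shift[of "T.c'" n T.d' 1, OF T'.per(3)] 2
      by (simp add: layer_ratio_def)
  next
    case 3
    have "diagonal n (R_matrix n m j w) k = diagonal n w k" "straight n (R_matrix n m j w) k = straight n w k"
      using diagonal_R[OF assms] straight_R[OF assms] 3 by (auto simp: fun_eq_iff)
    then show ?thesis using 3 by (simp add: layer_ratio_def)
  qed
qed

text \<open>Potentials in column \<open>j\<close> are averages over the two neighbouring columns.
  Replacing only these by the averages for the new conductances leaves the currents in all other
  columns unchanged, by star equivalence, and column \<open>j\<close> is never a boundary
  column.\<close>

lemma R_matrix_same_response: "same_response n m w (R_matrix n m j w)"
proof -
  define w' where "w' = R_matrix n m j w"
  have w': "w' \<in> conductances n m" unfolding w'_def by (rule R_matrix_conductances)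
  have m: "1 \<le> m" using j by simp
  obtain l where l: "j = Suc l" using j by (cases j) auto
  interpret w: strip n m "diagonal n w" "straight n w" using strip_conductances[OF w n m] .
  interpret w': strip n m "diagonal n w'" "straight n w'" using strip_conductances[OF w' n m] .
  show ?thesis unfolding w'_def[symmetric]
  proof (rule same_responseI[OF w w' n m])
    fix U :: "nat \<Rightarrow> int \<Rightarrow> real" and M
    assume U: "w.harmonic U" and M: "\<And>k i. k \<le> m \<Longrightarrow> norm (U k i) \<le> M"
    define p q where "p = U (j - 1)" and "q = U (Suc j)"
    define v where "v = middle_value T.a' T.b' T.c' T.d' p q"
    define U' where "U' = U(j := v)"
    have Uj: "U j = middle_value R_a R_b R_c R_d p q"
    proof
      fix i
      have "w.current U j i = 0" using U j by (simp add: w.harmonic_def)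
      then have "degree4 (diagonal n w) (straight n w) j i * U j i = neighbour_sum (diagonal n w) (straight n w) U j i"
        using out_current_interior[of j m "diagonal n w" "straight n w" U i] j by simp
      moreover have "degree4 (diagonal n w) (straight n w) j i = T.S i"
        by (simp add: degree4_def middle_weight_def)
      ultimately show "U j i = middle_value R_a R_b R_c R_d p q i"
        using T.S_pos[of i] by (simp add: middle_value_def neighbour_sum_def p_def q_def field_simps)
    qed
    note cur = star_equivalent_currents(1)[OF T.star_equivalent_R T.S_pos T'.S_pos, of _ p q]
      star_equivalent_currents(2)[OF T.star_equivalent_R T.S_pos T'.S_pos, of _ q p]
    have c0: "w'.current U' k i = w.current U k i" if k: "k \<le> m" "k \<noteq> j" for k i
    proof -
      consider "k = l" | "k = Suc j" | "k \<noteq> l" "k \<noteq> Suc j" by blast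
      then show ?thesis
      proof cases
        case 1
        have "straight n w' l i * (p i - v i) + diagonal n w' l i * (p i - v (i - 1)) =
          straight n w l i * (p i - U j i) + diagonal n w l i * (p i - U j (i - 1))"
          using cur(1)[of i] straight_R[of l i] diagonal_R[of l i] l j unfolding Uj v_def w'_def by simp
        moreover have "straight n w' (l - 1) = straight n w (l - 1)" "diagonal n w' (l - 1) = diagonal n w (l - 1)" if "0 < l"
          using straight_R[of "l - 1"] diagonal_R[of "l - 1"] l j that unfolding w'_def by (auto simp: fun_eq_iff)
        ultimately show ?thesis using 1 l j unfolding out_current_def U'_def p_def by auto
      next
        case 2
        have "straight n w' j i * (q i - v i) + diagonal n w' j (i + 1) * (q i - v (i + 1)) =
          straight n w j i * (q i - U j i) + diagonal n w j (i + 1) * (q i - U j (i + 1))"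
          using cur(2)[of i] straight_R[of j i] diagonal_R[of j "i + 1"] l j unfolding Uj v_def w'_def by simp
        moreover have "straight n w' (Suc j) = straight n w (Suc j)" "diagonal n w' (Suc j) = diagonal n w (Suc j)" if "Suc j < m"
          using straight_R[OF that] diagonal_R[OF that] l unfolding w'_def by (auto simp: fun_eq_iff)
        ultimately show ?thesis using 2 unfolding out_current_def U'_def q_def by auto
      next
        case 3
        have "straight n w' k i = straight n w k i" "diagonal n w' k i = diagonal n w k i" if "k < m" for i
          using straight_R[OF that] diagonal_R[OF that] l 3 k unfolding w'_def by auto
        moreover have "straight n w' (k - 1) i = straight n w (k - 1) i" "diagonal n w' (k - 1) i = diagonal n w (k - 1) i" if "0 < k" for i
        proof -
          have "k - 1 < m" "k - 1 \<noteq> j - 1" "k - 1 \<noteq> j" using that k 3 l by auto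
          then show "straight n w' (k - 1) i = straight n w (k - 1) i" "diagonal n w' (k - 1) i = diagonal n w (k - 1) i"
            using straight_R[of "k - 1"] diagonal_R[of "k - 1"] unfolding w'_def by auto
        qed
        moreover have "Suc k \<noteq> j" "0 < k \<longrightarrow> k - 1 \<noteq> j" using 3 l by auto
        ultimately show ?thesis using k unfolding out_current_def U'_def by auto
      qed
    qed
    have cj: "w'.current U' j i = 0" for i
    proof -
      have 1: "degree4 (diagonal n w') (straight n w') j i = T'.S i"
        using straight_R[of j i] straight_R[of l i] diagonal_R[of j i] diagonal_R[of l "i + 1"] j l
        by (simp add: degree4_def middle_weight_def w'_def)
      have "neighbour_sum (diagonal n w') (straight n w') U' j i = T.b' i * p i + T.a' (i + 1) * p (i + 1) + T.c' (i + 1) * q i + T.d' i * q (i - 1)"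
        using straight_R[of j i] straight_R[of l i] diagonal_R[of j i] diagonal_R[of l "i + 1"] j l
        by (simp add: neighbour_sum_def w'_def U'_def p_def q_def)
      also have "\<dots> = T'.S i * v i" using T'.S_pos[of i] by (simp add: v_def middle_value_def)
      finally show ?thesis
        using out_current_interior[of j m "diagonal n w'" "straight n w'" U' i] j 1 by (simp add: U'_def)
    qed
    have h': "w'.harmonic U'"
      unfolding w'.harmonic_def
    proof (intro allI impI)
      show "w'.current U' k i = 0" if "0 < k" "k < m" for k i
        using c0[of k i] cj[of i] U that by (cases "k = j") (auto simp: w.harmonic_def)
    qed
    have "\<bar>v i\<bar> \<le> M" for i
      unfolding v_def using M j by (intro middle_value_bound T'.pos) (auto simp: p_def q_def)
    then have b': "norm (U' k i) \<le> M" if "k \<le> m" for k i using M[OF that] by (simp add: U'_def)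
    have "U' k i = U k i \<and> w'.current U' k i = w.current U k i" if "k \<in> {0, m}" for k i
      using c0[of k i] that j by (auto simp: U'_def)
    then show "\<exists>U' M'. w'.harmonic U' \<and> (\<forall>k i. k \<le> m \<longrightarrow> norm (U' k i) \<le> M') \<and>
       (\<forall>k\<in>{0, m}. \<forall>i. U' k i = U k i \<and> w'.current U' k i = w.current U k i)"
      using h' b' by (intro exI[of _ U'] exI[of _ M]) auto
  qed
qed

text \<open>Stated without the names of the interpretation, so that the images of two different
  networks can be compared.\<close>

lemma R_matrix_layers:
  "\<exists>a' b' c' d'. two_layers n a' b' c' d' \<and> star_equivalent R_a R_b R_c R_d a' b' c' d' \<and> ratio n d' c' = ratio n R_a R_b \<and>
     diagonal n (R_matrix n m j w) (j - 1) = a' \<and> straight n (R_matrix n m j w) (j - 1) = b' \<and>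
     diagonal n (R_matrix n m j w) j = d' \<and> straight n (R_matrix n m j w) j = (\<lambda>i. c' (i + 1))"
  using T.two_layers_R T.star_equivalent_R T.ratio_R(2) straight_R diagonal_R j
  by (intro exI[of _ T.a'] exI[of _ T.b'] exI[of _ T.c'] exI[of _ T.d']) (auto simp: fun_eq_iff)

lemma R_matrix_other_layers:
  assumes "l < m" "l \<noteq> j - 1" "l \<noteq> j"
  shows "straight n (R_matrix n m j w) l = straight n w l" "diagonal n (R_matrix n m j w) l = diagonal n w l"
  using straight_R[OF assms(1)] diagonal_R[OF assms(1)] assms by (auto simp: fun_eq_iff)

end

text \<open>Equal images make both networks star equivalent to the same layers, hence to each other,
  and the ratio of the new second layer remembers that of the old first one.
  \<open>star_equivalent_unique\<close> then recovers layers \<open>j - 1\<close> and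
  \<open>j\<close>.\<close>

lemma R_matrix_inj:
  assumes n: "1 \<le> n" and j: "1 \<le> j" "j < m" and w: "w \<in> conductances n m" "w2 \<in> conductances n m"
    and eq: "R_matrix n m j w = R_matrix n m j w2"
  shows "w = w2"
proof -
  obtain a' b' c' d' where 1: "star_equivalent (diagonal n w (j - 1)) (straight n w (j - 1)) (\<lambda>k. straight n w j (k - 1)) (diagonal n w j) a' b' c' d'"
    "ratio n d' c' = ratio n (diagonal n w (j - 1)) (straight n w (j - 1))"
    "diagonal n (R_matrix n m j w) (j - 1) = a'" "straight n (R_matrix n m j w) (j - 1) = b'"
    "diagonal n (R_matrix n m j w) j = d'" "straight n (R_matrix n m j w) j = (\<lambda>i. c' (i + 1))"
    using R_matrix_layers[OF n j w(1)] by blast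
  obtain a2 b2 c2 d2 where 2: "star_equivalent (diagonal n w2 (j - 1)) (straight n w2 (j - 1)) (\<lambda>k. straight n w2 j (k - 1)) (diagonal n w2 j) a2 b2 c2 d2"
    "ratio n d2 c2 = ratio n (diagonal n w2 (j - 1)) (straight n w2 (j - 1))"
    "diagonal n (R_matrix n m j w2) (j - 1) = a2" "straight n (R_matrix n m j w2) (j - 1) = b2"
    "diagonal n (R_matrix n m j w2) j = d2" "straight n (R_matrix n m j w2) j = (\<lambda>i. c2 (i + 1))"
    using R_matrix_layers[OF n j w(2)] by blast
  have "(\<lambda>i. c' (i + 1)) = (\<lambda>i. c2 (i + 1))" using 1 2 eq by simp
  then have "c' k = c2 k" for k using fun_cong[of "\<lambda>i. c' (i + 1)" "\<lambda>i. c2 (i + 1)" "k - 1"] by simp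
  then have same: "a' = a2" "b' = b2" "c' = c2" "d' = d2" using 1 2 eq by auto
  have se: "star_equivalent (diagonal n w (j - 1)) (straight n w (j - 1)) (\<lambda>k. straight n w j (k - 1)) (diagonal n w j)
    (diagonal n w2 (j - 1)) (straight n w2 (j - 1)) (\<lambda>k. straight n w2 j (k - 1)) (diagonal n w2 j)"
    using 1(1) 2(1) unfolding same star_equivalent_def by simp
  have r: "ratio n (diagonal n w2 (j - 1)) (straight n w2 (j - 1)) = ratio n (diagonal n w (j - 1)) (straight n w (j - 1))"
    using 1(2) 2(2) same by simp
  note u = star_equivalent_unique[OF two_layers_conductances[OF n j w(1)] two_layers_conductances[OF n j w(2)] se r]
  have sj: "straight n w2 j i = straight n w j i" for i using u[of "i + 1"] by simp
  show ?thesis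
  proof (rule conductances_eqI[OF w])
    fix k i assume k: "k < m"
    show "straight n w k i = straight n w2 k i"
      using u[of i] sj[of i] R_matrix_other_layers(1)[OF n j w(1) k] R_matrix_other_layers(1)[OF n j w(2) k] eq
      by (cases "k = j - 1"; cases "k = j") auto
    show "diagonal n w k i = diagonal n w2 k i"
      using u[of i] R_matrix_other_layers(2)[OF n j w(1) k] R_matrix_other_layers(2)[OF n j w(2) k] eq
      by (cases "k = j - 1"; cases "k = j") auto
  qed
qed

section \<open>The group action and the fibres of the response\<close>

lemma same_response_trans:
  "same_response n m w w' \<Longrightarrow> same_response n m w' w'' \<Longrightarrow> same_response n m w w''"
  by (simp add: same_response_def)

lemma same_response_sym: "same_response n m w w' \<Longrightarrow> same_response n m w' w"
  by (simp add: same_response_def)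

text \<open>Permutations act on \<open>{1..m}\<close> as in \<open>sym_group m\<close> while layers
  are numbered from 0, hence the shifts by 1. The inverse yields a left action.\<close>

definition permuted_by :: "nat \<Rightarrow> nat \<Rightarrow> (nat \<Rightarrow> nat) \<Rightarrow> (edge \<Rightarrow> real) \<Rightarrow> (edge \<Rightarrow> real) \<Rightarrow> bool" where
  "permuted_by n m \<sigma> w w' \<longleftrightarrow> w' \<in> conductances n m \<and> same_response n m w w' \<and>
     (\<forall>i\<in>{1..m}. layer_ratio n w' (i - 1) = layer_ratio n w (inv' \<sigma> i - 1))"

lemma permuted_by_comp:
  assumes "permuted_by n m \<tau> w w'" "permuted_by n m \<sigma> w' w''" "\<sigma> permutes {1..m}" "\<tau> permutes {1..m}"
  shows "permuted_by n m (\<sigma> \<circ> \<tau>) w w''"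
proof -
  have "inv' (\<sigma> \<circ> \<tau>) = inv' \<tau> \<circ> inv' \<sigma>"
    using assms(3,4) by (intro o_inv_distrib permutes_bij)
  moreover have "inv' \<sigma> i \<in> {1..m}" if "i \<in> {1..m}" for i
    using permutes_in_image[OF permutes_inv[OF assms(3)]] that by blast
  ultimately show ?thesis using assms(1,2) by (auto simp: permuted_by_def intro: same_response_trans)
qed

text \<open>Injectivity is included because it will carry uniqueness from decreasing ratios to
  arbitrary ones. The witness is composed from R-matrices; a priori, different factorizations of
  \<open>\<sigma>\<close> might give different maps, hence mere existence.\<close>

definition permuting_map :: "nat \<Rightarrow> nat \<Rightarrow> (nat \<Rightarrow> nat) \<Rightarrow> bool" where
  "permuting_map n m \<sigma> \<longleftrightarrow> (\<exists>X. inj_on X (conductances n m) \<and> (\<forall>w\<in>conductances n m. permuted_by n m \<sigma> w (X w)))"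

lemma permuting_map_comp:
  assumes "permuting_map n m \<sigma>" "permuting_map n m \<tau>" "\<sigma> permutes {1..m}" "\<tau> permutes {1..m}"
  shows "permuting_map n m (\<sigma> \<circ> \<tau>)"
proof -
  obtain X Y where X: "inj_on X (conductances n m)" "\<And>w. w \<in> conductances n m \<Longrightarrow> permuted_by n m \<sigma> w (X w)"
    and Y: "inj_on Y (conductances n m)" "\<And>w. w \<in> conductances n m \<Longrightarrow> permuted_by n m \<tau> w (Y w)"
    using assms(1,2) unfolding permuting_map_def by blast
  have Yc: "Y w \<in> conductances n m" if "w \<in> conductances n m" for w using Y(2)[OF that] by (simp add: permuted_by_def)
  have "inj_on (\<lambda>w. X (Y w)) (conductances n m)"
    using X(1) Y(1) Yc by (auto simp: inj_on_def)
  moreover have "permuted_by n m (\<sigma> \<circ> \<tau>) w (X (Y w))" if "w \<in> conductances n m" for w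
    by (rule permuted_by_comp[OF Y(2)[OF that] X(2)[OF Yc[OF that]] assms(3,4)])
  ultimately show ?thesis unfolding permuting_map_def by blast
qed

lemma permuted_by_R_matrix:
  assumes "1 \<le> n" "1 \<le> j" "j < m" "w \<in> conductances n m"
  shows "permuted_by n m (transpose j (j + 1)) w (R_matrix n m j w)"
proof -
  have "layer_ratio n (R_matrix n m j w) (i - 1) = layer_ratio n w (transpose j (j + 1) i - 1)" if "i \<in> {1..m}" for i
  proof -
    have "transpose (j - 1) j (i - 1) = transpose j (j + 1) i - 1"
      using that assms(2) by (auto simp: transpose_def)
    moreover have "i - 1 < m" using that by auto
    ultimately show ?thesis using layer_ratio_R[OF assms, of "i - 1"] by simp
  qed
  then show ?thesis
    using R_matrix_conductances[OF assms] R_matrix_same_response[OF assms] by (simp add: permuted_by_def)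
qed

lemma permuting_map_id: "permuting_map n m id"
  unfolding permuting_map_def
  by (intro exI[of _ id]) (auto simp: permuted_by_def same_response_def)

text \<open>R-matrices provide adjacent transpositions only; conjugating with one of them moves the
  upper index by one.\<close>

lemma permuting_map_transpose_less:
  assumes n: "1 \<le> n" and "1 \<le> i" "i + d + 1 \<le> m"
  shows "permuting_map n m (transpose i (i + d + 1))"
  using assms(2,3)
proof (induction d)
  case 0
  then show ?case unfolding permuting_map_def
    using permuted_by_R_matrix[OF n, of i m] R_matrix_inj[OF n, of i m]
    by (intro exI[of _ "R_matrix n m i"]) (auto intro!: inj_onI)
next
  case (Suc d)
  define k where "k = i + d + 1"
  have k: "1 \<le> k" "k < m" "i < k" using Suc.prems by (auto simp: k_def)
  have a: "permuting_map n m (transpose k (k + 1))"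
    unfolding permuting_map_def
    using permuted_by_R_matrix[OF n, of k m] R_matrix_inj[OF n, of k m] k
    by (intro exI[of _ "R_matrix n m k"]) (auto intro!: inj_onI)
  have b: "permuting_map n m (transpose i k)" using Suc by (simp add: k_def)
  have p: "transpose k (k + 1) permutes {1..m}" "transpose i k permutes {1..m}"
    using k Suc.prems(1) by (auto intro!: permutes_swap_id)
  have "permuting_map n m (transpose k (k + 1) \<circ> (transpose i k \<circ> transpose k (k + 1)))"
    by (intro permuting_map_comp a b p permutes_compose)
  moreover have "transpose k (k + 1) \<circ> (transpose i k \<circ> transpose k (k + 1)) = transpose i (k + 1)"
    using k by (auto simp: fun_eq_iff transpose_def)
  ultimately show ?case by (simp add: k_def)
qed

lemma permuting_map_transpose:
  assumes n: "1 \<le> n" and "i \<in> {1..m}" "k \<in> {1..m}" "i \<noteq> k"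
  shows "permuting_map n m (transpose i k)"
proof -
  have less: "permuting_map n m (transpose i k)" if "1 \<le> i" "i < k" "k \<le> m" for i k
  proof -
    have "k = i + (k - i - 1) + 1" using that by simp
    then show ?thesis using permuting_map_transpose_less[OF n that(1), of "k - i - 1" m] that by simp
  qed
  show ?thesis
  proof (cases "i < k")
    case True
    then show ?thesis using less assms by auto
  next
    case False
    then show ?thesis using less[of k i] assms by (auto simp: transpose_commute)
  qed
qed

lemma permuting_map_permutes:
  assumes n: "1 \<le> n" and "\<sigma> permutes {1..m}"
  shows "permuting_map n m \<sigma>"
  using assms(2) finite_atLeastAtMost
proof (induction rule: permutes_induct)
  case id
  show ?case by (rule permuting_map_id)
next
  case (swap a b p)
  then show ?case
    by (intro permuting_map_comp permuting_map_transpose[OF n] permutes_swap_id) auto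
qed

lemma ex_sorting_permutation:
  fixes f :: "nat \<Rightarrow> real"
  shows "\<exists>\<pi>. \<pi> permutes {1..m} \<and> (\<forall>k l. k \<le> l \<longrightarrow> l < m \<longrightarrow> f (\<pi> (l + 1)) \<le> f (\<pi> (k + 1)))"
proof -
  define xs where "xs = map (\<lambda>i. f (i + 1)) [0..<m]"
  define ys where "ys = rev (sort xs)"
  have "mset ys = mset xs" by (simp add: ys_def)
  then obtain p where p: "p permutes {..<length xs}" "permute_list p xs = ys" by (rule mset_eq_permutation)
  have len: "length xs = m" "length ys = m" by (simp_all add: xs_def ys_def)
  have nth: "ys ! i = f (p i + 1)" if "i < m" for i
  proof -
    have "p i < m" using permutes_in_image[OF p(1), of i] that len by simp
    then show ?thesis using permute_list_nth[OF p(1), of i] p(2) that len by (simp add: xs_def)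
  qed
  define \<pi> where "\<pi> = (\<lambda>i. if i \<in> {1..m} then p (i - 1) + 1 else i)"
  have "bij_betw (\<lambda>i. i - 1) {1..m} {..<m}"
    by (rule bij_betwI[where g = Suc]) auto
  moreover have "bij_betw p {..<m} {..<m}" using permutes_imp_bij[OF p(1)] len by simp
  moreover have "bij_betw Suc {..<m} {1..m}"
    by (rule bij_betwI[where g = "\<lambda>i. i - 1"]) auto
  ultimately have "bij_betw (Suc \<circ> p \<circ> (\<lambda>i. i - 1)) {1..m} {1..m}"
    by (metis bij_betw_trans comp_assoc)
  then have "bij_betw \<pi> {1..m} {1..m}"
    by (rule bij_betw_cong[THEN iffD1, rotated]) (auto simp: \<pi>_def)
  then have "\<pi> permutes {1..m}" by (rule bij_imp_permutes) (auto simp: \<pi>_def)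
  moreover have "f (\<pi> (l + 1)) \<le> f (\<pi> (k + 1))" if "k \<le> l" "l < m" for k l
  proof -
    have "sorted (rev ys)" by (simp add: ys_def)
    then have "ys ! l \<le> ys ! k" using that len sorted_rev_nth_mono[of ys k l] by simp
    then show ?thesis using nth[of l] nth[of k] that by (simp add: \<pi>_def)
  qed
  ultimately show ?thesis by blast
qed

lemma ex_sorting_map:
  assumes n: "1 \<le> n"
  obtains \<sigma> where "\<sigma> permutes {1..m}"
    "\<And>w' k l. \<lbrakk>permuted_by n m \<sigma> w w'; k \<le> l; l < m\<rbrakk> \<Longrightarrow> layer_ratio n w' l \<le> layer_ratio n w' k"
proof -
  obtain \<pi> where \<pi>: "\<pi> permutes {1..m}"
    "\<And>k l. k \<le> l \<Longrightarrow> l < m \<Longrightarrow> layer_ratio n w (\<pi> (l + 1) - 1) \<le> layer_ratio n w (\<pi> (k + 1) - 1)"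
    using ex_sorting_permutation[of m "\<lambda>i. layer_ratio n w (i - 1)"] by blast
  show ?thesis
  \<comment> \<open>\<open>permuted_by\<close> reads ratios through the inverse permutation, so the
    sorting permutation is inverted.\<close>
  proof (rule that[of "inv' \<pi>"])
    show "inv' \<pi> permutes {1..m}" by (rule permutes_inv[OF \<pi>(1)])
    fix w' k l assume w': "permuted_by n m (inv' \<pi>) w w'" and kl: "k \<le> l" "l < m"
    have ii: "inv' (inv' \<pi>) = \<pi>" by (rule permutes_inv_inv[OF \<pi>(1)])
    have "layer_ratio n w' i = layer_ratio n w (\<pi> (i + 1) - 1)" if "i < m" for i
      using w' that unfolding permuted_by_def ii by (metis Suc_eq_plus1 Suc_leI atLeastAtMost_iff diff_Suc_1 le_add2)
    then show "layer_ratio n w' l \<le> layer_ratio n w' k" using \<pi>(2)[OF kl] kl by simp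
  qed
qed

text \<open>One injective map sorts both networks, since their ratios agree. The sorted images have
  equal responses and therefore coincide, and injectivity pulls this back.\<close>

lemma same_ratio_unique:
  assumes n: "1 \<le> n" and m: "1 \<le> m" and w: "w \<in> conductances n m" "w' \<in> conductances n m"
    and same: "same_response n m w w'" and ratio: "\<And>k. k < m \<Longrightarrow> layer_ratio n w' k = layer_ratio n w k"
  shows "w = w'"
proof -
  obtain \<sigma> where \<sigma>: "\<sigma> permutes {1..m}"
    "\<And>w' k l. \<lbrakk>permuted_by n m \<sigma> w w'; k \<le> l; l < m\<rbrakk> \<Longrightarrow> layer_ratio n w' l \<le> layer_ratio n w' k"
    using ex_sorting_map[OF n] by blast
  obtain X where X: "inj_on X (conductances n m)" "\<And>w. w \<in> conductances n m \<Longrightarrow> permuted_by n m \<sigma> w (X w)"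
    using permuting_map_permutes[OF n \<sigma>(1)] unfolding permuting_map_def by blast
  have pw: "permuted_by n m \<sigma> w (X w)" by (rule X(2)[OF w(1)])
  have pw': "permuted_by n m \<sigma> w (X w')"
  proof -
    have "inv' \<sigma> i \<in> {1..m}" if "i \<in> {1..m}" for i
      using permutes_in_image[OF permutes_inv[OF \<sigma>(1)]] that by blast
    then have "layer_ratio n w' (inv' \<sigma> i - 1) = layer_ratio n w (inv' \<sigma> i - 1)" if "i \<in> {1..m}" for i
      using that by (intro ratio) fastforce
    then show ?thesis using X(2)[OF w(2)] same by (auto simp: permuted_by_def intro: same_response_trans)
  qed
  have "X w = X w'"
  proof (rule sorted_same_response_unique[OF n m])
    show "X w \<in> conductances n m" "X w' \<in> conductances n m" using pw pw' by (auto simp: permuted_by_def)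
    show "same_response n m (X w) (X w')"
      using pw pw' by (auto simp: permuted_by_def intro: same_response_trans same_response_sym)
  qed (use \<sigma>(2)[OF pw] \<sigma>(2)[OF pw'] in auto)
  then show ?thesis using X(1) w by (auto simp: inj_on_def)
qed

lemma permuted_by_unique:
  assumes n: "1 \<le> n" and m: "1 \<le> m" and "permuted_by n m \<sigma> w w'" "permuted_by n m \<sigma> w w''"
  shows "w' = w''"
proof (rule same_ratio_unique[OF n m])
  show "same_response n m w' w''" using assms by (auto simp: permuted_by_def intro: same_response_trans same_response_sym)
  show "layer_ratio n w'' k = layer_ratio n w' k" if "k < m" for k
  proof -
    have "k + 1 \<in> {1..m}" using that by simp
    then have "layer_ratio n w'' (k + 1 - 1) = layer_ratio n w' (k + 1 - 1)"
      using assms(3,4) unfolding permuted_by_def by metis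
    then show ?thesis by simp
  qed
qed (use assms in \<open>auto simp: permuted_by_def\<close>)

text \<open>Each network is sorted by its own permutation, and the sorted networks coincide. One
  sorting followed by the inverse of the other leads from \<open>w\<close> to
  \<open>w'\<close>.\<close>

lemma same_response_permuted_by:
  assumes n: "1 \<le> n" and m: "1 \<le> m" and w: "w \<in> conductances n m" "w' \<in> conductances n m"
    and same: "same_response n m w w'"
  shows "\<exists>\<sigma>. \<sigma> permutes {1..m} \<and> permuted_by n m \<sigma> w w'"
proof -
  obtain \<sigma> where \<sigma>: "\<sigma> permutes {1..m}"
    "\<And>w' k l. \<lbrakk>permuted_by n m \<sigma> w w'; k \<le> l; l < m\<rbrakk> \<Longrightarrow> layer_ratio n w' l \<le> layer_ratio n w' k"
    using ex_sorting_map[OF n] by blast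
  obtain \<sigma>' where \<sigma>': "\<sigma>' permutes {1..m}"
    "\<And>w'' k l. \<lbrakk>permuted_by n m \<sigma>' w' w''; k \<le> l; l < m\<rbrakk> \<Longrightarrow> layer_ratio n w'' l \<le> layer_ratio n w'' k"
    using ex_sorting_map[OF n] by blast
  obtain v where v: "permuted_by n m \<sigma> w v"
    using permuting_map_permutes[OF n \<sigma>(1)] w unfolding permuting_map_def by blast
  obtain v' where v': "permuted_by n m \<sigma>' w' v'"
    using permuting_map_permutes[OF n \<sigma>'(1)] w unfolding permuting_map_def by blast
  have "v = v'"
  proof (rule sorted_same_response_unique[OF n m])
    show "v \<in> conductances n m" "v' \<in> conductances n m" using v v' by (auto simp: permuted_by_def)
    show "same_response n m v v'"
      using v v' same by (auto simp: permuted_by_def intro: same_response_trans same_response_sym)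
  qed (use \<sigma>(2)[OF v] \<sigma>'(2)[OF v'] in auto)
  have "permuted_by n m (inv' \<sigma>') v w'"
    unfolding permuted_by_def
  proof (intro conjI ballI)
    show "same_response n m v w'" using v' \<open>v = v'\<close> by (auto simp: permuted_by_def intro: same_response_sym)
    fix i assume i: "i \<in> {1..m}"
    have "\<sigma>' i \<in> {1..m}" using permutes_in_image[OF \<sigma>'(1)] i by blast
    then have "layer_ratio n v (\<sigma>' i - 1) = layer_ratio n w' (inv' \<sigma>' (\<sigma>' i) - 1)"
      using v' \<open>v = v'\<close> by (simp add: permuted_by_def)
    then show "layer_ratio n w' (i - 1) = layer_ratio n v (inv' (inv' \<sigma>') i - 1)"
      using \<sigma>'(1) by (simp add: permutes_inverses permutes_inv_inv)
  qed (use w in simp)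
  then have "permuted_by n m (inv' \<sigma>' \<circ> \<sigma>) w w'"
    using v \<sigma>(1) \<sigma>'(1) by (intro permuted_by_comp permutes_inv)
  moreover have "inv' \<sigma>' \<circ> \<sigma> permutes {1..m}" using \<sigma>(1) \<sigma>'(1) by (intro permutes_compose permutes_inv)
  ultimately show ?thesis by blast
qed

text \<open>Characterizing the action by the ratios and the response makes it a group action without any
  recourse to the braid relations.\<close>

definition ratio_action :: "nat \<Rightarrow> nat \<Rightarrow> (nat \<Rightarrow> nat) \<Rightarrow> (edge \<Rightarrow> real) \<Rightarrow> (edge \<Rightarrow> real)" where
  "ratio_action n m \<sigma> = (\<lambda>w\<in>conductances n m. THE w'. permuted_by n m \<sigma> w w')"

context
  fixes n m :: nat
  assumes n: "1 \<le> n" and m: "1 \<le> m"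
begin

lemma ratio_action_eq:
  assumes "w \<in> conductances n m" "permuted_by n m \<sigma> w w'"
  shows "ratio_action n m \<sigma> w = w'"
  using assms permuted_by_unique[OF n m] by (auto simp: ratio_action_def)

lemma permuted_by_ratio_action:
  assumes "\<sigma> permutes {1..m}" "w \<in> conductances n m"
  shows "permuted_by n m \<sigma> w (ratio_action n m \<sigma> w)"
proof -
  obtain w' where "permuted_by n m \<sigma> w w'"
    using permuting_map_permutes[OF n assms(1)] assms(2) unfolding permuting_map_def by blast
  then show ?thesis using ratio_action_eq[OF assms(2)] by simp
qed

lemma ratio_action_closed:
  "\<sigma> permutes {1..m} \<Longrightarrow> w \<in> conductances n m \<Longrightarrow> ratio_action n m \<sigma> w \<in> conductances n m"
  using permuted_by_ratio_action by (simp add: permuted_by_def)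

lemma ratio_action_comp:
  assumes "\<sigma> permutes {1..m}" "\<tau> permutes {1..m}" "w \<in> conductances n m"
  shows "ratio_action n m (\<sigma> \<circ> \<tau>) w = ratio_action n m \<sigma> (ratio_action n m \<tau> w)"
  using assms by (intro ratio_action_eq permuted_by_comp[OF permuted_by_ratio_action permuted_by_ratio_action] ratio_action_closed)

lemma ratio_action_id: "w \<in> conductances n m \<Longrightarrow> ratio_action n m id w = w"
  by (intro ratio_action_eq) (auto simp: permuted_by_def same_response_def)

lemma ratio_action_Bij:
  assumes "\<sigma> permutes {1..m}"
  shows "ratio_action n m \<sigma> \<in> Bij (conductances n m)"
proof -
  have "ratio_action n m (inv' \<sigma>) (ratio_action n m \<sigma> w) = w" "ratio_action n m \<sigma> (ratio_action n m (inv' \<sigma>) w) = w"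
    if "w \<in> conductances n m" for w
    using assms that permutes_inv[OF assms]
    by (simp_all add: ratio_action_comp[symmetric] permutes_inv_o[OF assms] ratio_action_id)
  then have "bij_betw (ratio_action n m \<sigma>) (conductances n m) (conductances n m)"
    using ratio_action_closed assms permutes_inv[OF assms]
    by (intro bij_betwI[where g = "ratio_action n m (inv' \<sigma>)"]) auto
  then show ?thesis by (simp add: Bij_def ratio_action_def)
qed

lemma is_R_action_ratio_action: "is_R_action n m (ratio_action n m)"
  unfolding is_R_action_def
proof (intro conjI ballI)
  have "ratio_action n m \<in> hom (sym_group m) (BijGroup (conductances n m))"
  proof (rule homI)
    fix \<sigma> \<tau> assume "\<sigma> \<in> carrier (sym_group m)" "\<tau> \<in> carrier (sym_group m)"
    then have st: "\<sigma> permutes {1..m}" "\<tau> permutes {1..m}" by (simp_all add: sym_group_carrier)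
    show "ratio_action n m \<sigma> \<in> carrier (BijGroup (conductances n m))"
      using ratio_action_Bij[OF st(1)] by (simp add: BijGroup_def)
    have "ratio_action n m (\<sigma> \<circ> \<tau>) = compose (conductances n m) (ratio_action n m \<sigma>) (ratio_action n m \<tau>)"
    proof
      fix w
      show "ratio_action n m (\<sigma> \<circ> \<tau>) w = compose (conductances n m) (ratio_action n m \<sigma>) (ratio_action n m \<tau>) w"
        using ratio_action_comp[OF st, of w] by (cases "w \<in> conductances n m") (auto simp: compose_def ratio_action_def)
    qed
    then show "ratio_action n m (\<sigma> \<otimes>\<^bsub>sym_group m\<^esub> \<tau>) =
        ratio_action n m \<sigma> \<otimes>\<^bsub>BijGroup (conductances n m)\<^esub> ratio_action n m \<tau>"
      using ratio_action_Bij[OF st(1)] ratio_action_Bij[OF st(2)] by (simp add: BijGroup_def sym_group_mult)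
  qed
  then show "group_action (sym_group m) (conductances n m) (ratio_action n m)"
    by (simp add: group_action_def group_hom_def group_hom_axioms_def sym_group_is_group group_BijGroup)
  show "ratio_action n m (transpose j (j + 1)) w = R_matrix n m j w" if "j \<in> {1..<m}" "w \<in> conductances n m" for j w
    using that by (intro ratio_action_eq permuted_by_R_matrix n) auto
qed

lemma same_response_assignments_eq_image:
  assumes "w \<in> conductances n m"
  shows "same_response_assignments n m w = (\<lambda>\<sigma>. ratio_action n m \<sigma> w) ` {\<sigma>. \<sigma> permutes {1..m}}"
proof (intro equalityI subsetI)
  fix w' assume "w' \<in> same_response_assignments n m w"
  then have w': "w' \<in> conductances n m" "same_response n m w w'"
    by (auto simp: same_response_assignments_def same_response_def)
  then obtain \<sigma> where "\<sigma> permutes {1..m}" "permuted_by n m \<sigma> w w'"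
    using same_response_permuted_by[OF n m assms] by blast
  then show "w' \<in> (\<lambda>\<sigma>. ratio_action n m \<sigma> w) ` {\<sigma>. \<sigma> permutes {1..m}}"
    using ratio_action_eq[OF assms] by blast
next
  fix w' assume "w' \<in> (\<lambda>\<sigma>. ratio_action n m \<sigma> w) ` {\<sigma>. \<sigma> permutes {1..m}}"
  then show "w' \<in> same_response_assignments n m w"
    using permuted_by_ratio_action[OF _ assms]
    by (auto simp: permuted_by_def same_response_assignments_def same_response_def)
qed

text \<open>When the ratios are pairwise different, those of the image tell from which layer each
  one came, so different permutations give different networks.\<close>

lemma card_same_response_assignments:
  assumes w: "w \<in> conductances n m" and inj: "inj_on (layer_ratio n w) {..<m}"
  shows "card (same_response_assignments n m w) = fact m"
proof -
  have "inj_on (\<lambda>\<sigma>. ratio_action n m \<sigma> w) {\<sigma>. \<sigma> permutes {1..m}}"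
  proof (rule inj_onI)
    fix \<sigma> \<tau> assume st: "\<sigma> \<in> {\<sigma>. \<sigma> permutes {1..m}}" "\<tau> \<in> {\<sigma>. \<sigma> permutes {1..m}}"
      and eq: "ratio_action n m \<sigma> w = ratio_action n m \<tau> w"
    have p: "\<sigma> permutes {1..m}" "\<tau> permutes {1..m}" using st by auto
    have "inv' \<sigma> i = inv' \<tau> i" for i
    proof (cases "i \<in> {1..m}")
      case True
      have r: "inv' \<sigma> i \<in> {1..m}" "inv' \<tau> i \<in> {1..m}"
        using permutes_in_image[OF permutes_inv[OF p(1)]] permutes_in_image[OF permutes_inv[OF p(2)]] True by blast+
      have "layer_ratio n w (inv' \<sigma> i - 1) = layer_ratio n w (inv' \<tau> i - 1)"
        using permuted_by_ratio_action[OF p(1) w] permuted_by_ratio_action[OF p(2) w] eq True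
        unfolding permuted_by_def by metis
      moreover have "inv' \<sigma> i - 1 \<in> {..<m}" "inv' \<tau> i - 1 \<in> {..<m}" using r by auto
      ultimately have "inv' \<sigma> i - 1 = inv' \<tau> i - 1" using inj by (meson inj_onD)
      then show ?thesis using r by auto
    next
      case False
      then show ?thesis
        using permutes_not_in[OF permutes_inv[OF p(1)]] permutes_not_in[OF permutes_inv[OF p(2)]] by simp
    qed
    then have "inv' \<sigma> = inv' \<tau>" by auto
    then show "\<sigma> = \<tau>" using permutes_inv_inv[OF p(1)] permutes_inv_inv[OF p(2)] by metis
  qed
  then show ?thesis
    unfolding same_response_assignments_eq_image[OF w] by (simp add: card_image card_permutations)
qed

end

section \<open>Generic networks have pairwise different ratios\<close>

lemma polynomial_functions_prod:
  "(\<And>x. x \<in> A \<Longrightarrow> p x \<in> polynomial_functions E) \<Longrightarrow> (\<lambda>w. \<Prod>x\<in>A. p x w) \<in> polynomial_functions E"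
  by (induction A rule: infinite_finite_induct) (auto intro: polynomial_functions.intros)

lemma polynomial_functions_diff:
  assumes "p \<in> polynomial_functions E" "q \<in> polynomial_functions E"
  shows "(\<lambda>w. p w - q w) \<in> polynomial_functions E"
  using polynomial_functions.add[OF assms(1) polynomial_functions.mult[OF polynomial_functions.const[of "- 1"] assms(2)]]
  by simp

lemma layer_ratio_eq:
  "layer_ratio n w k = (\<Prod>i<n. w (Diagonal k (int i))) / (\<Prod>i<n. w (Straight k (int i)))"
proof -
  have "diagonal n w k (int i) = w (Diagonal k (int i))" "straight n w k (int i) = w (Straight k (int i))" if "i < n" for i
    using that by (simp_all add: diagonal_def straight_def lift_def)
  then show ?thesis by (simp add: layer_ratio_def ratio_def prod_dividef)
qed

lemma generically_distinct_ratios: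
  assumes n: "1 \<le> n"
  shows "generically n m (\<lambda>w. inj_on (layer_ratio n w) {..<m})"
proof -
  define P where "P = (\<lambda>k w. \<Prod>i<n. w (Diagonal k (int i)) :: real)"
  define Q where "Q = (\<lambda>k w. \<Prod>i<n. w (Straight k (int i)) :: real)"
  define D where "D = {(k, l). k < m \<and> l < k}"
  have fD: "finite D" by (rule finite_subset[of _ "{..<m} \<times> {..<m}"]) (auto simp: D_def)
  \<comment> \<open>The product, over all pairs of layers, of the differences of their ratios with
    denominators cleared.\<close>
  define p where "p = (\<lambda>w. \<Prod>x\<in>D. P (fst x) w * Q (snd x) w - P (snd x) w * Q (fst x) w)"
  have PQ: "P k \<in> polynomial_functions (edges n m)" "Q k \<in> polynomial_functions (edges n m)" if "k < m" for k
    unfolding P_def Q_def using that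
    by (auto intro!: polynomial_functions_prod polynomial_functions.var simp: edges_def)
  have "p \<in> polynomial_functions (edges n m)"
    unfolding p_def
    by (intro polynomial_functions_prod polynomial_functions_diff polynomial_functions.mult PQ) (auto simp: D_def)
  moreover have "\<exists>w\<in>conductances n m. p w \<noteq> 0"
  proof
    \<comment> \<open>This gives layer \<open>k\<close> the ratio \<open>(k + 1) ^ n\<close>, which
      is strictly increasing in \<open>k\<close>.\<close>
    define w where "w = (\<lambda>e\<in>edges n m. case e of Straight k i \<Rightarrow> 1 | Diagonal k i \<Rightarrow> real k + 1)"
    show "w \<in> conductances n m"
      unfolding w_def conductances_def by (auto simp: restrict_PiE_iff split: edge.split)
    have "P k w = (real k + 1) ^ n" "Q k w = 1" if "k < m" for k
    proof -
      have "Diagonal k (int i) \<in> edges n m" "Straight k (int i) \<in> edges n m" if "i < n" for i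
        using that \<open>k < m\<close> by (auto simp: edges_def)
      then show "P k w = (real k + 1) ^ n" "Q k w = 1" by (simp_all add: P_def Q_def w_def)
    qed
    then have "P k w * Q l w - P l w * Q k w \<noteq> 0" if "(k, l) \<in> D" for k l
      using that n power_strict_mono[of "real l + 1" "real k + 1" n] by (auto simp: D_def)
    then show "p w \<noteq> 0" using fD by (auto simp: p_def)
  qed
  moreover have "inj_on (layer_ratio n w) {..<m}" if w: "w \<in> conductances n m" and pw: "p w \<noteq> 0" for w
  proof (rule linorder_inj_onI')
    fix l k assume lk: "l \<in> {..<m}" "k \<in> {..<m}" "l < k"
    have "(k, l) \<in> D" using lk by (auto simp: D_def)
    then have "P k w * Q l w - P l w * Q k w \<noteq> 0" using pw fD by (auto simp: p_def)
    moreover have "0 < Q k w" if "k < m" for k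
    proof -
      have "0 < w (Straight k (int i))" if "i < n" for i
        using conductances_posD(1)[OF w n \<open>k < m\<close>, of "int i"] that by (simp add: straight_def lift_def)
      then show ?thesis by (auto simp: Q_def intro: prod_pos)
    qed
    then have "0 < Q k w" "0 < Q l w" using lk by auto
    moreover have "layer_ratio n w k = P k w / Q k w" for k by (simp add: layer_ratio_eq P_def Q_def)
    ultimately show "layer_ratio n w l \<noteq> layer_ratio n w k" by (auto simp: field_simps)
  qed
  ultimately show ?thesis unfolding generically_def by blast
qed

theorem theorem6p2:
  fixes n m :: nat
  assumes "n \<ge> 1" and "m \<ge> 1"
  shows "(\<exists>\<phi>. is_R_action n m \<phi> \<and>
           (\<forall>w\<in>conductances n m. same_response_assignments n m w = orbit (sym_group m) \<phi> w)) \<and>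
         generically n m (\<lambda>w. card (same_response_assignments n m w) = fact m)"
proof
  have "same_response_assignments n m w = orbit (sym_group m) (ratio_action n m) w" if "w \<in> conductances n m" for w
    unfolding same_response_assignments_eq_image[OF assms that] by (auto simp: orbit_def sym_group_carrier)
  then show "\<exists>\<phi>. is_R_action n m \<phi> \<and> (\<forall>w\<in>conductances n m. same_response_assignments n m w = orbit (sym_group m) \<phi> w)"
    using is_R_action_ratio_action[OF assms] by blast
  show "generically n m (\<lambda>w. card (same_response_assignments n m w) = fact m)"
    using generically_distinct_ratios[OF assms(1), of m] card_same_response_assignments[OF assms]
    unfolding generically_def by blast
qed

end
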